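(* Let $\mathbf{BM}_{\mathrm{comp}}\subset\mathbf{BM}$ denote the wide subcategory of the Borisov--Manin category of graphs with only the compression morphisms, and let $\widetilde{\mathbf{Gr}}_{\mathrm{gen}}\subset\widetilde{\mathbf{Gr}}$ denote the wide subcategory of the restricted Kleisli category with only generic morphisms. There is a canonical equivalence $$\Phi_2:\mathbf{BM}_{\mathrm{comp}}\xrightarrow{\ \sim\ }\widetilde{\mathbf{Gr}}_{\mathrm{gen}}^{\mathrm{op}}.$$
   Context: **The Borisov--Manin category $\mathbf{BM}$.** A BM graph is a quadruple $\tau=(V_\tau,F_\tau,\partial_\tau,j_\tau)$ with $V_\tau$ a set (of vertices), $F_\tau$ a set (of flags), $\partial_\tau:F_\tau\to V_\tau$ a map and $j_\tau:F_\tau\to F_\tau$ an involution. Fixed points of $j_\tau$ are called tails (their set is $T_\tau$); two-element $j_\tau$-orbits are called edges. A morphism $h:\tau\to\sigma$ is a triple $(h^F,h_V,j_h)$ with $h^F:F_\sigma\to F_\tau$ a map, $h_V:V_\tau\to V_\sigma$ a map, and $j_h$ an involution on $F_\tau\setminus h^F(F_\sigma)$ such that: (i) $h^F$ is injective and $h_V$ is surjective; (ii) $h^F(F_\sigma)$ and its complement are $j_\tau$-invariant; (ii') $j_h$ is fixpoint free and agrees with $j_\tau$ on those flags of its domain that belong to edges of $\tau$; (iii) if $f_\tau=h^F(f_\sigma)$ then $h_V(\partial_\tau f_\tau)=\partial_\sigma f_\sigma$, and for every $f\in F_\tau\setminus h^F(F_\sigma)$ one has $h_V(\partial_\tau f)=h_V(\partial_\tau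 j_h(f))$; (iv) the bijection $(h^F)^{-1}:h^F(F_\sigma)\to F_\sigma$ maps edges of $\tau$ to edges of $\sigma$. The composite of $g:\tau\to\sigma$ and $c:\sigma\to\rho$ is $h=c\circ g$ with $h_V=c_V\circ g_V$, $h^F=g^F\circ c^F$, and $j_h$ equal to $j_g$ on $F_\tau\setminus g^F(F_\sigma)$ and to $j_c$ (transported along the injection $g^F$) on $g^F(F_\sigma\setminus c^F(F_\rho))$. A morphism $h:\tau\to\sigma$ is a compression when $h^F$ is bijective on tails, i.e. restricts to a bijection $T_\sigma\to T_\tau$. **Joyal--Kock graphs.** A graph in the sense of Joyal--Kock is a diagram of finite sets $A\xleftarrow{s}H\xrightarrow{p}V$ together with a fixpoint-free involution $i:A\to A$, with $s$ injective. $V$: vertices, $H$: half-edges (flags), $A$: arcs. An edge is an $i$-orbit; an inner edge is an $i$-orbit with both elements in the image of $s$; an edge is isolated if neither of its arcs is in the image of $s$. A port is an arc not in the image of $s$. An etale morphism of graphs is a triple of maps on $A,H,V$ commuting with $i,s,p$ and such that the square involving $p:H\to V$ is a pullback. $\mathbf{Gr}$ is the category of graphs and etale morphisms. A graph is effective if it is nonempty and has no isolated edges. **Elementary graphs and graphical species.** The unit graph $\mathsf I$ has two arcs interchanged by $i$ and $H=V=\emptyset$. For a finite set $n$, the corolla $\mathsf n$ has $V=1$, $H=n'$ a copy of $n$, $A=n+n'$, $s$ the inclusion of $n'$, and $i$ interchanging the two copies; its set of ports is $n$. $\mathbf{elGr}\subset\mathbf{Gr}$ is the full subcategory of the unit graph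 and the corollas. A graphical species is a presheaf $F:\mathbf{elGr}^{\mathrm{op}}\to\mathbf{Set}$. A graph $\mathsf G$ is regarded as the graphical species $\operatorname{Hom}_{\mathbf{Gr}}(-,\mathsf G)$ (a fully faithful embedding). An $F$-decoration of $\mathsf G$ is a natural transformation $\mathsf G\to F$. **The monad.** For a finite set $n$, an $\mathsf n$-graph is a graph with a bijection between $n$ and its set of ports. For a graphical species $F$ let $\overline F[\mathsf I]:=F[\mathsf I]$ and let $\overline F[\mathsf n]$ be the set of isomorphism classes (isomorphisms respecting the port labelling and the decoration) of effective $\mathsf n$-graphs equipped with an $F$-decoration; this is a graphical species. Gluing: given a graph $\mathsf R$ without isolated edges and $\phi:\mathsf R\to\overline F$, for each vertex $x$ of $\mathsf R$ put $n_x=p^{-1}(x)$; the canonical etale map from the corolla $\mathsf n_x$ to $\mathsf R$ at $x$ (sending the port $f\in n_x$ to the arc $i(s(f))$) is sent by $\phi$ to an element represented by an effective $\mathsf n_x$-graph $\mathsf S_x$ with ports $q(f)$, $f\in n_x$, and an $F$-decoration. Let $\mathsf S$ be obtained from the disjoint union of all $\mathsf S_x$ by identifying, for each inner edge $\{s(f),s(f')\}$ of $\mathsf R$, the arc $q(f)$ with $i(q(f'))$ and $i(q(f))$ with $q(f')$ (this is a colimit in $\mathbf{Gr}$, indexed by the category of elements of $\mathsf R$). The decorations induce an $F$-decoration $\mathsf S\to F$, well defined up to isomorphism, and the ports of $\mathsf S$ are canonically in bijection with the ports of $\mathsf R$. Applying gluing to effective $\mathsf n$-graphs $\mathsf R$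 decorated by $\overline F$ gives the multiplication $\overline{\overline F}\to\overline F$; the unit $F\to\overline F$ regards an $F$-decorated corolla as an $F$-decorated $\mathsf n$-graph. This is a monad on the category of graphical species. **Restricted Kleisli category.** $\widetilde{\mathbf{Gr}}$ has as objects the graphs without isolated edges (including the empty graph) and as morphisms $\mathsf R\to\mathsf Y$ the natural transformations $\mathsf R\to\overline{\mathsf Y}$, with Kleisli composition. A morphism $\mathsf R\to\mathsf Y$ of $\widetilde{\mathbf{Gr}}$ is generic (a refinement) if the etale morphism $\mathsf S\to\mathsf Y$ obtained by gluing (with $F=\mathsf Y$) is invertible.
   Formalization: Borisov–Manin graphs are taken with finite sets of vertices and flags; with arbitrary sets the claim fails, since Joyal–Kock graphs are finite and infinite BM graphs would have no counterpart. *)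

theory Defs
  imports Main "HOL-Library.FuncSet" "HOL-Library.Infinite_Typeclass"
begin

text \<open>
  Conventions.  All maps between carrier sets are extensional (value \<open>undefined\<close> off the
  carrier), so that HOL equality of morphisms is equality of maps.  Finite sets are finite subsets
  of an arbitrary infinite type \<open>'u\<close>; arcs of the objects of \<open>Gr\<close> are taken in \<open>'u + 'u\<close>, which
  leaves room for \<open>n + n'\<close> in corollas.  Graphs over other types (such as the result of a gluing)
  also occur; isomorphism classes always consist of graphs over the universe.
\<close>

section \<open>Categories, functors, equivalences\<close>

record ('o, 'm) category =
  Ob :: "'o set"
  Hom :: "'o \<Rightarrow> 'o \<Rightarrow> 'm set"
  Ident :: "'o \<Rightarrow> 'm"
  Cmp :: "'o \<Rightarrow> 'o \<Rightarrow> 'o \<Rightarrow> 'm \<Rightarrow> 'm \<Rightarrow> 'm"  \<comment> \<open>\<open>Cmp C X Y Z g f\<close> is \<open>g\<close> after \<open>f\<close>, for \<open>f : X \<rightarrow> Y\<close>, \<open>g : Y \<rightarrow> Z\<close>\<close>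

definition is_category :: "('o, 'm) category \<Rightarrow> bool" where
  "is_category C \<longleftrightarrow>
     (\<forall>X\<in>Ob C. Ident C X \<in> Hom C X X) \<and>
     (\<forall>X\<in>Ob C. \<forall>Y\<in>Ob C. \<forall>Z\<in>Ob C. \<forall>f\<in>Hom C X Y. \<forall>g\<in>Hom C Y Z. Cmp C X Y Z g f \<in> Hom C X Z) \<and>
     (\<forall>X\<in>Ob C. \<forall>Y\<in>Ob C. \<forall>f\<in>Hom C X Y.
        Cmp C X X Y f (Ident C X) = f \<and> Cmp C X Y Y (Ident C Y) f = f) \<and>
     (\<forall>X\<in>Ob C. \<forall>Y\<in>Ob C. \<forall>Z\<in>Ob C. \<forall>W\<in>Ob C. \<forall>f\<in>Hom C X Y. \<forall>g\<in>Hom C Y Z. \<forall>h\<in>Hom C Z W.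
        Cmp C X Z W h (Cmp C X Y Z g f) = Cmp C X Y W (Cmp C Y Z W h g) f)"

definition op_cat :: "('o, 'm) category \<Rightarrow> ('o, 'm) category" where
  "op_cat C = \<lparr>Ob = Ob C, Hom = (\<lambda>X Y. Hom C Y X), Ident = Ident C,
               Cmp = (\<lambda>X Y Z g f. Cmp C Z Y X f g)\<rparr>"

definition wide_sub :: "('o, 'm) category \<Rightarrow> ('o \<Rightarrow> 'o \<Rightarrow> 'm \<Rightarrow> bool) \<Rightarrow> ('o, 'm) category" where
  "wide_sub C P = C\<lparr>Hom := (\<lambda>X Y. {f \<in> Hom C X Y. P X Y f})\<rparr>"

record ('o, 'm, 'p, 'n) func =
  FOb :: "'o \<Rightarrow> 'p"
  FMor :: "'o \<Rightarrow> 'o \<Rightarrow> 'm \<Rightarrow> 'n"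

definition is_functor ::
    "('o, 'm) category \<Rightarrow> ('p, 'n) category \<Rightarrow> ('o, 'm, 'p, 'n) func \<Rightarrow> bool" where
  "is_functor C D F \<longleftrightarrow> is_category C \<and> is_category D \<and>
     (\<forall>X\<in>Ob C. FOb F X \<in> Ob D) \<and>
     (\<forall>X\<in>Ob C. \<forall>Y\<in>Ob C. \<forall>f\<in>Hom C X Y. FMor F X Y f \<in> Hom D (FOb F X) (FOb F Y)) \<and>
     (\<forall>X\<in>Ob C. FMor F X X (Ident C X) = Ident D (FOb F X)) \<and>
     (\<forall>X\<in>Ob C. \<forall>Y\<in>Ob C. \<forall>Z\<in>Ob C. \<forall>f\<in>Hom C X Y. \<forall>g\<in>Hom C Y Z.
        FMor F X Z (Cmp C X Y Z g f) =
        Cmp D (FOb F X) (FOb F Y) (FOb F Z) (FMor F Y Z g) (FMor F X Y f))"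

definition id_func :: "('o, 'm, 'o, 'm) func" where
  "id_func = \<lparr>FOb = (\<lambda>X. X), FMor = (\<lambda>X Y f. f)\<rparr>"

definition comp_func ::
    "('p, 'n, 'q, 'k) func \<Rightarrow> ('o, 'm, 'p, 'n) func \<Rightarrow> ('o, 'm, 'q, 'k) func" where
  "comp_func G F = \<lparr>FOb = (\<lambda>X. FOb G (FOb F X)),
                    FMor = (\<lambda>X Y f. FMor G (FOb F X) (FOb F Y) (FMor F X Y f))\<rparr>"

definition is_iso :: "('o, 'm) category \<Rightarrow> 'o \<Rightarrow> 'o \<Rightarrow> 'm \<Rightarrow> bool" where
  "is_iso C X Y f \<longleftrightarrow> f \<in> Hom C X Y \<and>
     (\<exists>g\<in>Hom C Y X. Cmp C X Y X g f = Ident C X \<and> Cmp C Y X Y f g = Ident C Y)"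

definition nat_iso :: "('o, 'm) category \<Rightarrow> ('p, 'n) category \<Rightarrow>
    ('o, 'm, 'p, 'n) func \<Rightarrow> ('o, 'm, 'p, 'n) func \<Rightarrow> ('o \<Rightarrow> 'n) \<Rightarrow> bool" where
  "nat_iso C D F G \<eta> \<longleftrightarrow>
     (\<forall>X\<in>Ob C. is_iso D (FOb F X) (FOb G X) (\<eta> X)) \<and>
     (\<forall>X\<in>Ob C. \<forall>Y\<in>Ob C. \<forall>f\<in>Hom C X Y.
        Cmp D (FOb F X) (FOb F Y) (FOb G Y) (\<eta> Y) (FMor F X Y f) =
        Cmp D (FOb F X) (FOb G X) (FOb G Y) (FMor G X Y f) (\<eta> X))"

definition is_equivalence ::
    "('o, 'm) category \<Rightarrow> ('p, 'n) category \<Rightarrow> ('o, 'm, 'p, 'n) func \<Rightarrow> bool" where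
  "is_equivalence C D F \<longleftrightarrow> is_functor C D F \<and>
     (\<exists>G \<eta> \<epsilon>. is_functor D C G \<and>
        nat_iso C C id_func (comp_func G F) \<eta> \<and> nat_iso D D (comp_func F G) id_func \<epsilon>)"


section \<open>The Borisov--Manin category\<close>

record 'u bm_graph =
  bm_verts :: "'u set"
  bm_flags :: "'u set"
  bd :: "'u \<Rightarrow> 'u"
  jinv :: "'u \<Rightarrow> 'u"

text \<open>Finiteness is imposed because the graphs of Joyal and Kock are finite.\<close>

definition is_bm_graph :: "'u bm_graph \<Rightarrow> bool" where
  "is_bm_graph \<tau> \<longleftrightarrow> finite (bm_verts \<tau>) \<and> finite (bm_flags \<tau>) \<and>
     bd \<tau> \<in> bm_flags \<tau> \<rightarrow> bm_verts \<tau> \<and>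
     jinv \<tau> \<in> bm_flags \<tau> \<rightarrow> bm_flags \<tau> \<and> (\<forall>f\<in>bm_flags \<tau>. jinv \<tau> (jinv \<tau> f) = f)"

definition tails :: "'u bm_graph \<Rightarrow> 'u set" where
  "tails \<tau> = {f \<in> bm_flags \<tau>. jinv \<tau> f = f}"

definition bm_edges :: "'u bm_graph \<Rightarrow> 'u set set" where
  "bm_edges \<tau> = {{f, jinv \<tau> f} | f. f \<in> bm_flags \<tau> \<and> jinv \<tau> f \<noteq> f}"

record 'u bm_mor =
  mF :: "'u \<Rightarrow> 'u"
  mV :: "'u \<Rightarrow> 'u"
  mj :: "'u \<Rightarrow> 'u"

definition is_bm_mor :: "'u bm_graph \<Rightarrow> 'u bm_graph \<Rightarrow> 'u bm_mor \<Rightarrow> bool" where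
  "is_bm_mor \<tau> \<sigma> h \<longleftrightarrow>
     (let I = mF h ` bm_flags \<sigma>; K = bm_flags \<tau> - mF h ` bm_flags \<sigma> in
       mF h \<in> bm_flags \<sigma> \<rightarrow>\<^sub>E bm_flags \<tau> \<and> mV h \<in> bm_verts \<tau> \<rightarrow>\<^sub>E bm_verts \<sigma> \<and>
       mj h \<in> K \<rightarrow>\<^sub>E K \<and> (\<forall>f\<in>K. mj h (mj h f) = f) \<and>
       inj_on (mF h) (bm_flags \<sigma>) \<and> mV h ` bm_verts \<tau> = bm_verts \<sigma> \<and>
       jinv \<tau> ` I \<subseteq> I \<and> jinv \<tau> ` K \<subseteq> K \<and>
       (\<forall>f\<in>K. mj h f \<noteq> f) \<and> (\<forall>f\<in>K. f \<in> \<Union>(bm_edges \<tau>) \<longrightarrow> mj h f = jinv \<tau> f) \<and>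
       (\<forall>f\<in>bm_flags \<sigma>. mV h (bd \<tau> (mF h f)) = bd \<sigma> f) \<and>
       (\<forall>f\<in>K. mV h (bd \<tau> f) = mV h (bd \<tau> (mj h f))) \<and>
       (\<forall>E\<in>bm_edges \<tau>. E \<subseteq> I \<longrightarrow> inv_into (bm_flags \<sigma>) (mF h) ` E \<in> bm_edges \<sigma>))"

definition bm_id :: "'u bm_graph \<Rightarrow> 'u bm_mor" where
  "bm_id \<tau> = \<lparr>mF = (\<lambda>f\<in>bm_flags \<tau>. f), mV = (\<lambda>v\<in>bm_verts \<tau>. v), mj = (\<lambda>f\<in>{}. f)\<rparr>"

definition bm_comp ::
    "'u bm_graph \<Rightarrow> 'u bm_graph \<Rightarrow> 'u bm_graph \<Rightarrow> 'u bm_mor \<Rightarrow> 'u bm_mor \<Rightarrow> 'u bm_mor" where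
  "bm_comp \<tau> \<sigma> \<rho> c g =
     \<lparr>mF = (\<lambda>f\<in>bm_flags \<rho>. mF g (mF c f)),
      mV = (\<lambda>v\<in>bm_verts \<tau>. mV c (mV g v)),
      mj = (\<lambda>f\<in>bm_flags \<tau> - (\<lambda>f. mF g (mF c f)) ` bm_flags \<rho>.
              if f \<in> mF g ` bm_flags \<sigma>
              then mF g (mj c (inv_into (bm_flags \<sigma>) (mF g) f)) else mj g f)\<rparr>"

definition BM :: "('u bm_graph, 'u bm_mor) category" where
  "BM = \<lparr>Ob = {\<tau>. is_bm_graph \<tau>}, Hom = (\<lambda>\<tau> \<sigma>. {h. is_bm_mor \<tau> \<sigma> h}),
         Ident = bm_id, Cmp = bm_comp\<rparr>"

definition is_compression :: "'u bm_graph \<Rightarrow> 'u bm_graph \<Rightarrow> 'u bm_mor \<Rightarrow> bool" where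
  "is_compression \<tau> \<sigma> h \<longleftrightarrow> bij_betw (mF h) (tails \<sigma>) (tails \<tau>)"

definition BM_comp :: "('u bm_graph, 'u bm_mor) category" where
  "BM_comp = wide_sub BM is_compression"


section \<open>Joyal--Kock graphs and etale morphisms\<close>

record ('a, 'h, 'v) graph =
  arcs :: "'a set"
  hedges :: "'h set"
  verts :: "'v set"
  flip :: "'a \<Rightarrow> 'a"
  src :: "'h \<Rightarrow> 'a"
  vtx :: "'h \<Rightarrow> 'v"

type_synonym 'u ugraph = "('u + 'u, 'u, 'u) graph"

definition is_graph :: "('a, 'h, 'v) graph \<Rightarrow> bool" where
  "is_graph G \<longleftrightarrow> finite (arcs G) \<and> finite (hedges G) \<and> finite (verts G) \<and>
     flip G \<in> arcs G \<rightarrow> arcs G \<and> (\<forall>a\<in>arcs G. flip G (flip G a) = a \<and> flip G a \<noteq> a) \<and>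
     src G \<in> hedges G \<rightarrow> arcs G \<and> inj_on (src G) (hedges G) \<and>
     vtx G \<in> hedges G \<rightarrow> verts G"

definition ports :: "('a, 'h, 'v) graph \<Rightarrow> 'a set" where
  "ports G = arcs G - src G ` hedges G"

definition no_isolated_edges :: "('a, 'h, 'v) graph \<Rightarrow> bool" where
  "no_isolated_edges G \<longleftrightarrow> (\<forall>a\<in>arcs G. \<not> (a \<in> ports G \<and> flip G a \<in> ports G))"

definition effective :: "('a, 'h, 'v) graph \<Rightarrow> bool" where
  "effective G \<longleftrightarrow> is_graph G \<and> \<not> (arcs G = {} \<and> hedges G = {} \<and> verts G = {}) \<and>
     no_isolated_edges G"

record ('a, 'h, 'v, 'b, 'k, 'w) gmap =
  onA :: "'a \<Rightarrow> 'b"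
  onH :: "'h \<Rightarrow> 'k"
  onV :: "'v \<Rightarrow> 'w"

type_synonym ('u, 'a, 'h, 'v) probe = "('u + 'u, 'u, 'u, 'a, 'h, 'v) gmap"

text \<open>The last conjunct says that the square on \<open>vtx\<close> is a pullback.\<close>

definition etale ::
    "('a, 'h, 'v) graph \<Rightarrow> ('b, 'k, 'w) graph \<Rightarrow> ('a, 'h, 'v, 'b, 'k, 'w) gmap \<Rightarrow> bool" where
  "etale X Y m \<longleftrightarrow>
     onA m \<in> arcs X \<rightarrow>\<^sub>E arcs Y \<and> onH m \<in> hedges X \<rightarrow>\<^sub>E hedges Y \<and> onV m \<in> verts X \<rightarrow>\<^sub>E verts Y \<and>
     (\<forall>a\<in>arcs X. onA m (flip X a) = flip Y (onA m a)) \<and>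
     (\<forall>h\<in>hedges X. onA m (src X h) = src Y (onH m h)) \<and>
     (\<forall>h\<in>hedges X. onV m (vtx X h) = vtx Y (onH m h)) \<and>
     (\<forall>v\<in>verts X. \<forall>k\<in>hedges Y. vtx Y k = onV m v \<longrightarrow>
        (\<exists>!h. h \<in> hedges X \<and> vtx X h = v \<and> onH m h = k))"

definition gid :: "('a, 'h, 'v) graph \<Rightarrow> ('a, 'h, 'v, 'a, 'h, 'v) gmap" where
  "gid X = \<lparr>onA = (\<lambda>a\<in>arcs X. a), onH = (\<lambda>h\<in>hedges X. h), onV = (\<lambda>v\<in>verts X. v)\<rparr>"

definition gcomp :: "('a, 'h, 'v) graph \<Rightarrow> ('b, 'k, 'w, 'c, 'l, 'z) gmap \<Rightarrow>
    ('a, 'h, 'v, 'b, 'k, 'w) gmap \<Rightarrow> ('a, 'h, 'v, 'c, 'l, 'z) gmap" where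
  "gcomp X g f = \<lparr>onA = (\<lambda>a\<in>arcs X. onA g (onA f a)), onH = (\<lambda>h\<in>hedges X. onH g (onH f h)),
                  onV = (\<lambda>v\<in>verts X. onV g (onV f v))\<rparr>"

definition giso ::
    "('a, 'h, 'v) graph \<Rightarrow> ('b, 'k, 'w) graph \<Rightarrow> ('a, 'h, 'v, 'b, 'k, 'w) gmap \<Rightarrow> bool" where
  "giso X Y h \<longleftrightarrow> etale X Y h \<and> (\<exists>k. etale Y X k \<and> gcomp X k h = gid X \<and> gcomp Y h k = gid Y)"


section \<open>Elementary graphs and graphical species\<close>

text \<open>In the corolla on \<open>n\<close>, \<open>Inr\<close> embeds the copy \<open>n'\<close> (the arcs in the image of \<open>src\<close>) and
  \<open>Inl\<close> embeds \<open>n\<close> (the ports).\<close>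

datatype 'u el = Unit | Corolla "'u set"

definition el_ob :: "'u el set" where
  "el_ob = insert Unit {Corolla n | n. finite n}"

definition swap_sum :: "'u + 'u \<Rightarrow> 'u + 'u" where
  "swap_sum = case_sum Inr Inl"

definition unit_graph :: "'u ugraph" where
  "unit_graph = \<lparr>arcs = {Inl undefined, Inr undefined}, hedges = {}, verts = {},
                 flip = swap_sum, src = Inr, vtx = (\<lambda>_. undefined)\<rparr>"

definition corolla :: "'u set \<Rightarrow> 'u ugraph" where
  "corolla n = \<lparr>arcs = Inl ` n \<union> Inr ` n, hedges = n, verts = {undefined},
                flip = swap_sum, src = Inr, vtx = (\<lambda>_. undefined)\<rparr>"

fun el_graph :: "'u el \<Rightarrow> 'u ugraph" where
  "el_graph Unit = unit_graph"
| "el_graph (Corolla n) = corolla n"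

definition el_hom :: "'u el \<Rightarrow> ('a, 'h, 'v) graph \<Rightarrow> ('u, 'a, 'h, 'v) probe set" where
  "el_hom e Y = {m. etale (el_graph e) Y m}"

record ('u, 'x) species =
  val :: "'u el \<Rightarrow> 'x set"
  act :: "'u el \<Rightarrow> 'u el \<Rightarrow> ('u, 'u + 'u, 'u, 'u) probe \<Rightarrow> 'x \<Rightarrow> 'x"
    \<comment> \<open>\<open>act F e d m : val F d \<rightarrow> val F e\<close> for \<open>m : e \<rightarrow> d\<close>\<close>

definition is_species :: "('u, 'x) species \<Rightarrow> bool" where
  "is_species F \<longleftrightarrow>
     (\<forall>e\<in>el_ob. \<forall>d\<in>el_ob. \<forall>m\<in>el_hom e (el_graph d). act F e d m \<in> val F d \<rightarrow> val F e) \<and>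
     (\<forall>e\<in>el_ob. \<forall>x\<in>val F e. act F e e (gid (el_graph e)) x = x) \<and>
     (\<forall>e\<in>el_ob. \<forall>d\<in>el_ob. \<forall>c\<in>el_ob. \<forall>m\<in>el_hom e (el_graph d). \<forall>k\<in>el_hom d (el_graph c).
        \<forall>x\<in>val F c. act F e c (gcomp (el_graph e) k m) x = act F e d m (act F d c k x))"

type_synonym ('u, 'x, 'y) nat_tr = "'u el \<Rightarrow> 'x \<Rightarrow> 'y"

definition nat_trans :: "('u, 'x) species \<Rightarrow> ('u, 'y) species \<Rightarrow> ('u, 'x, 'y) nat_tr \<Rightarrow> bool" where
  "nat_trans F G \<theta> \<longleftrightarrow>
     \<theta> \<in> (\<Pi>\<^sub>E e\<in>el_ob. val F e \<rightarrow>\<^sub>E val G e) \<and>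
     (\<forall>e\<in>el_ob. \<forall>d\<in>el_ob. \<forall>m\<in>el_hom e (el_graph d). \<forall>x\<in>val F d.
        \<theta> e (act F e d m x) = act G e d m (\<theta> d x))"

definition nat_comp ::
    "('u, 'x) species \<Rightarrow> ('u, 'y, 'z) nat_tr \<Rightarrow> ('u, 'x, 'y) nat_tr \<Rightarrow> ('u, 'x, 'z) nat_tr" where
  "nat_comp F \<psi> \<theta> = (\<lambda>e\<in>el_ob. \<lambda>x\<in>val F e. \<psi> e (\<theta> e x))"

definition rep :: "('a, 'h, 'v) graph \<Rightarrow> ('u, ('u, 'a, 'h, 'v) probe) species" where
  "rep Y = \<lparr>val = (\<lambda>e. el_hom e Y), act = (\<lambda>e d m k. gcomp (el_graph e) k m)\<rparr>"

definition rep_map :: "('a, 'h, 'v) graph \<Rightarrow> ('a, 'h, 'v, 'b, 'k, 'w) gmap \<Rightarrow>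
    ('u, ('u, 'a, 'h, 'v) probe, ('u, 'b, 'k, 'w) probe) nat_tr" where
  "rep_map X h = (\<lambda>e\<in>el_ob. \<lambda>m\<in>el_hom e X. gcomp (el_graph e) h m)"


lemma etale_gcomp:
  assumes f: "etale X Y f" and g: "etale Y Z g" and X: "is_graph X"
  shows "etale X Z (gcomp X g f)"
proof -
  have fP: "onA f \<in> arcs X \<rightarrow> arcs Y" "onH f \<in> hedges X \<rightarrow> hedges Y" "onV f \<in> verts X \<rightarrow> verts Y"
    and gP: "onA g \<in> arcs Y \<rightarrow> arcs Z" "onH g \<in> hedges Y \<rightarrow> hedges Z" "onV g \<in> verts Y \<rightarrow> verts Z"
    using f g by (auto simp: etale_def)
  have fE: "\<forall>a\<in>arcs X. onA f (flip X a) = flip Y (onA f a)"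
      "\<forall>h\<in>hedges X. onA f (src X h) = src Y (onH f h)"
      "\<forall>h\<in>hedges X. onV f (vtx X h) = vtx Y (onH f h)"
    and gE: "\<forall>a\<in>arcs Y. onA g (flip Y a) = flip Z (onA g a)"
      "\<forall>h\<in>hedges Y. onA g (src Y h) = src Z (onH g h)"
      "\<forall>h\<in>hedges Y. onV g (vtx Y h) = vtx Z (onH g h)"
    using f g unfolding etale_def by blast+
  have XP: "flip X \<in> arcs X \<rightarrow> arcs X" "src X \<in> hedges X \<rightarrow> arcs X" "vtx X \<in> hedges X \<rightarrow> verts X"
    using X unfolding is_graph_def by blast+
  have "\<exists>!h. h \<in> hedges X \<and> vtx X h = v \<and> onH (gcomp X g f) h = k"
    if v: "v \<in> verts X" and k: "k \<in> hedges Z" "vtx Z k = onV (gcomp X g f) v" for v k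
  proof -
    have fv: "onV f v \<in> verts Y" using fP v by blast
    have "\<exists>!l. l \<in> hedges Y \<and> vtx Y l = onV f v \<and> onH g l = k"
      using g fv k v unfolding etale_def by (simp add: gcomp_def)
    then obtain l where l: "l \<in> hedges Y" "vtx Y l = onV f v" "onH g l = k"
      and l_unique: "\<And>l'. l' \<in> hedges Y \<and> vtx Y l' = onV f v \<and> onH g l' = k \<Longrightarrow> l' = l" by blast
    have "\<exists>!h. h \<in> hedges X \<and> vtx X h = v \<and> onH f h = l"
      using f v l unfolding etale_def by simp
    then obtain h where h: "h \<in> hedges X" "vtx X h = v" "onH f h = l"
      and h_unique: "\<And>h'. h' \<in> hedges X \<and> vtx X h' = v \<and> onH f h' = l \<Longrightarrow> h' = h" by blast
    show ?thesis
    proof (rule ex1I[of _ h])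
      show "h \<in> hedges X \<and> vtx X h = v \<and> onH (gcomp X g f) h = k"
        using h l by (simp add: gcomp_def)
      fix h' assume h': "h' \<in> hedges X \<and> vtx X h' = v \<and> onH (gcomp X g f) h' = k"
      have "onH f h' \<in> hedges Y" using fP h' by blast
      moreover have "vtx Y (onH f h') = onV f v" using fE(3) h' by auto
      moreover have "onH g (onH f h') = k" using h' by (auto simp: gcomp_def)
      ultimately show "h' = h" using h_unique l_unique h' by blast
    qed
  qed
  moreover have "onA (gcomp X g f) \<in> arcs X \<rightarrow>\<^sub>E arcs Z" "onH (gcomp X g f) \<in> hedges X \<rightarrow>\<^sub>E hedges Z"
    "onV (gcomp X g f) \<in> verts X \<rightarrow>\<^sub>E verts Z"
    using fP gP by (simp_all add: gcomp_def Pi_iff)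
  moreover have "\<forall>a\<in>arcs X. onA (gcomp X g f) (flip X a) = flip Z (onA (gcomp X g f) a)"
    "\<forall>h\<in>hedges X. onA (gcomp X g f) (src X h) = src Z (onH (gcomp X g f) h)"
    "\<forall>h\<in>hedges X. onV (gcomp X g f) (vtx X h) = vtx Z (onH (gcomp X g f) h)"
    using fP XP fE gE by (simp_all add: gcomp_def Pi_iff)
  ultimately show ?thesis unfolding etale_def by blast
qed

lemma is_graph_el_graph: "e \<in> el_ob \<Longrightarrow> is_graph (el_graph e)"
  by (auto simp: el_ob_def is_graph_def unit_graph_def corolla_def swap_sum_def)

lemma is_species_rep:
  fixes Y :: "('a, 'h, 'v) graph"
  shows "is_species (rep Y :: ('u, ('u, 'a, 'h, 'v) probe) species)"
proof -
  have 1: "gcomp (el_graph e) k m \<in> el_hom e Y"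
    if "e \<in> el_ob" "m \<in> el_hom e (el_graph d)" "k \<in> el_hom d Y" for e d :: "'u el" and m k
    using etale_gcomp[of "el_graph e" "el_graph d" m Y k] is_graph_el_graph[of e] that
    by (simp add: el_hom_def)
  have 2: "gcomp (el_graph e) k (gid (el_graph e)) = k" if "k \<in> el_hom e Y" for e :: "'u el" and k
  proof -
    have "onA k \<in> extensional (arcs (el_graph e))" "onH k \<in> extensional (hedges (el_graph e))"
      "onV k \<in> extensional (verts (el_graph e))"
      using that by (simp_all add: el_hom_def etale_def PiE_def)
    then have "restrict (onA k) (arcs (el_graph e)) = onA k"
      "restrict (onH k) (hedges (el_graph e)) = onH k" "restrict (onV k) (verts (el_graph e)) = onV k"
      by (simp_all add: extensional_restrict)
    then show ?thesis by (cases k) (simp add: gcomp_def gid_def cong: restrict_cong)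
  qed
  have 3: "gcomp (el_graph e) x (gcomp (el_graph e) k m) = gcomp (el_graph e) (gcomp (el_graph d) x k) m"
    if "m \<in> el_hom e (el_graph d)"
    for e d :: "'u el" and m k and x :: "('u + 'u, 'u, 'u, 'a, 'h, 'v) gmap"
  proof -
    have "\<And>a. a \<in> arcs (el_graph e) \<Longrightarrow> onA m a \<in> arcs (el_graph d)"
      "\<And>a. a \<in> hedges (el_graph e) \<Longrightarrow> onH m a \<in> hedges (el_graph d)"
      "\<And>a. a \<in> verts (el_graph e) \<Longrightarrow> onV m a \<in> verts (el_graph d)"
      using that by (auto simp: el_hom_def etale_def)
    then show ?thesis by (simp add: gcomp_def cong: restrict_cong)
  qed
  show ?thesis
    unfolding is_species_def
    by (intro conjI ballI funcsetI; unfold rep_def species.simps) (rule 1, assumption+, rule 2, assumption, rule 3, assumption)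
qed


section \<open>Decorated graphs with labelled ports\<close>

record ('u, 'a, 'h, 'v, 'x) dgraph =
  gr :: "('a, 'h, 'v) graph"
  lab :: "'u \<Rightarrow> 'a"
  dec :: "('u, ('u, 'a, 'h, 'v) probe, 'x) nat_tr"

type_synonym ('u, 'x) udgraph = "('u, 'u + 'u, 'u, 'u, 'x) dgraph"

definition is_dgraph ::
    "('u, 'x) species \<Rightarrow> 'u set \<Rightarrow> ('u, 'a, 'h, 'v, 'x) dgraph \<Rightarrow> bool" where
  "is_dgraph F n D \<longleftrightarrow>
     effective (gr D) \<and> bij_betw (lab D) n (ports (gr D)) \<and> nat_trans (rep (gr D)) F (dec D)"

definition diso :: "'u set \<Rightarrow> ('u, 'a, 'h, 'v, 'x) dgraph \<Rightarrow> ('u, 'b, 'k, 'w, 'x) dgraph \<Rightarrow> bool" where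
  "diso n D D' \<longleftrightarrow> (\<exists>h. giso (gr D) (gr D') h \<and> (\<forall>k\<in>n. onA h (lab D k) = lab D' k) \<and>
     (\<forall>e\<in>el_ob. \<forall>m\<in>el_hom e (gr D). dec D' e (gcomp (el_graph e) h m) = dec D e m))"

definition iso_class ::
    "('u, 'x) species \<Rightarrow> 'u set \<Rightarrow> ('u, 'a, 'h, 'v, 'x) dgraph \<Rightarrow> ('u, 'x) udgraph set" where
  "iso_class F n D = {D'. is_dgraph F n D' \<and> diso n D D'}"


section \<open>The monad\<close>

type_synonym ('u, 'x) bar = "'x + ('u, 'x) udgraph set"

text \<open>The arc of a labelled graph corresponding to an arc of the corolla on the label set.\<close>

definition corolla_arc :: "('u, 'a, 'h, 'v, 'x) dgraph \<Rightarrow> 'u + 'u \<Rightarrow> 'a" where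
  "corolla_arc D = case_sum (lab D) (\<lambda>k. flip (gr D) (lab D k))"

definition unit_probe :: "('u + 'u \<Rightarrow> 'a) \<Rightarrow> ('u, 'a, 'h, 'v) probe" where
  "unit_probe p = \<lparr>onA = (\<lambda>a\<in>arcs unit_graph. p a), onH = (\<lambda>h\<in>{}. undefined),
                   onV = (\<lambda>v\<in>{}. undefined)\<rparr>"

text \<open>Only the cases \<open>Unit \<rightarrow> Unit\<close>, \<open>Unit \<rightarrow> Corolla n\<close> and \<open>Corolla k \<rightarrow> Corolla n\<close> occur: there is
  no etale map from a corolla to the unit graph.\<close>

fun bar_act :: "('u, 'x) species \<Rightarrow> 'u el \<Rightarrow> 'u el \<Rightarrow> ('u, 'u + 'u, 'u, 'u) probe \<Rightarrow>
    ('u, 'x) bar \<Rightarrow> ('u, 'x) bar" where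
  "bar_act F Unit Unit m y = Inl (act F Unit Unit m (projl y))"
| "bar_act F Unit (Corolla n) m y =
     (let D = (SOME D. D \<in> projr y)
      in Inl (dec D Unit (unit_probe (\<lambda>a. corolla_arc D (onA m a)))))"
| "bar_act F (Corolla k) (Corolla n) m y =
     Inr (\<Union>D\<in>projr y. iso_class F k (D\<lparr>lab := (\<lambda>i. lab D (onH m i))\<rparr>))"
| "bar_act F (Corolla k) Unit m y = undefined"

fun bar_val :: "('u, 'x) species \<Rightarrow> 'u el \<Rightarrow> ('u, 'x) bar set" where
  "bar_val F Unit = Inl ` val F Unit"
| "bar_val F (Corolla n) =
     {Inr (iso_class F n D) | D :: ('u, 'x) udgraph. is_dgraph F n D}"

definition bar :: "('u, 'x) species \<Rightarrow> ('u, ('u, 'x) bar) species" where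
  "bar F = \<lparr>val = bar_val F, act = bar_act F\<rparr>"

definition bar_map :: "('u, 'x) species \<Rightarrow> ('u, 'y) species \<Rightarrow> ('u, 'x, 'y) nat_tr \<Rightarrow>
    ('u, ('u, 'x) bar, ('u, 'y) bar) nat_tr" where
  "bar_map F G \<theta> = (\<lambda>e\<in>el_ob. \<lambda>y\<in>val (bar F) e. case e of
       Unit \<Rightarrow> Inl (\<theta> Unit (projl y))
     | Corolla n \<Rightarrow> Inr (\<Union>D\<in>projr y. iso_class G n
           \<lparr>gr = gr D, lab = lab D, dec = nat_comp (rep (gr D)) \<theta> (dec D)\<rparr>))"

definition unit_tr :: "('u, 'x) species \<Rightarrow> ('u, 'x, ('u, 'x) bar) nat_tr" where
  "unit_tr F = (\<lambda>e\<in>el_ob. \<lambda>x\<in>val F e. case e of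
       Unit \<Rightarrow> Inl x
     | Corolla n \<Rightarrow> Inr (iso_class F n
           \<lparr>gr = corolla n, lab = Inl,
            dec = (\<lambda>d\<in>el_ob. \<lambda>m\<in>el_hom d (corolla n). act F d (Corolla n) m x)\<rparr>))"

subsection \<open>Gluing\<close>

definition flags_at :: "('a, 'h, 'v) graph \<Rightarrow> 'v \<Rightarrow> 'h set" where
  "flags_at R x = {f \<in> hedges R. vtx R f = x}"

definition corolla_at :: "('a, 'u, 'v) graph \<Rightarrow> 'v \<Rightarrow> ('u, 'a, 'u, 'v) probe" where
  "corolla_at R x =
     \<lparr>onA = (\<lambda>a\<in>arcs (corolla (flags_at R x)). case a of Inl f \<Rightarrow> flip R (src R f) | Inr f \<Rightarrow> src R f),
      onH = (\<lambda>f\<in>flags_at R x. f), onV = (\<lambda>v\<in>{undefined}. x)\<rparr>"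

definition piece :: "'u ugraph \<Rightarrow> ('u, ('u, 'u + 'u, 'u, 'u) probe, ('u, 'x) bar) nat_tr \<Rightarrow>
    'u \<Rightarrow> ('u, 'x) udgraph" where
  "piece R \<phi> x = (SOME D. D \<in> projr (\<phi> (Corolla (flags_at R x)) (corolla_at R x)))"

context
  fixes R :: "'u ugraph" and S :: "'u \<Rightarrow> ('u, 'x) udgraph"
    \<comment> \<open>\<open>S x\<close> replaces the vertex \<open>x\<close> of \<open>R\<close>\<close>
begin

definition glue_arcs :: "('u \<times> ('u + 'u)) set" where
  "glue_arcs = (SIGMA x:verts R. arcs (gr (S x)))"

text \<open>The condition on \<open>(f, f')\<close> is symmetric, so both identifications along an inner edge are
  included.\<close>

definition glue_step :: "(('u \<times> ('u + 'u)) \<times> ('u \<times> ('u + 'u))) set" where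
  "glue_step = {((vtx R f, lab (S (vtx R f)) f),
                 (vtx R f', flip (gr (S (vtx R f'))) (lab (S (vtx R f')) f'))) | f f'.
                 f \<in> hedges R \<and> f' \<in> hedges R \<and> flip R (src R f) = src R f'}"

definition glue_class :: "'u \<times> ('u + 'u) \<Rightarrow> ('u \<times> ('u + 'u)) set" where
  "glue_class p = (glue_step \<union> glue_step\<inverse>)\<^sup>* `` {p}"

definition glue_graph :: "(('u \<times> ('u + 'u)) set, 'u \<times> 'u, 'u \<times> 'u) graph" where
  "glue_graph =
     \<lparr>arcs = glue_class ` glue_arcs,
      hedges = (SIGMA x:verts R. hedges (gr (S x))),
      verts = (SIGMA x:verts R. verts (gr (S x))),
      flip = (\<lambda>X. (\<lambda>(x, a). (x, flip (gr (S x)) a)) ` X),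
      src = (\<lambda>(x, h). glue_class (x, src (gr (S x)) h)),
      vtx = (\<lambda>(x, h). (x, vtx (gr (S x)) h))\<rparr>"

definition glue_incl ::
    "'u \<Rightarrow> ('u + 'u, 'u, 'u, ('u \<times> ('u + 'u)) set, 'u \<times> 'u, 'u \<times> 'u) gmap" where
  "glue_incl x = \<lparr>onA = (\<lambda>a\<in>arcs (gr (S x)). glue_class (x, a)),
                  onH = (\<lambda>h\<in>hedges (gr (S x)). (x, h)),
                  onV = (\<lambda>v\<in>verts (gr (S x)). (x, v))\<rparr>"

text \<open>The decoration induced on the colimit: the unique one that restricts along each \<open>glue_incl x\<close>
  to the decoration of \<open>S x\<close>.\<close>

definition glue_dec ::
    "('u, ('u, ('u \<times> ('u + 'u)) set, 'u \<times> 'u, 'u \<times> 'u) probe, 'x) nat_tr" where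
  "glue_dec = (\<lambda>e\<in>el_ob. \<lambda>m\<in>el_hom e glue_graph.
     THE y. \<exists>x\<in>verts R. \<exists>k\<in>el_hom e (gr (S x)).
       m = gcomp (el_graph e) (glue_incl x) k \<and> y = dec (S x) e k)"

text \<open>A port \<open>a\<close> of \<open>R\<close> (having no isolated edges) is \<open>flip R (src R f)\<close> for a unique \<open>f\<close>, and
  corresponds to the port \<open>f\<close> of the piece at the vertex of \<open>f\<close>.\<close>

definition glue_port :: "'u + 'u \<Rightarrow> ('u \<times> ('u + 'u)) set" where
  "glue_port a = (let f = (THE f. f \<in> hedges R \<and> flip R (src R f) = a)
                  in glue_class (vtx R f, lab (S (vtx R f)) f))"

end

definition glue :: "('u, ('u, 'x) bar) udgraph \<Rightarrow>
    ('u, ('u \<times> ('u + 'u)) set, 'u \<times> 'u, 'u \<times> 'u, 'x) dgraph" where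
  "glue D = (let S = piece (gr D) (dec D) in
     \<lparr>gr = glue_graph (gr D) S, lab = (\<lambda>k. glue_port (gr D) S (lab D k)), dec = glue_dec (gr D) S\<rparr>)"

definition mult_tr :: "('u, 'x) species \<Rightarrow> ('u, ('u, ('u, 'x) bar) bar, ('u, 'x) bar) nat_tr" where
  "mult_tr F = (\<lambda>e\<in>el_ob. \<lambda>y\<in>val (bar (bar F)) e. case e of
       Unit \<Rightarrow> projl y
     | Corolla n \<Rightarrow> Inr (\<Union>D\<in>projr y. iso_class F n (glue D)))"


section \<open>The restricted Kleisli category and its generic morphisms\<close>

type_synonym 'u kl_mor =
  "('u, ('u, 'u + 'u, 'u, 'u) probe, ('u, ('u, 'u + 'u, 'u, 'u) probe) bar) nat_tr"

definition kl_comp ::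
    "'u ugraph \<Rightarrow> 'u ugraph \<Rightarrow> 'u ugraph \<Rightarrow> 'u kl_mor \<Rightarrow> 'u kl_mor \<Rightarrow> 'u kl_mor" where
  "kl_comp R Y Z \<psi> \<phi> =
     nat_comp (rep R) (mult_tr (rep Z)) (nat_comp (rep R) (bar_map (rep Y) (bar (rep Z)) \<psi>) \<phi>)"

definition Gr_tilde :: "('u ugraph, 'u kl_mor) category" where
  "Gr_tilde = \<lparr>Ob = {R. is_graph R \<and> no_isolated_edges R},
               Hom = (\<lambda>R Y. {\<phi>. nat_trans (rep R) (bar (rep Y)) \<phi>}),
               Ident = (\<lambda>R. unit_tr (rep R)), Cmp = kl_comp\<rparr>"

text \<open>The gluing carries a decoration by \<open>rep Y\<close>, which corresponds to an etale map to \<open>Y\<close> via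
  \<open>rep_map\<close>.\<close>

definition is_generic :: "'u ugraph \<Rightarrow> 'u ugraph \<Rightarrow> 'u kl_mor \<Rightarrow> bool" where
  "is_generic R Y \<phi> \<longleftrightarrow> (\<exists>h. giso (glue_graph R (piece R \<phi>)) Y h \<and>
     glue_dec R (piece R \<phi>) = rep_map (glue_graph R (piece R \<phi>)) h)"

definition Gr_tilde_gen :: "('u ugraph, 'u kl_mor) category" where
  "Gr_tilde_gen = wide_sub Gr_tilde is_generic"


section \<open>The functor\<close>

text \<open>A BM graph is turned into a graph by adding, for each tail, one new arc (a port): flags are
  the arcs \<open>Inr f\<close>, the added arcs are \<open>Inl t\<close>.\<close>

definition phi_ob :: "'u bm_graph \<Rightarrow> 'u ugraph" where
  "phi_ob \<tau> = \<lparr>arcs = Inl ` tails \<tau> \<union> Inr ` bm_flags \<tau>, hedges = bm_flags \<tau>, verts = bm_verts \<tau>,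
     flip = (\<lambda>a. case a of Inl t \<Rightarrow> Inr t
                         | Inr f \<Rightarrow> if jinv \<tau> f = f then Inl f else Inr (jinv \<tau> f)),
     src = Inr, vtx = bd \<tau>\<rparr>"

text \<open>The part of \<open>\<tau>\<close> contracted by \<open>h : \<tau> \<rightarrow> \<sigma>\<close> to the vertex \<open>x\<close>: edges contracted by \<open>h\<close> are
  kept, all other flags become tails.\<close>

definition fibre :: "'u bm_graph \<Rightarrow> 'u bm_graph \<Rightarrow> 'u bm_mor \<Rightarrow> 'u \<Rightarrow> 'u bm_graph" where
  "fibre \<tau> \<sigma> h x =
     \<lparr>bm_verts = {v \<in> bm_verts \<tau>. mV h v = x},
      bm_flags = {f \<in> bm_flags \<tau>. mV h (bd \<tau> f) = x},
      bd = bd \<tau>, jinv = (\<lambda>f. if f \<in> mF h ` bm_flags \<sigma> then f else mj h f)\<rparr>"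

definition fibre_map ::
    "'u bm_graph \<Rightarrow> 'u bm_graph \<Rightarrow> 'u bm_mor \<Rightarrow> 'u \<Rightarrow> ('u, 'u + 'u, 'u, 'u) probe" where
  "fibre_map \<tau> \<sigma> h x = (let X = phi_ob (fibre \<tau> \<sigma> h x) in
     \<lparr>onA = (\<lambda>a\<in>arcs X. case a of Inl f \<Rightarrow> flip (phi_ob \<tau>) (Inr f) | Inr f \<Rightarrow> Inr f),
      onH = (\<lambda>f\<in>hedges X. f), onV = (\<lambda>v\<in>verts X. v)\<rparr>)"

text \<open>On arcs the image of \<open>h\<close> is given by \<open>mF h\<close>; a corolla of \<open>phi_ob \<sigma>\<close> at the vertex \<open>x\<close> goes to
  the fibre over \<open>x\<close> with its canonical etale map to \<open>phi_ob \<tau>\<close>.\<close>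

definition phi_mor :: "'u bm_graph \<Rightarrow> 'u bm_graph \<Rightarrow> 'u bm_mor \<Rightarrow> 'u kl_mor" where
  "phi_mor \<tau> \<sigma> h = (\<lambda>e\<in>el_ob. \<lambda>m\<in>el_hom e (phi_ob \<sigma>). case e of
       Unit \<Rightarrow> Inl (unit_probe (\<lambda>a. map_sum (mF h) (mF h) (onA m a)))
     | Corolla n \<Rightarrow> (let x = onV m undefined; X = phi_ob (fibre \<tau> \<sigma> h x) in
         Inr (iso_class (rep (phi_ob \<tau>)) n
           \<lparr>gr = X, lab = (\<lambda>k. Inl (mF h (onH m k))), dec = rep_map X (fibre_map \<tau> \<sigma> h x)\<rparr>)))"

definition Phi2 :: "('u bm_graph, 'u bm_mor, 'u ugraph, 'u kl_mor) func" where
  "Phi2 = \<lparr>FOb = phi_ob, FMor = phi_mor\<rparr>"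

end

theory Submission
  imports Defs
begin

text \<open>
  An etale map into \<open>Y\<close> that is injective on vertices amounts to cutting out a set of vertices of
  \<open>Y\<close> along certain flags.  An \<open>n\<close>-labelled graph decorated in this way by \<open>Y\<close> is therefore
  determined up to isomorphism by its set \<open>W\<close> of vertices of \<open>Y\<close> and by the arcs of \<open>Y\<close> at which
  its labelled ports lie.  A compression \<open>h\<close> from the flags and vertices of \<open>Y\<close> to those of \<open>R\<close>
  thus gives a Kleisli morphism from \<open>R\<close> to \<open>Y\<close>: an arc goes to its image under the flag map, and a
  corolla at \<open>x\<close> to the class given by the fibre of \<open>h\<close> over \<open>x\<close>.  Gluing such pieces again yields
  a graph cut out of \<open>Y\<close>, on the union of the fibres, so these morphisms are generic and compose like
  the compressions.  Conversely, an isomorphism from the gluing of a generic morphism onto \<open>Y\<close>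
  embeds all pieces into \<open>Y\<close>, and the vertex sets of the pieces are the fibres of a compression.
  This identifies the two categories on hom sets, and every graph without isolated edges is
  isomorphic to one obtained from its vertices and flags.  Associativity of the Kleisli composition
  is only needed for generic morphisms, where it is inherited from the compressions.
\<close>

text \<open>What makes classes computable is a rigidity: without isolated edges every arc is some
  \<open>src h\<close> or its flip, so an etale map is determined by half-edges and vertices, and an
  etale map injective on vertices can be cancelled on the left. Two graphs cut out of
  \<open>Y\<close> with equal vertex sets and equal port positions therefore have mutually inverse
  comparison maps over \<open>Y\<close>, and results do not depend on the representative chosen by
  \<open>SOME\<close> in \<open>piece\<close> or \<open>bar_act\<close>. Injectivity on vertices
  does not give injectivity on arcs: an edge of \<open>Y\<close> that is cut while both of its ends
  are kept is covered by two edges. This is why port positions are recorded next to the vertex set.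
  Directions are opposite: a compression goes from the finer graph to the coarser one, the Kleisli
  morphism from the coarser \<open>R\<close> to the finer \<open>Y\<close>. The passage from
  compressions to Kleisli morphisms is set up between arbitrary objects of \<open>Gr_tilde\<close>,
  so that it serves \<open>Phi2\<close> as well as an explicit quasi-inverse that forgets
  ports.\<close>

text \<open>A compression contracts no tails, so its involution is forced to be the restriction of
  \<open>jinv \<tau>\<close>.\<close>

definition comp_mor :: "'u bm_graph \<Rightarrow> 'u bm_graph \<Rightarrow> 'u bm_mor \<Rightarrow> bool" where
  "comp_mor \<tau> \<sigma> h \<longleftrightarrow>
     mF h \<in> bm_flags \<sigma> \<rightarrow>\<^sub>E bm_flags \<tau> \<and> inj_on (mF h) (bm_flags \<sigma>) \<and>
     mV h \<in> bm_verts \<tau> \<rightarrow>\<^sub>E bm_verts \<sigma> \<and> mV h ` bm_verts \<tau> = bm_verts \<sigma> \<and>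
     mj h = restrict (jinv \<tau>) (bm_flags \<tau> - mF h ` bm_flags \<sigma>) \<and>
     (\<forall>f\<in>bm_flags \<sigma>. jinv \<tau> (mF h f) = mF h (jinv \<sigma> f)) \<and>
     (\<forall>f\<in>bm_flags \<sigma>. mV h (bd \<tau> (mF h f)) = bd \<sigma> f) \<and>
     (\<forall>f\<in>bm_flags \<tau> - mF h ` bm_flags \<sigma>.
        jinv \<tau> f \<noteq> f \<and> mV h (bd \<tau> (jinv \<tau> f)) = mV h (bd \<tau> f))"

section \<open>The category of BM graphs and compressions\<close>

lemma bm_graphD:
  assumes "is_bm_graph \<tau>"
  shows "finite (bm_verts \<tau>)" "finite (bm_flags \<tau>)"
    "f \<in> bm_flags \<tau> \<Longrightarrow> bd \<tau> f \<in> bm_verts \<tau>" "f \<in> bm_flags \<tau> \<Longrightarrow> jinv \<tau> f \<in> bm_flags \<tau>"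
    "f \<in> bm_flags \<tau> \<Longrightarrow> jinv \<tau> (jinv \<tau> f) = f"
  using assms by (auto simp: is_bm_graph_def)

lemma comp_morD:
  assumes "comp_mor \<tau> \<sigma> h"
  shows "f \<in> bm_flags \<sigma> \<Longrightarrow> mF h f \<in> bm_flags \<tau>"
    "inj_on (mF h) (bm_flags \<sigma>)"
    "v \<in> bm_verts \<tau> \<Longrightarrow> mV h v \<in> bm_verts \<sigma>"
    "mV h ` bm_verts \<tau> = bm_verts \<sigma>"
    "mj h = restrict (jinv \<tau>) (bm_flags \<tau> - mF h ` bm_flags \<sigma>)"
    "f \<in> bm_flags \<sigma> \<Longrightarrow> jinv \<tau> (mF h f) = mF h (jinv \<sigma> f)"
    "f \<in> bm_flags \<sigma> \<Longrightarrow> mV h (bd \<tau> (mF h f)) = bd \<sigma> f"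
    "f \<in> bm_flags \<tau> \<Longrightarrow> f \<notin> mF h ` bm_flags \<sigma> \<Longrightarrow> jinv \<tau> f \<noteq> f"
    "f \<in> bm_flags \<tau> \<Longrightarrow> f \<notin> mF h ` bm_flags \<sigma> \<Longrightarrow> mV h (bd \<tau> (jinv \<tau> f)) = mV h (bd \<tau> f)"
    "mF h \<in> extensional (bm_flags \<sigma>)" "mV h \<in> extensional (bm_verts \<tau>)"
  using assms unfolding comp_mor_def by (blast | auto simp: PiE_def)+

text \<open>\<open>mF h\<close> intertwines the involutions, so its image is stable under
  \<open>jinv \<tau>\<close>; an involution that preserves a set preserves its complement.\<close>

lemma comp_mor_compl_jinv:
  assumes "comp_mor \<tau> \<sigma> h" "is_bm_graph \<tau>" "is_bm_graph \<sigma>"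
    and f: "f \<in> bm_flags \<tau>" "f \<notin> mF h ` bm_flags \<sigma>"
  shows "jinv \<tau> f \<in> bm_flags \<tau> - mF h ` bm_flags \<sigma>"
proof -
  have "jinv \<tau> f \<notin> mF h ` bm_flags \<sigma>"
  proof
    assume "jinv \<tau> f \<in> mF h ` bm_flags \<sigma>"
    then obtain g where g: "g \<in> bm_flags \<sigma>" "jinv \<tau> f = mF h g" by blast
    then have "f = mF h (jinv \<sigma> g)"
      using comp_morD(6)[OF assms(1) g(1)] bm_graphD(5)[OF assms(2) f(1)] by simp
    then show False using f(2) bm_graphD(4)[OF assms(3) g(1)] by blast
  qed
  then show ?thesis using bm_graphD(4)[OF assms(2) f(1)] by blast
qed

text \<open>All tails of \<open>\<tau>\<close> come from tails of \<open>\<sigma>\<close>, so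
  contracted flags lie on edges of \<open>\<tau>\<close>, where the axioms prescribe
  \<open>mj h\<close>. On the remaining flags tails match tails, and the axiom that edges go to
  edges yields compatibility with the involutions.\<close>

lemma comp_mor_iff:
  assumes \<tau>: "is_bm_graph \<tau>" and \<sigma>: "is_bm_graph \<sigma>"
  shows "is_bm_mor \<tau> \<sigma> h \<and> is_compression \<tau> \<sigma> h \<longleftrightarrow> comp_mor \<tau> \<sigma> h"
proof (intro iffI)
  let ?I = "mF h ` bm_flags \<sigma>" and ?K = "bm_flags \<tau> - mF h ` bm_flags \<sigma>"
  assume A: "is_bm_mor \<tau> \<sigma> h \<and> is_compression \<tau> \<sigma> h"
  then have F: "mF h \<in> bm_flags \<sigma> \<rightarrow>\<^sub>E bm_flags \<tau>" and V: "mV h \<in> bm_verts \<tau> \<rightarrow>\<^sub>E bm_verts \<sigma>"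
    and J: "mj h \<in> ?K \<rightarrow>\<^sub>E ?K" and inj: "inj_on (mF h) (bm_flags \<sigma>)"
    and surj: "mV h ` bm_verts \<tau> = bm_verts \<sigma>" and invI: "jinv \<tau> ` ?I \<subseteq> ?I"
    and jj: "\<And>f. f \<in> ?K \<Longrightarrow> f \<in> \<Union>(bm_edges \<tau>) \<Longrightarrow> mj h f = jinv \<tau> f"
    and b1: "\<forall>f\<in>bm_flags \<sigma>. mV h (bd \<tau> (mF h f)) = bd \<sigma> f"
    and b2: "\<And>f. f\<in>?K \<Longrightarrow> mV h (bd \<tau> f) = mV h (bd \<tau> (mj h f))"
    and ed: "\<And>E. E\<in>bm_edges \<tau> \<Longrightarrow> E \<subseteq> ?I \<Longrightarrow> inv_into (bm_flags \<sigma>) (mF h) ` E \<in> bm_edges \<sigma>"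
    by (auto simp: is_bm_mor_def Let_def)
  have T: "mF h ` tails \<sigma> = tails \<tau>" using A by (auto simp: is_compression_def bij_betw_def)
  have Kn: "jinv \<tau> f \<noteq> f" if "f \<in> ?K" for f
  proof
    assume "jinv \<tau> f = f"
    then have "f \<in> tails \<tau>" using that by (simp add: tails_def)
    then show False using that T by (auto simp: tails_def)
  qed
  have Kj: "mj h f = jinv \<tau> f" if "f \<in> ?K" for f
  proof (rule jj[OF that])
    have "{f, jinv \<tau> f} \<in> bm_edges \<tau>" using that Kn[OF that] by (auto simp: bm_edges_def)
    then show "f \<in> \<Union>(bm_edges \<tau>)" by blast
  qed
  have C: "jinv \<tau> (mF h f) = mF h (jinv \<sigma> f)" if f: "f \<in> bm_flags \<sigma>" for f
  proof (cases "jinv \<sigma> f = f")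
    case True
    then have "mF h f \<in> tails \<tau>" using f T by (auto simp: tails_def)
    then show ?thesis using True by (simp add: tails_def)
  next
    case False
    \<comment> \<open>\<open>f\<close> is no tail, so by injectivity of \<open>mF h\<close> its
      image is none either. Hence \<open>?E\<close> is an edge inside the image, and its preimage
      has to be the edge of \<open>\<sigma>\<close> through \<open>f\<close>.\<close>
    let ?E = "{mF h f, jinv \<tau> (mF h f)}" and ?i = "inv_into (bm_flags \<sigma>) (mF h)"
    have "mF h f \<notin> tails \<tau>"
    proof
      assume "mF h f \<in> tails \<tau>"
      then obtain g where g: "g \<in> tails \<sigma>" "mF h f = mF h g" using T by (metis imageE)
      then have "f = g" using inj f by (auto simp: tails_def inj_on_def)
      then show False using g False by (simp add: tails_def)
    qed
    moreover have mf: "mF h f \<in> bm_flags \<tau>" using F f by blast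
    ultimately have "?E \<in> bm_edges \<tau>" by (auto simp: bm_edges_def tails_def)
    moreover have jI: "jinv \<tau> (mF h f) \<in> ?I" using invI f by blast
    ultimately have "?i ` ?E \<in> bm_edges \<sigma>" using ed[of ?E] f by blast
    then obtain g where g: "g \<in> bm_flags \<sigma>" "jinv \<sigma> g \<noteq> g" "?i ` ?E = {g, jinv \<sigma> g}"
      by (auto simp: bm_edges_def)
    have "?i (mF h f) = f" using inj f by simp
    then have "{f, ?i (jinv \<tau> (mF h f))} = {g, jinv \<sigma> g}" using g by simp
    then have "?i (jinv \<tau> (mF h f)) = jinv \<sigma> f"
      using g bm_graphD(5)[OF \<sigma> g(1)] by (metis doubleton_eq_iff)
    then show ?thesis using f_inv_into_f[OF jI] by metis
  qed
  have "mj h = restrict (jinv \<tau>) ?K"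
    using J Kj by (intro ext) (metis PiE_arb restrict_apply)
  then show "comp_mor \<tau> \<sigma> h"
    unfolding comp_mor_def using F V inj surj b1 b2 C Kn Kj by metis
next
  let ?I = "mF h ` bm_flags \<sigma>" and ?K = "bm_flags \<tau> - mF h ` bm_flags \<sigma>"
  assume c: "comp_mor \<tau> \<sigma> h"
  note D = comp_morD[OF c]
  have JK: "jinv \<tau> f \<in> ?K" if "f \<in> ?K" for f
    using comp_mor_compl_jinv[OF c \<tau> \<sigma>] that by blast
  have t1: "mF h f \<in> tails \<tau> \<longleftrightarrow> f \<in> tails \<sigma>" if f: "f \<in> bm_flags \<sigma>" for f
    using D(1,6)[OF f] inj_on_eq_iff[OF D(2) bm_graphD(4)[OF \<sigma> f] f] f by (auto simp: tails_def)
  have "mF h ` tails \<sigma> = tails \<tau>"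
  proof
    show "mF h ` tails \<sigma> \<subseteq> tails \<tau>" using t1 by (auto simp: tails_def)
    show "tails \<tau> \<subseteq> mF h ` tails \<sigma>"
    proof
      fix f assume f: "f \<in> tails \<tau>"
      then have "f \<in> ?I" using D(8)[of f] by (auto simp: tails_def)
      then show "f \<in> mF h ` tails \<sigma>" using t1 f by blast
    qed
  qed
  moreover have "inj_on (mF h) (tails \<sigma>)" using D(2) by (auto simp: tails_def inj_on_def)
  ultimately have "is_compression \<tau> \<sigma> h" by (simp add: is_compression_def bij_betw_def)
  moreover have "is_bm_mor \<tau> \<sigma> h"
    unfolding is_bm_mor_def Let_def
  proof (intro conjI)
    show "mF h \<in> bm_flags \<sigma> \<rightarrow>\<^sub>E bm_flags \<tau>" "mV h \<in> bm_verts \<tau> \<rightarrow>\<^sub>E bm_verts \<sigma>"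
      using c by (simp_all add: comp_mor_def)
    show "mj h \<in> ?K \<rightarrow>\<^sub>E ?K" using JK by (simp add: D(5))
    show "\<forall>f\<in>?K. mj h (mj h f) = f" using JK bm_graphD(5)[OF \<tau>] by (auto simp: D(5))
    show "inj_on (mF h) (bm_flags \<sigma>)" "mV h ` bm_verts \<tau> = bm_verts \<sigma>" by (fact D)+
    show "jinv \<tau> ` ?I \<subseteq> ?I" using D(6) bm_graphD(4)[OF \<sigma>] by auto
    show "jinv \<tau> ` ?K \<subseteq> ?K" by (intro image_subsetI JK)
    show "\<forall>f\<in>?K. mj h f \<noteq> f" using D(8) by (simp add: D(5))
    show "\<forall>f\<in>?K. f \<in> \<Union> (bm_edges \<tau>) \<longrightarrow> mj h f = jinv \<tau> f" by (simp add: D(5))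
    show "\<forall>f\<in>bm_flags \<sigma>. mV h (bd \<tau> (mF h f)) = bd \<sigma> f" using D(7) by blast
    show "\<forall>f\<in>?K. mV h (bd \<tau> f) = mV h (bd \<tau> (mj h f))" using D(9) by (simp add: D(5))
    show "\<forall>E\<in>bm_edges \<tau>. E \<subseteq> ?I \<longrightarrow> inv_into (bm_flags \<sigma>) (mF h) ` E \<in> bm_edges \<sigma>"
    proof (intro ballI impI)
      fix E assume E: "E \<in> bm_edges \<tau>" "E \<subseteq> ?I"
      then obtain f where f: "E = {f, jinv \<tau> f}" "jinv \<tau> f \<noteq> f" by (auto simp: bm_edges_def)
      then obtain g where g: "g \<in> bm_flags \<sigma>" "f = mF h g" using E by auto
      have "inv_into (bm_flags \<sigma>) (mF h) ` E = {g, jinv \<sigma> g}"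
        using f g D(2,6) bm_graphD(4)[OF \<sigma>] by simp
      moreover have "jinv \<sigma> g \<noteq> g" using f g D(6) by metis
      ultimately show "inv_into (bm_flags \<sigma>) (mF h) ` E \<in> bm_edges \<sigma>"
        using g by (auto simp: bm_edges_def)
    qed
  qed
  ultimately show "is_bm_mor \<tau> \<sigma> h \<and> is_compression \<tau> \<sigma> h" by blast
qed

lemma comp_mor_id: "is_bm_graph \<tau> \<Longrightarrow> comp_mor \<tau> \<tau> (bm_id \<tau>)"
  by (auto simp: comp_mor_def bm_id_def bm_graphD)

lemma bm_mor_eqI:
  "mF h = mF k \<Longrightarrow> mV h = mV k \<Longrightarrow> mj h = mj k \<Longrightarrow> h = (k :: 'u bm_mor)"
  by (cases h; cases k) simp

lemma comp_mor_eqI: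
  assumes "comp_mor \<tau> \<sigma> h" "comp_mor \<tau> \<sigma> k"
    and "\<And>f. f \<in> bm_flags \<sigma> \<Longrightarrow> mF h f = mF k f" "\<And>v. v \<in> bm_verts \<tau> \<Longrightarrow> mV h v = mV k v"
  shows "h = k"
proof (rule bm_mor_eqI)
  show F: "mF h = mF k"
    using extensionalityI[OF comp_morD(10)[OF assms(1)] comp_morD(10)[OF assms(2)]] assms(3) by blast
  show "mV h = mV k"
    using extensionalityI[OF comp_morD(11)[OF assms(1)] comp_morD(11)[OF assms(2)]] assms(4) by blast
  show "mj h = mj k"
    using comp_morD(5)[OF assms(1)] comp_morD(5)[OF assms(2)] F by simp
qed

text \<open>A flag contracted by the composite is either contracted by \<open>g\<close> or the image
  under \<open>mF g\<close> of a flag contracted by \<open>c\<close>. In the second case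
  transporting \<open>mj c\<close> along \<open>mF g\<close> gives \<open>jinv \<tau>\<close> again,
  because \<open>mF g\<close> commutes with the involutions.\<close>

lemma comp_mor_comp:
  assumes g: "comp_mor \<tau> \<sigma> g" and c: "comp_mor \<sigma> \<rho> c"
    and \<tau>: "is_bm_graph \<tau>" and \<sigma>: "is_bm_graph \<sigma>" and \<rho>: "is_bm_graph \<rho>"
  shows "comp_mor \<tau> \<rho> (bm_comp \<tau> \<sigma> \<rho> c g)"
proof -
  note G = comp_morD[OF g] and C = comp_morD[OF c]
  let ?h = "bm_comp \<tau> \<sigma> \<rho> c g"
  have F: "mF ?h = (\<lambda>f\<in>bm_flags \<rho>. mF g (mF c f))" and V: "mV ?h = (\<lambda>v\<in>bm_verts \<tau>. mV c (mV g v))"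
    by (simp_all add: bm_comp_def)
  have im: "mF ?h ` bm_flags \<rho> = mF g ` mF c ` bm_flags \<rho>" by (auto simp: F)
  have im2: "mF g f \<in> mF g ` mF c ` bm_flags \<rho> \<longleftrightarrow> f \<in> mF c ` bm_flags \<rho>" if "f \<in> bm_flags \<sigma>" for f
    using that G(2) C(1) by (auto simp: inj_on_def)
  have K: "jinv \<tau> f \<noteq> f \<and> mV ?h (bd \<tau> (jinv \<tau> f)) = mV ?h (bd \<tau> f) \<and> mj ?h f = jinv \<tau> f"
    if f: "f \<in> bm_flags \<tau> - mF ?h ` bm_flags \<rho>" for f
  proof (cases "f \<in> mF g ` bm_flags \<sigma>")
    case True
    then obtain f' where f': "f' \<in> bm_flags \<sigma>" "f = mF g f'" by blast
    have nc: "f' \<notin> mF c ` bm_flags \<rho>" using f f' im im2 by auto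
    have jf: "jinv \<tau> f = mF g (jinv \<sigma> f')" using f' G(6) by simp
    have "jinv \<sigma> f' \<noteq> f'" using C(8) f' nc by blast
    then have n: "jinv \<tau> f \<noteq> f"
      using jf f' inj_on_eq_iff[OF G(2) bm_graphD(4)[OF \<sigma> f'(1)] f'(1)] by auto
    have "mV c (bd \<sigma> (jinv \<sigma> f')) = mV c (bd \<sigma> f')" using C(9) f' nc by blast
    then have "mV ?h (bd \<tau> (jinv \<tau> f)) = mV ?h (bd \<tau> f)"
      using f' jf G(1,7) bm_graphD(3,4)[OF \<tau>] bm_graphD(3,4)[OF \<sigma>] by (simp add: V)
    moreover have "mj ?h f = jinv \<tau> f"
      using f im f' nc G(2) jf by (auto simp: bm_comp_def C(5) F)
    ultimately show ?thesis using n by blast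
  next
    case False
    then show ?thesis
      using f im G(8,9)[of f] bm_graphD(3,4)[OF \<tau>] by (auto simp: bm_comp_def G(5) V F)
  qed
  show ?thesis
    unfolding comp_mor_def
  proof (intro conjI)
    show "mF ?h \<in> bm_flags \<rho> \<rightarrow>\<^sub>E bm_flags \<tau>" using C(1) G(1) by (auto simp: F)
    show "inj_on (mF ?h) (bm_flags \<rho>)"
      unfolding F using C(1,2) G(2) by (auto simp: inj_on_def)
    show "mV ?h \<in> bm_verts \<tau> \<rightarrow>\<^sub>E bm_verts \<rho>" using C(3) G(3) by (auto simp: V)
    have "mV ?h ` bm_verts \<tau> = mV c ` mV g ` bm_verts \<tau>" by (auto simp: V)
    then show "mV ?h ` bm_verts \<tau> = bm_verts \<rho>" using C(4) G(4) by simp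
    show "mj ?h = restrict (jinv \<tau>) (bm_flags \<tau> - mF ?h ` bm_flags \<rho>)"
    proof
      fix f
      show "mj ?h f = restrict (jinv \<tau>) (bm_flags \<tau> - mF ?h ` bm_flags \<rho>) f"
      proof (cases "f \<in> bm_flags \<tau> - mF ?h ` bm_flags \<rho>")
        case True then show ?thesis using K by simp
      next
        case False then show ?thesis unfolding restrict_apply by (auto simp: bm_comp_def)
      qed
    qed
    show "\<forall>f\<in>bm_flags \<rho>. jinv \<tau> (mF ?h f) = mF ?h (jinv \<rho> f)"
      using C(1,6) G(6) bm_graphD(4)[OF \<rho>] by (simp add: F)
    show "\<forall>f\<in>bm_flags \<rho>. mV ?h (bd \<tau> (mF ?h f)) = bd \<rho> f"
      using C(1,7) G(1,7) bm_graphD(3)[OF \<tau>] by (simp add: F V)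
    show "\<forall>f\<in>bm_flags \<tau> - mF ?h ` bm_flags \<rho>.
        jinv \<tau> f \<noteq> f \<and> mV ?h (bd \<tau> (jinv \<tau> f)) = mV ?h (bd \<tau> f)" using K by blast
  qed
qed

lemma BM_comp_simps:
  "Ob BM_comp = {\<tau>. is_bm_graph \<tau>}" "Ident BM_comp = bm_id" "Cmp BM_comp = bm_comp"
  "is_bm_graph \<tau> \<Longrightarrow> is_bm_graph \<sigma> \<Longrightarrow> Hom BM_comp \<tau> \<sigma> = {h. comp_mor \<tau> \<sigma> h}"
  using comp_mor_iff by (auto simp: BM_comp_def wide_sub_def BM_def)

lemma bm_comp_id:
  assumes h: "comp_mor \<tau> \<sigma> h" and \<tau>: "is_bm_graph \<tau>" and \<sigma>: "is_bm_graph \<sigma>"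
  shows "bm_comp \<tau> \<tau> \<sigma> h (bm_id \<tau>) = h" "bm_comp \<tau> \<sigma> \<sigma> (bm_id \<sigma>) h = h"
  using comp_mor_comp[OF comp_mor_id[OF \<tau>] h \<tau> \<tau> \<sigma>] comp_mor_comp[OF h comp_mor_id[OF \<sigma>] \<tau> \<sigma> \<sigma>]
    comp_morD(1,3)[OF h] h
  by (auto intro!: comp_mor_eqI[OF _ h] simp: bm_comp_def bm_id_def)

lemma bm_comp_assoc:
  assumes f: "comp_mor X Y f" and g: "comp_mor Y Z g" and h: "comp_mor Z W h"
    and "is_bm_graph X" "is_bm_graph Y" "is_bm_graph Z" "is_bm_graph W"
  shows "bm_comp X Z W h (bm_comp X Y Z g f) = bm_comp X Y W (bm_comp Y Z W h g) f"
proof (rule comp_mor_eqI)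
  show "comp_mor X W (bm_comp X Z W h (bm_comp X Y Z g f))"
    "comp_mor X W (bm_comp X Y W (bm_comp Y Z W h g) f)"
    using assms by (auto intro: comp_mor_comp)
qed (use comp_morD(1,3)[OF f] comp_morD(1,3)[OF g] comp_morD(1,3)[OF h] in \<open>simp_all add: bm_comp_def\<close>)

lemma is_category_BM_comp: "is_category BM_comp"
  unfolding is_category_def
  by (auto simp: BM_comp_simps comp_mor_id comp_mor_comp bm_comp_id bm_comp_assoc)

section \<open>Rigidity of etale maps\<close>

lemma graphD:
  assumes "is_graph G"
  shows "a \<in> arcs G \<Longrightarrow> flip G a \<in> arcs G" "a \<in> arcs G \<Longrightarrow> flip G (flip G a) = a"
    "a \<in> arcs G \<Longrightarrow> flip G a \<noteq> a" "h \<in> hedges G \<Longrightarrow> src G h \<in> arcs G"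
    "h \<in> hedges G \<Longrightarrow> k \<in> hedges G \<Longrightarrow> src G h = src G k \<longleftrightarrow> h = k"
    "h \<in> hedges G \<Longrightarrow> vtx G h \<in> verts G"
    "finite (arcs G)" "finite (hedges G)" "finite (verts G)"
  using assms unfolding is_graph_def by (auto simp: inj_on_eq_iff Pi_iff)

text \<open>One of the two arcs of an edge is in the image of \<open>src\<close> as soon as the edge
  is not isolated. This split is how statements about arcs are reduced to half-edges below.\<close>

lemma arc_cases [consumes 3]:
  assumes "no_isolated_edges G" "is_graph G" "a \<in> arcs G"
  obtains (src) h where "h \<in> hedges G" "a = src G h"
    | (flip) h where "h \<in> hedges G" "a = flip G (src G h)"
proof -
  have "a \<notin> ports G \<or> flip G a \<notin> ports G" using assms by (auto simp: no_isolated_edges_def)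
  then have "a \<in> src G ` hedges G \<or> flip G a \<in> src G ` hedges G"
    using assms(3) graphD(1)[OF assms(2,3)] by (auto simp: ports_def)
  then show thesis using that graphD(2)[OF assms(2,3)] by (metis imageE)
qed

lemma port_cases:
  assumes "no_isolated_edges G" "is_graph G" "a \<in> ports G"
  obtains h where "h \<in> hedges G" "a = flip G (src G h)" "flip G a = src G h"
proof -
  have a: "a \<in> arcs G" "\<And>h. h \<in> hedges G \<Longrightarrow> a \<noteq> src G h" using assms(3) by (auto simp: ports_def)
  then obtain h where h: "h \<in> hedges G" "a = flip G (src G h)"
    using arc_cases[OF assms(1,2) a(1)] by metis
  then show thesis using that graphD(2,4)[OF assms(2)] by metis
qed

lemma etaleD:
  assumes "etale X Y m"
  shows "a \<in> arcs X \<Longrightarrow> onA m a \<in> arcs Y" "h \<in> hedges X \<Longrightarrow> onH m h \<in> hedges Y"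
    "v \<in> verts X \<Longrightarrow> onV m v \<in> verts Y" "a \<in> arcs X \<Longrightarrow> onA m (flip X a) = flip Y (onA m a)"
    "h \<in> hedges X \<Longrightarrow> onA m (src X h) = src Y (onH m h)"
    "h \<in> hedges X \<Longrightarrow> onV m (vtx X h) = vtx Y (onH m h)"
    "v \<in> verts X \<Longrightarrow> k \<in> hedges Y \<Longrightarrow> vtx Y k = onV m v \<Longrightarrow>
       \<exists>!h. h \<in> hedges X \<and> vtx X h = v \<and> onH m h = k"
    "onA m \<in> extensional (arcs X)" "onH m \<in> extensional (hedges X)" "onV m \<in> extensional (verts X)"
  using assms unfolding etale_def PiE_def by blast+

lemma etale_inj_star:
  assumes "etale X Y m" "is_graph X" "h \<in> hedges X" "h' \<in> hedges X"
    "vtx X h = vtx X h'" "onH m h = onH m h'"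
  shows "h = h'"
  using etaleD(7)[OF assms(1) graphD(6)[OF assms(2,3)] etaleD(2)[OF assms(1,3)]]
    etaleD(6)[OF assms(1,3)] assms by auto

text \<open>Half-edges with equal images have vertices with equal images, hence equal vertices, and
  the pullback square separates half-edges at one vertex. The argument has no analogue for arcs,
  since a port of \<open>X\<close> may share its image with the \<open>src\<close> of a
  half-edge.\<close>

lemma etale_inj_hedges:
  assumes m: "etale X Y m" and X: "is_graph X" and inj: "inj_on (onV m) (verts X)"
    and h: "h \<in> hedges X" "h' \<in> hedges X" "onH m h = onH m h'"
  shows "h = h'"
proof (rule etale_inj_star[OF m X h(1,2) _ h(3)])
  show "vtx X h = vtx X h'"
    using etaleD(6)[OF m h(1)] etaleD(6)[OF m h(2)] h(3)
    by (intro inj_onD[OF inj] graphD(6)[OF X] h) simp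
qed

lemma gmap_eqI: "onA m = onA k \<Longrightarrow> onH m = onH k \<Longrightarrow> onV m = onV k \<Longrightarrow>
    m = (k :: ('a, 'h, 'v, 'b, 'k, 'w) gmap)"
  by (cases m; cases k) simp

lemma etale_eqI:
  assumes m: "etale X Y m" and k: "etale X Y k"
    and A: "\<And>a. a \<in> arcs X \<Longrightarrow> onA m a = onA k a" and H: "\<And>h. h \<in> hedges X \<Longrightarrow> onH m h = onH k h"
    and V: "\<And>v. v \<in> verts X \<Longrightarrow> onV m v = onV k v"
  shows "m = k"
  by (intro gmap_eqI extensionalityI[OF etaleD(8)[OF m] etaleD(8)[OF k]] A
      extensionalityI[OF etaleD(9)[OF m] etaleD(9)[OF k]] H
      extensionalityI[OF etaleD(10)[OF m] etaleD(10)[OF k]] V)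

text \<open>Compatibility with \<open>src\<close> and \<open>flip\<close> fixes the value on every
  arc of the form \<open>src h\<close> or \<open>flip X (src X h)\<close>, and there are no
  others.\<close>

lemma etale_eqI_noiso:
  assumes m: "etale X Y m" and k: "etale X Y k" and X: "is_graph X" "no_isolated_edges X"
    and H: "\<And>h. h \<in> hedges X \<Longrightarrow> onH m h = onH k h" and V: "\<And>v. v \<in> verts X \<Longrightarrow> onV m v = onV k v"
  shows "m = k"
proof (rule etale_eqI[OF m k _ H V])
  fix a assume "a \<in> arcs X"
  with X(2,1) show "onA m a = onA k a"
  proof (cases rule: arc_cases)
    case (src h)
    then show ?thesis using H etaleD(5)[OF m] etaleD(5)[OF k] by simp
  next
    case (flip h)
    then show ?thesis
      using H graphD(4)[OF X(1)] etaleD(4,5)[OF m] etaleD(4,5)[OF k] by simp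
  qed
qed

text \<open>Injectivity of \<open>s\<close> on vertices passes to half-edges, and these data
  determine maps out of \<open>X\<close>. The lemma turns maps that commute with maps to a common
  target into mutually inverse ones.\<close>

lemma etale_cancel:
  assumes s: "etale Y Z s" "inj_on (onV s) (verts Y)" and m: "etale X Y m" "etale X Y k"
    and X: "is_graph X" "no_isolated_edges X" and Y: "is_graph Y" and eq: "gcomp X s m = gcomp X s k"
  shows "m = k"
proof (rule etale_eqI_noiso[OF m X])
  fix h assume h: "h \<in> hedges X"
  have "onH (gcomp X s m) h = onH (gcomp X s k) h" by (simp only: eq)
  then have "onH s (onH m h) = onH s (onH k h)" using h by (simp add: gcomp_def)
  then show "onH m h = onH k h"
    using etale_inj_hedges[OF s(1) Y s(2)] etaleD(2)[OF m(1) h] etaleD(2)[OF m(2) h] by blast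
next
  fix v assume v: "v \<in> verts X"
  have "onV (gcomp X s m) v = onV (gcomp X s k) v" by (simp only: eq)
  then have "onV s (onV m v) = onV s (onV k v)" using v by (simp add: gcomp_def)
  then show "onV m v = onV k v"
    using inj_onD[OF s(2)] etaleD(3)[OF m(1) v] etaleD(3)[OF m(2) v] by blast
qed

lemma gcomp_simps [simp]:
  "a \<in> arcs X \<Longrightarrow> onA (gcomp X g f) a = onA g (onA f a)"
  "h \<in> hedges X \<Longrightarrow> onH (gcomp X g f) h = onH g (onH f h)"
  "v \<in> verts X \<Longrightarrow> onV (gcomp X g f) v = onV g (onV f v)"
  by (simp_all add: gcomp_def)

lemma etale_gid: "is_graph X \<Longrightarrow> etale X X (gid X)"
  unfolding etale_def gid_def by (auto simp: graphD(1,4,6))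

lemma gcomp_gid_right:
  assumes "etale X Y m"
  shows "gcomp X m (gid X) = m"
  by (intro gmap_eqI)
    (simp_all add: gcomp_def gid_def extensional_restrict[OF etaleD(8)[OF assms]]
      extensional_restrict[OF etaleD(9)[OF assms]] extensional_restrict[OF etaleD(10)[OF assms]]
      cong: restrict_cong)

lemma gcomp_gid_left:
  assumes "etale X Y m"
  shows "gcomp X (gid Y) m = m"
  by (intro gmap_eqI)
    (simp_all add: gcomp_def gid_def etaleD(1-3)[OF assms] extensional_restrict[OF etaleD(8)[OF assms]]
      extensional_restrict[OF etaleD(9)[OF assms]] extensional_restrict[OF etaleD(10)[OF assms]]
      cong: restrict_cong)

lemma gcomp_assoc:
  assumes "etale X Y e"
  shows "gcomp X g (gcomp X f e) = gcomp X (gcomp Y g f) e"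
  by (simp add: gcomp_def etaleD(1-3)[OF assms] cong: restrict_cong)

lemma giso_gid: "is_graph X \<Longrightarrow> giso X X (gid X)"
  unfolding giso_def using etale_gid gcomp_gid_left by blast

section \<open>Probes\<close>

lemma el_obI [simp]: "Unit \<in> el_ob" "Corolla n \<in> el_ob \<longleftrightarrow> finite n"
  by (auto simp: el_ob_def)

lemma el_ob_cases:
  assumes "e \<in> el_ob" obtains "e = Unit" | n where "e = Corolla n" "finite n"
  using assms by (auto simp: el_ob_def)

lemma el_hom_gcomp:
  assumes "e \<in> el_ob" "m \<in> el_hom e X" "etale X Y s"
  shows "gcomp (el_graph e) s m \<in> el_hom e Y"
  using etale_gcomp[OF _ assms(3) is_graph_el_graph[OF assms(1)]] assms(2) by (simp add: el_hom_def)

lemma gcomp_assoc_el: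
  assumes "m \<in> el_hom e X"
  shows "gcomp (el_graph e) g (gcomp (el_graph e) f m) = gcomp (el_graph e) (gcomp X g f) m"
  using assms by (intro gcomp_assoc) (simp add: el_hom_def)

lemma rep_simps [simp]: "val (rep Y) e = el_hom e Y" "act (rep Y) e d m k = gcomp (el_graph e) k m"
  by (simp_all add: rep_def)

text \<open>A map out of the unit graph is the choice of one arc, by convention the image of
  \<open>Inl undefined\<close>; the other arc must go to the flip.\<close>

definition uprobe :: "('a, 'h, 'v) graph \<Rightarrow> 'a \<Rightarrow> ('u, 'a, 'h, 'v) probe" where
  "uprobe X a = unit_probe (case_sum (\<lambda>_. a) (\<lambda>_. flip X a))"

lemma unit_probe_cong:
  "p (Inl undefined) = q (Inl undefined) \<Longrightarrow> p (Inr undefined) = q (Inr undefined) \<Longrightarrow>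
   unit_probe p = unit_probe q"
  by (auto simp: unit_probe_def unit_graph_def)

lemma uprobe_sel [simp]:
  "onA (uprobe X a) (Inl undefined) = a" "onA (uprobe X a) (Inr undefined) = flip X a"
  by (simp_all add: uprobe_def unit_probe_def unit_graph_def)

lemma unit_probe_eq_uprobe:
  "p (Inr undefined) = flip X (p (Inl undefined)) \<Longrightarrow> unit_probe p = uprobe X (p (Inl undefined))"
  unfolding uprobe_def by (rule unit_probe_cong) simp_all

lemma uprobe_in:
  "is_graph X \<Longrightarrow> a \<in> arcs X \<Longrightarrow> uprobe X a \<in> el_hom Unit X"
  by (auto simp: el_hom_def etale_def uprobe_def unit_probe_def unit_graph_def swap_sum_def graphD)

lemma uprobe_cases:
  assumes "m \<in> el_hom Unit X"
  shows "m = uprobe X (onA m (Inl undefined))" "onA m (Inl undefined) \<in> arcs X"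
    "onA m (Inr undefined) = flip X (onA m (Inl undefined))"
proof -
  have e: "etale unit_graph X m" using assms by (simp add: el_hom_def)
  show 1: "onA m (Inl undefined) \<in> arcs X" by (rule etaleD(1)[OF e]) (simp add: unit_graph_def)
  show 2: "onA m (Inr undefined) = flip X (onA m (Inl undefined))"
    using etaleD(4)[OF e, of "Inl undefined"] by (simp add: unit_graph_def swap_sum_def)
  show "m = uprobe X (onA m (Inl undefined))"
  proof (rule gmap_eqI)
    show "onA m = onA (uprobe X (onA m (Inl undefined)))"
      using extensional_arb[OF etaleD(8)[OF e]] 2
      by (intro ext) (auto simp: uprobe_def unit_probe_def unit_graph_def restrict_def)
    show "onH m = onH (uprobe X (onA m (Inl undefined)))" "onV m = onV (uprobe X (onA m (Inl undefined)))"
      using etaleD(9,10)[OF e]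
      by (intro ext; simp add: uprobe_def unit_probe_def unit_graph_def extensional_def)+
  qed
qed

lemma gcomp_uprobe:
  assumes "etale X Y s" "is_graph X" "a \<in> arcs X"
  shows "gcomp unit_graph s (uprobe X a) = uprobe Y (onA s a)"
proof -
  have "gcomp (el_graph Unit) s (uprobe X a) \<in> el_hom Unit Y"
    by (rule el_hom_gcomp[OF _ uprobe_in[OF assms(2,3)] assms(1)]) simp
  from uprobe_cases(1)[OF this] show ?thesis by (simp add: unit_graph_def)
qed

text \<open>A map out of a corolla is a vertex \<open>v\<close> together with a bijection
  \<open>i\<close> from \<open>n\<close> to the half-edges at \<open>v\<close>. The port
  \<open>Inl k\<close> goes to the arc opposite \<open>src X (i k)\<close>.\<close>

definition cmap :: "('a, 'h, 'v) graph \<Rightarrow> 'u set \<Rightarrow> 'v \<Rightarrow> ('u \<Rightarrow> 'h) \<Rightarrow> ('u, 'a, 'h, 'v) probe" where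
  "cmap X n v i =
     \<lparr>onA = (\<lambda>a\<in>arcs (corolla n). case a of Inl k \<Rightarrow> flip X (src X (i k)) | Inr k \<Rightarrow> src X (i k)),
      onH = restrict i n, onV = (\<lambda>_\<in>{undefined}. v)\<rparr>"

lemma corolla_simps [simp]:
  "arcs (corolla n) = Inl ` n \<union> Inr ` n" "hedges (corolla n) = n" "verts (corolla n) = {undefined}"
  "flip (corolla n) (Inl k) = Inr k" "flip (corolla n) (Inr k) = Inl k" "src (corolla n) = Inr"
  "vtx (corolla n) k = undefined"
  by (simp_all add: corolla_def swap_sum_def)

lemma cmap_sel [simp]:
  "k \<in> n \<Longrightarrow> onA (cmap X n v i) (Inl k) = flip X (src X (i k))"
  "k \<in> n \<Longrightarrow> onA (cmap X n v i) (Inr k) = src X (i k)"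
  "k \<in> n \<Longrightarrow> onH (cmap X n v i) k = i k" "onV (cmap X n v i) undefined = v"
  by (simp_all add: cmap_def)

lemma cmap_cong:
  "v = v' \<Longrightarrow> (\<And>k. k \<in> n \<Longrightarrow> i k = i' k) \<Longrightarrow> cmap X n v i = cmap X n v' i'"
  by (auto simp: cmap_def fun_eq_iff restrict_def)

lemma cmap_in:
  assumes "is_graph X" "v \<in> verts X" "bij_betw i n (flags_at X v)"
  shows "cmap X n v i \<in> el_hom (Corolla n) X"
proof -
  have i: "i k \<in> hedges X" "vtx X (i k) = v" if "k \<in> n" for k
    using bij_betwE[OF assms(3)] that by (auto simp: flags_at_def)
  have u: "\<exists>!k. k \<in> n \<and> i k = l" if "l \<in> hedges X" "vtx X l = v" for l
  proof -
    have "l \<in> i ` n" using assms(3) that by (simp add: bij_betw_def flags_at_def)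
    then obtain k where k: "k \<in> n" "i k = l" by blast
    show ?thesis
      by (rule ex1I[of _ k]) (use k assms(3) in \<open>auto simp: bij_betw_def inj_on_def\<close>)
  qed
  show ?thesis
    unfolding el_hom_def etale_def mem_Collect_eq
  proof (intro conjI)
    show "onA (cmap X n v i) \<in> arcs (el_graph (Corolla n)) \<rightarrow>\<^sub>E arcs X"
      using i(1) graphD(1,4)[OF assms(1)] by (auto simp: cmap_def)
    show "\<forall>a\<in>arcs (el_graph (Corolla n)).
        onA (cmap X n v i) (flip (el_graph (Corolla n)) a) = flip X (onA (cmap X n v i) a)"
      using i(1) graphD(2,4)[OF assms(1)] by auto
    show "\<forall>k\<in>verts (el_graph (Corolla n)). \<forall>l\<in>hedges X. vtx X l = onV (cmap X n v i) k \<longrightarrow>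
        (\<exists>!h. h \<in> hedges (el_graph (Corolla n)) \<and> vtx (el_graph (Corolla n)) h = k \<and>
          onH (cmap X n v i) h = l)"
    proof (intro ballI impI)
      fix k l assume "k \<in> verts (el_graph (Corolla n))" "l \<in> hedges X" "vtx X l = onV (cmap X n v i) k"
      then have "k = undefined" "\<exists>!k. k \<in> n \<and> i k = l" using u[of l] by simp_all
      then show "\<exists>!h. h \<in> hedges (el_graph (Corolla n)) \<and> vtx (el_graph (Corolla n)) h = k \<and>
          onH (cmap X n v i) h = l" by (simp add: cmap_def cong: conj_cong)
    qed
  qed (use assms(2) i in \<open>auto simp: cmap_def\<close>)
qed

text \<open>A corolla has a single vertex, where the pullback condition says exactly that
  \<open>onH m\<close> is a bijection onto the half-edges at its image. The arcs follow from
  \<open>src\<close> and \<open>flip\<close>.\<close>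

lemma corolla_cases:
  assumes "m \<in> el_hom (Corolla n) X"
  shows "bij_betw (onH m) n (flags_at X (onV m undefined))" "onV m undefined \<in> verts X"
    "m = cmap X n (onV m undefined) (onH m)"
    "k \<in> n \<Longrightarrow> onA m (Inl k) = flip X (src X (onH m k))"
    "k \<in> n \<Longrightarrow> onA m (Inr k) = src X (onH m k)"
    "k \<in> n \<Longrightarrow> onH m k \<in> hedges X" "k \<in> n \<Longrightarrow> vtx X (onH m k) = onV m undefined"
proof -
  have e: "etale (corolla n) X m" using assms by (simp add: el_hom_def)
  show v: "onV m undefined \<in> verts X" using etaleD(3)[OF e] by simp
  show h: "onH m k \<in> hedges X" if "k \<in> n" for k using etaleD(2)[OF e] that by simp
  show vh: "vtx X (onH m k) = onV m undefined" if "k \<in> n" for k using etaleD(6)[OF e] that by simp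
  have u: "\<exists>!k. k \<in> n \<and> onH m k = l" if "l \<in> hedges X" "vtx X l = onV m undefined" for l
    using etaleD(7)[OF e, of undefined l] that by simp
  show "bij_betw (onH m) n (flags_at X (onV m undefined))"
    unfolding bij_betw_def
  proof
    show "inj_on (onH m) n"
      by (rule inj_onI) (use u h vh in metis)
    show "onH m ` n = flags_at X (onV m undefined)"
      using u h vh by (fastforce simp: flags_at_def)
  qed
  show r: "onA m (Inr k) = src X (onH m k)" if "k \<in> n" for k
    using etaleD(5)[OF e] that by simp
  show l: "onA m (Inl k) = flip X (src X (onH m k))" if "k \<in> n" for k
    using etaleD(4)[OF e, of "Inr k"] that r by simp
  show "m = cmap X n (onV m undefined) (onH m)"
  proof (rule gmap_eqI)
    show "onA m = onA (cmap X n (onV m undefined) (onH m))"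
      using extensional_arb[OF etaleD(8)[OF e]] l r
      by (intro ext) (auto simp: cmap_def restrict_def split: sum.split)
    show "onH m = onH (cmap X n (onV m undefined) (onH m))"
      using etaleD(9)[OF e] by (auto simp: cmap_def extensional_restrict)
    show "onV m = onV (cmap X n (onV m undefined) (onH m))"
      using extensional_arb[OF etaleD(10)[OF e]] by (intro ext) (auto simp: cmap_def restrict_def)
  qed
qed

lemma gcomp_cmap:
  assumes s: "etale X Y s" and X: "is_graph X" and v: "v \<in> verts X"
    and i: "bij_betw i n (flags_at X v)" and n: "finite n"
  shows "gcomp (corolla n) s (cmap X n v i) = cmap Y n (onV s v) (\<lambda>k. onH s (i k))"
proof -
  have "gcomp (el_graph (Corolla n)) s (cmap X n v i) \<in> el_hom (Corolla n) Y"
    using n by (intro el_hom_gcomp[OF _ cmap_in[OF X v i] s]) simp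
  from corolla_cases(3)[OF this]
  have "gcomp (corolla n) s (cmap X n v i) =
      cmap Y n (onV (gcomp (corolla n) s (cmap X n v i)) undefined)
        (onH (gcomp (corolla n) s (cmap X n v i)))" unfolding el_graph.simps .
  also have "\<dots> = cmap Y n (onV s v) (\<lambda>k. onH s (i k))" by (rule cmap_cong) simp_all
  finally show ?thesis .
qed

lemma corolla_at_eq: "corolla_at R x = cmap R (flags_at R x) x (\<lambda>f. f)"
  by (simp add: corolla_at_def cmap_def)

lemma finite_flags_at: "is_graph R \<Longrightarrow> finite (flags_at R x)"
  by (simp add: flags_at_def graphD(8))

lemma corolla_at_in:
  "is_graph R \<Longrightarrow> x \<in> verts R \<Longrightarrow> corolla_at R x \<in> el_hom (Corolla (flags_at R x)) R"
  unfolding corolla_at_eq by (rule cmap_in) (simp_all add: bij_betw_def)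

lemma no_corolla_to_unit: "m \<notin> el_hom (Corolla n) unit_graph"
  using corolla_cases(2)[of m n unit_graph] by (auto simp: unit_graph_def)

lemma corolla_to_corolla:
  assumes "m \<in> el_hom (Corolla k) (corolla n)"
  shows "bij_betw (onH m) k n" "onV m undefined = undefined"
    "i \<in> k \<Longrightarrow> onA m (Inl i) = Inl (onH m i)" "i \<in> k \<Longrightarrow> onA m (Inr i) = Inr (onH m i)"
  using corolla_cases[OF assms] by (simp_all add: flags_at_def)

section \<open>Natural transformations between species\<close>

lemma nat_trans_rep_map:
  fixes X :: "('a, 'h, 'v) graph" and Y :: "('b, 'k, 'w) graph"
  assumes "etale X Y s"
  shows "nat_trans (rep X) (rep Y) (rep_map X s :: ('u, _, _) nat_tr)"
  unfolding nat_trans_def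
proof (intro conjI ballI)
  show "rep_map X s \<in> (\<Pi>\<^sub>E e\<in>(el_ob :: 'u el set). val (rep X) e \<rightarrow>\<^sub>E val (rep Y) e)"
    using el_hom_gcomp[OF _ _ assms] by (auto simp: rep_map_def)
next
  fix e d :: "'u el" and m x
  assume "e \<in> el_ob" "d \<in> el_ob" and m: "m \<in> el_hom e (el_graph d)" and x: "x \<in> val (rep X) d"
  then have "gcomp (el_graph e) x m \<in> el_hom e X"
    using el_hom_gcomp[OF \<open>e \<in> el_ob\<close> m] by (simp add: el_hom_def)
  then show "rep_map X s e (act (rep X) e d m x) = act (rep Y) e d m (rep_map X s d x)"
    using \<open>e \<in> el_ob\<close> \<open>d \<in> el_ob\<close> m x by (simp add: rep_map_def gcomp_assoc_el)
qed

lemma nat_transD: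
  assumes "nat_trans F G \<theta>" "e \<in> el_ob"
  shows "x \<in> val F e \<Longrightarrow> \<theta> e x \<in> val G e"
    "d \<in> el_ob \<Longrightarrow> m \<in> el_hom e (el_graph d) \<Longrightarrow> x \<in> val F d \<Longrightarrow> \<theta> e (act F e d m x) = act G e d m (\<theta> d x)"
    "\<theta> \<in> extensional el_ob" "\<theta> e \<in> extensional (val F e)"
  using assms unfolding nat_trans_def PiE_def by blast+

lemma nat_trans_eqI:
  fixes F :: "('a, 'x) species"
  assumes "nat_trans F G \<theta>" "nat_trans F G \<theta>'" "\<And>e x. e \<in> el_ob \<Longrightarrow> x \<in> val F e \<Longrightarrow> \<theta> e x = \<theta>' e x"
  shows "\<theta> = \<theta>'"
proof (rule extensionalityI[OF nat_transD(3)[OF assms(1) el_obI(1)] nat_transD(3)[OF assms(2) el_obI(1)]])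
  fix e :: "'a el" assume e: "e \<in> el_ob"
  show "\<theta> e = \<theta>' e"
    by (rule extensionalityI[OF nat_transD(4)[OF assms(1) e] nat_transD(4)[OF assms(2) e] assms(3)[OF e]])
qed

lemma nat_trans_comp:
  fixes F :: "('u, 'x) species"
  assumes \<theta>: "nat_trans F G \<theta>" and \<psi>: "nat_trans G H \<psi>" and F: "is_species F"
  shows "nat_trans F H (nat_comp F \<psi> \<theta>)"
  unfolding nat_trans_def
proof (intro conjI ballI)
  show "nat_comp F \<psi> \<theta> \<in> (\<Pi>\<^sub>E e\<in>el_ob. val F e \<rightarrow>\<^sub>E val H e)"
    using nat_transD(1)[OF \<theta>] nat_transD(1)[OF \<psi>] by (auto simp: nat_comp_def)
next
  fix e d :: "'u el" and m x
  assume *: "e \<in> el_ob" "d \<in> el_ob" "m \<in> el_hom e (el_graph d)" "x \<in> val F d"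
  then have "act F e d m x \<in> val F e" using F unfolding is_species_def by blast
  then show "nat_comp F \<psi> \<theta> e (act F e d m x) = act H e d m (nat_comp F \<psi> \<theta> d x)"
    using * nat_transD(1)[OF \<theta> *(2,4)]
    by (simp add: nat_comp_def nat_transD(2)[OF \<theta>] nat_transD(2)[OF \<psi>])
qed

section \<open>Labelled graphs embedded in a graph up to cutting edges\<close>

text \<open>The types of \<open>gr D\<close> are left free, so that the result of a gluing, whose
  arcs are classes, is covered along with graphs over the universe. Nonemptiness, the remaining part
  of \<open>effective\<close>, is supplied where it matters as \<open>W \<noteq> {}\<close>.\<close>

definition emb :: "('b, 'k, 'w) graph \<Rightarrow> 'u set \<Rightarrow> 'w set \<Rightarrow> ('u \<Rightarrow> 'b) \<Rightarrow>
    ('u, 'a, 'h, 'v, ('u, 'b, 'k, 'w) probe) dgraph \<Rightarrow> ('a, 'h, 'v, 'b, 'k, 'w) gmap \<Rightarrow> bool" where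
  "emb Y n W l D s \<longleftrightarrow> is_graph (gr D) \<and> no_isolated_edges (gr D) \<and>
     bij_betw (lab D) n (ports (gr D)) \<and> etale (gr D) Y s \<and> inj_on (onV s) (verts (gr D)) \<and>
     onV s ` verts (gr D) = W \<and> (\<forall>k\<in>n. onA s (lab D k) = l k) \<and> dec D = rep_map (gr D) s"

lemma embD:
  assumes "emb Y n W l D s"
  shows "is_graph (gr D)" "no_isolated_edges (gr D)" "bij_betw (lab D) n (ports (gr D))"
    "etale (gr D) Y s" "inj_on (onV s) (verts (gr D))" "onV s ` verts (gr D) = W"
    "k \<in> n \<Longrightarrow> onA s (lab D k) = l k" "dec D = rep_map (gr D) s"
    "k \<in> n \<Longrightarrow> lab D k \<in> ports (gr D)" "k \<in> n \<Longrightarrow> lab D k \<in> arcs (gr D)"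
  using assms bij_betwE[of "lab D" n "ports (gr D)"] by (auto simp: emb_def ports_def)

text \<open>The labels prescribe along which flags of \<open>Y\<close> the two graphs are cut; hence no inner edge of
  \<open>gr D\<close> is cut in \<open>gr D'\<close>, which is what makes the map on arcs commute with \<open>flip\<close>.\<close>

lemma emb_etale_ex:
  assumes D: "emb Y n W l D s" and D': "emb Y n W l D' s'" and Y: "is_graph Y"
  shows "\<exists>h. etale (gr D) (gr D') h \<and> gcomp (gr D) s' h = s \<and> (\<forall>k\<in>n. onA h (lab D k) = lab D' k)"
proof -
  let ?X = "gr D" and ?X' = "gr D'"
  note X = embD(1)[OF D] and X' = embD(1)[OF D'] and s = embD(4)[OF D] and s' = embD(4)[OF D']
  have Hinj: "f = g" if "f \<in> hedges ?X" "g \<in> hedges ?X" "onH s f = onH s g" for f g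
    using etale_inj_hedges[OF s X embD(5)[OF D]] that by blast
  have Hinj': "f = g" if "f \<in> hedges ?X'" "g \<in> hedges ?X'" "onH s' f = onH s' g" for f g
    using etale_inj_hedges[OF s' X' embD(5)[OF D']] that by blast
  have "\<exists>v'. v' \<in> verts ?X' \<and> onV s' v' = onV s v" if "v \<in> verts ?X" for v
    using embD(6)[OF D] embD(6)[OF D'] that by (metis imageE imageI)
  then obtain hV where hV: "\<And>v. v \<in> verts ?X \<Longrightarrow> hV v \<in> verts ?X'"
      "\<And>v. v \<in> verts ?X \<Longrightarrow> onV s' (hV v) = onV s v" by metis
  have "\<exists>f'. f' \<in> hedges ?X' \<and> vtx ?X' f' = hV (vtx ?X f) \<and> onH s' f' = onH s f"
    if f: "f \<in> hedges ?X" for f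
  proof -
    have v: "vtx ?X f \<in> verts ?X" by (rule graphD(6)[OF X f])
    have "vtx Y (onH s f) = onV s' (hV (vtx ?X f))"
      using etaleD(6)[OF s f] hV(2)[OF v] by simp
    from etaleD(7)[OF s' hV(1)[OF v] etaleD(2)[OF s f] this] show ?thesis by blast
  qed
  then obtain hH where hH: "\<And>f. f \<in> hedges ?X \<Longrightarrow> hH f \<in> hedges ?X'"
      "\<And>f. f \<in> hedges ?X \<Longrightarrow> vtx ?X' (hH f) = hV (vtx ?X f)"
      "\<And>f. f \<in> hedges ?X \<Longrightarrow> onH s' (hH f) = onH s f" by metis
  have in_src: "src ?X f \<in> src ?X ` hedges ?X" if "f \<in> hedges ?X" for f using that by blast
  \<comment> \<open>The value is forced on arcs \<open>src f\<close> and on flips of such arcs. An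
    inner edge is reached in both ways, and consistency there is the content of
    \<open>hA2\<close>.\<close>
  define hA where "hA a = (if a \<in> src ?X ` hedges ?X
      then src ?X' (hH (inv_into (hedges ?X) (src ?X) a))
      else flip ?X' (src ?X' (hH (inv_into (hedges ?X) (src ?X) (flip ?X a)))))" for a
  have srcinj: "inj_on (src ?X) (hedges ?X)" using X by (simp add: is_graph_def)
  have hA1: "hA (src ?X f) = src ?X' (hH f)" if "f \<in> hedges ?X" for f
    using that srcinj by (simp add: hA_def)
  have sY: "onA s (flip ?X (src ?X f)) = flip Y (src Y (onH s f))" if "f \<in> hedges ?X" for f
    using that graphD(4)[OF X] etaleD(4,5)[OF s] by simp
  have sY': "onA s' (flip ?X' (src ?X' f)) = flip Y (src Y (onH s' f))" if "f \<in> hedges ?X'" for f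
    using that graphD(4)[OF X'] etaleD(4,5)[OF s'] by simp
  have fY: "flip Y (flip Y (src Y (onH s f))) = src Y (onH s f)" if "f \<in> hedges ?X" for f
    using graphD(2,4)[OF Y] etaleD(2)[OF s that] by simp
  have fY': "flip Y (flip Y (src Y (onH s' f))) = src Y (onH s' f)" if "f \<in> hedges ?X'" for f
    using graphD(2,4)[OF Y] etaleD(2)[OF s' that] by simp
  have hA2: "hA (flip ?X (src ?X f)) = flip ?X' (src ?X' (hH f))" if f: "f \<in> hedges ?X" for f
  proof (cases "flip ?X (src ?X f) \<in> src ?X ` hedges ?X")
    case False
    then show ?thesis using f srcinj by (simp add: hA_def graphD(2,4)[OF X])
  next
    case True
    then obtain g where g: "g \<in> hedges ?X" "flip ?X (src ?X f) = src ?X g" by blast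
    have sg: "src Y (onH s g) = flip Y (src Y (onH s f))"
      using sY[OF f] g etaleD(5)[OF s g(1)] by simp
    \<comment> \<open>If this were the port \<open>k\<close> of \<open>gr D'\<close>, the port
      \<open>k\<close> of \<open>gr D\<close> would lie over the same arc of \<open>Y\<close>.
      Injectivity on half-edges would make it \<open>flip ?X (src ?X f)\<close>, which is
      \<open>src ?X g\<close> and so no port.\<close>
    have "flip ?X' (src ?X' (hH f)) \<notin> ports ?X'"
    proof
      assume "flip ?X' (src ?X' (hH f)) \<in> ports ?X'"
      then obtain k where k: "k \<in> n" "flip ?X' (src ?X' (hH f)) = lab D' k"
        using embD(3)[OF D'] by (auto simp: bij_betw_def)
      obtain f2 where f2: "f2 \<in> hedges ?X" "lab D k = flip ?X (src ?X f2)"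
        using port_cases[OF embD(2)[OF D] X embD(9)[OF D k(1)]] by metis
      have "onA s (lab D k) = onA s' (lab D' k)" using embD(7)[OF D k(1)] embD(7)[OF D' k(1)] by simp
      then have "flip Y (src Y (onH s f2)) = flip Y (src Y (onH s f))"
        using sY'[OF hH(1)[OF f]] k(2) f2 sY[OF f2(1)] hH(3)[OF f] by simp
      then have "src Y (onH s f2) = src Y (onH s f)" using fY[OF f] fY[OF f2(1)] by metis
      then have "f2 = f"
        using Hinj f f2(1) graphD(5)[OF Y] etaleD(2)[OF s] by blast
      then have "src ?X g \<in> ports ?X" using embD(9)[OF D k(1)] f2(2) g(2) by simp
      then show False using g(1) by (simp add: ports_def)
    qed
    then obtain g' where g': "g' \<in> hedges ?X'" "flip ?X' (src ?X' (hH f)) = src ?X' g'"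
      using graphD(1,4)[OF X'] hH(1)[OF f] by (auto simp: ports_def)
    have "src Y (onH s' g') = src Y (onH s g)"
      using sY'[OF hH(1)[OF f]] g' etaleD(5)[OF s' g'(1)] sg hH(3)[OF f] by simp
    then have "g' = hH g"
      using Hinj'[OF g'(1) hH(1)[OF g(1)]] graphD(5)[OF Y] etaleD(2)[OF s' g'(1)]
        etaleD(2)[OF s g(1)] hH(3)[OF g(1)] by auto
    then show ?thesis using g g' hA1 by simp
  qed
  define h where "h = \<lparr>onA = restrict hA (arcs ?X), onH = restrict hH (hedges ?X),
      onV = restrict hV (verts ?X)\<rparr>"
  have h_sel: "a \<in> arcs ?X \<Longrightarrow> onA h a = hA a" "f \<in> hedges ?X \<Longrightarrow> onH h f = hH f"
    "v \<in> verts ?X \<Longrightarrow> onV h v = hV v" for a f v by (simp_all add: h_def)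
  note cases = arc_cases[OF embD(2)[OF D] X]
  have h: "etale ?X ?X' h"
    unfolding etale_def
  proof (intro conjI)
    have hA: "hA a \<in> arcs ?X'" if "a \<in> arcs ?X" for a
      using cases[OF that] hA1 hA2 hH(1) graphD(1,4)[OF X'] by metis
    then show "onA h \<in> arcs ?X \<rightarrow>\<^sub>E arcs ?X'" by (simp add: h_def)
    show "onH h \<in> hedges ?X \<rightarrow>\<^sub>E hedges ?X'" "onV h \<in> verts ?X \<rightarrow>\<^sub>E verts ?X'"
      using hH(1) hV(1) by (simp_all add: h_def)
    show "\<forall>a\<in>arcs ?X. onA h (flip ?X a) = flip ?X' (onA h a)"
    proof
      fix a assume a: "a \<in> arcs ?X"
      have "hA (flip ?X a) = flip ?X' (hA a)"
        using cases[OF a] hA1 hA2 graphD(2,4)[OF X] graphD(2,4)[OF X'] hH(1) by metis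
      then show "onA h (flip ?X a) = flip ?X' (onA h a)" using a graphD(1)[OF X a] by (simp add: h_sel)
    qed
    show "\<forall>f\<in>hedges ?X. onA h (src ?X f) = src ?X' (onH h f)"
      using hA1 graphD(4)[OF X] by (simp add: h_sel)
    show "\<forall>f\<in>hedges ?X. onV h (vtx ?X f) = vtx ?X' (onH h f)"
      using hH(2) graphD(6)[OF X] by (simp add: h_sel)
    show "\<forall>v\<in>verts ?X. \<forall>k\<in>hedges ?X'. vtx ?X' k = onV h v \<longrightarrow>
        (\<exists>!f. f \<in> hedges ?X \<and> vtx ?X f = v \<and> onH h f = k)"
    proof (intro ballI impI)
      fix v k assume v: "v \<in> verts ?X" and k: "k \<in> hedges ?X'" "vtx ?X' k = onV h v"
      have "vtx Y (onH s' k) = onV s v" using etaleD(6)[OF s' k(1)] k(2) v hV(2) by (simp add: h_sel)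
      from etaleD(7)[OF s v etaleD(2)[OF s' k(1)] this]
      obtain f where f: "f \<in> hedges ?X" "vtx ?X f = v" "onH s f = onH s' k" by blast
      have "hH f = k" using Hinj'[OF hH(1)[OF f(1)] k(1)] hH(3)[OF f(1)] f(3) by simp
      moreover have "g = f" if "g \<in> hedges ?X" "hH g = k" for g
        using Hinj[OF that(1) f(1)] hH(3)[OF that(1)] hH(3)[OF f(1)] that(2) \<open>hH f = k\<close> by simp
      ultimately show "\<exists>!f. f \<in> hedges ?X \<and> vtx ?X f = v \<and> onH h f = k"
        using f h_sel(2) by (metis (no_types))
    qed
  qed
  moreover have "gcomp ?X s' h = s"
    by (rule etale_eqI_noiso[OF etale_gcomp[OF h s' X] s X embD(2)[OF D]])
      (simp_all add: h_sel hH(3) hV(2))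
  moreover have "onA h (lab D k) = lab D' k" if k: "k \<in> n" for k
  proof -
    obtain f where f: "f \<in> hedges ?X" "lab D k = flip ?X (src ?X f)"
      using port_cases[OF embD(2)[OF D] X embD(9)[OF D k]] by metis
    obtain f' where f': "f' \<in> hedges ?X'" "lab D' k = flip ?X' (src ?X' f')"
      using port_cases[OF embD(2)[OF D'] X' embD(9)[OF D' k]] by metis
    \<comment> \<open>Both ports labelled \<open>k\<close> lie over the arc \<open>l k\<close>, so
      the half-edges opposite to them have the same image in \<open>Y\<close>.\<close>
    have "flip Y (src Y (onH s f)) = flip Y (src Y (onH s' f'))"
      using embD(7)[OF D k] embD(7)[OF D' k] f f' sY sY' by metis
    then have "src Y (onH s f) = src Y (onH s' f')" using fY[OF f(1)] fY'[OF f'(1)] by metis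
    then have "onH s f = onH s' f'"
      using graphD(5)[OF Y etaleD(2)[OF s f(1)] etaleD(2)[OF s' f'(1)]] by blast
    then have "f' = hH f" using Hinj'[OF f'(1) hH(1)[OF f(1)]] hH(3)[OF f(1)] by simp
    then show ?thesis using f f' hA2 graphD(1,4)[OF X] by (simp add: h_sel)
  qed
  ultimately show ?thesis by blast
qed

text \<open>Comparison maps exist in both directions and commute with the maps to \<open>Y\<close>.
  Their composites do so too, as do the identities, and \<open>etale_cancel\<close> identifies
  them.\<close>

lemma emb_giso:
  assumes D: "emb Y n W l D s" and D': "emb Y n W l D' s'" and Y: "is_graph Y"
  obtains h where "giso (gr D) (gr D') h" "gcomp (gr D) s' h = s"
    "\<And>k. k \<in> n \<Longrightarrow> onA h (lab D k) = lab D' k"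
proof -
  let ?X = "gr D" and ?X' = "gr D'"
  obtain h where h: "etale ?X ?X' h" "gcomp ?X s' h = s" "\<forall>k\<in>n. onA h (lab D k) = lab D' k"
    using emb_etale_ex[OF D D' Y] by blast
  obtain k where k: "etale ?X' ?X k" "gcomp ?X' s k = s'"
    using emb_etale_ex[OF D' D Y] by blast
  have "gcomp ?X k h = gid ?X"
    by (rule etale_cancel[OF embD(4,5)[OF D] etale_gcomp[OF h(1) k(1) embD(1)[OF D]]
          etale_gid[OF embD(1)[OF D]] embD(1,2)[OF D] embD(1)[OF D]])
      (simp add: gcomp_assoc[OF h(1)] k h gcomp_gid_right[OF embD(4)[OF D]])
  moreover have "gcomp ?X' h k = gid ?X'"
    by (rule etale_cancel[OF embD(4,5)[OF D'] etale_gcomp[OF k(1) h(1) embD(1)[OF D']]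
          etale_gid[OF embD(1)[OF D']] embD(1,2)[OF D'] embD(1)[OF D']])
      (simp add: gcomp_assoc[OF k(1)] k h gcomp_gid_right[OF embD(4)[OF D']])
  ultimately have "giso ?X ?X' h" using h k by (auto simp: giso_def)
  then show thesis using that h by blast
qed

lemma emb_diso:
  assumes D: "emb Y n W l D s" and D': "emb Y n W l D' s'" and Y: "is_graph Y"
  shows "diso n D D'"
proof -
  obtain h where h: "giso (gr D) (gr D') h" "gcomp (gr D) s' h = s"
    "\<And>k. k \<in> n \<Longrightarrow> onA h (lab D k) = lab D' k" using emb_giso[OF assms] by blast
  have e: "etale (gr D) (gr D') h" using h(1) by (simp add: giso_def)
  have "dec D' e (gcomp (el_graph e) h m) = dec D e m" if "e \<in> el_ob" "m \<in> el_hom e (gr D)" for e m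
    using that el_hom_gcomp[OF that e]
    by (simp add: embD(8)[OF D] embD(8)[OF D'] rep_map_def gcomp_assoc_el[OF that(2)] h(2))
  then show ?thesis unfolding diso_def using h by blast
qed

lemma emb_is_dgraph:
  assumes D: "emb Y n W l D s" and W: "W \<noteq> {}"
  shows "is_dgraph (rep Y) n D"
  using embD[OF D] W nat_trans_rep_map[OF embD(4)[OF D]] by (auto simp: is_dgraph_def effective_def)

text \<open>The map to \<open>Y\<close> is precomposed with the inverse isomorphism. The decoration
  of \<open>D'\<close> is the induced one because the decoration of \<open>D\<close> is and the
  isomorphism respects both.\<close>

lemma emb_transport:
  fixes Y :: "('b, 'k, 'w) graph" and D :: "('u, 'a, 'h, 'v, ('u, 'b, 'k, 'w) probe) dgraph"
    and D' :: "('u, 'c, 'l, 'z, ('u, 'b, 'k, 'w) probe) dgraph"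
  assumes D: "emb Y n W l D s" and i: "diso n D D'" and D': "is_dgraph (rep Y) n D'"
  shows "\<exists>s'. emb Y n W l D' s'"
proof -
  let ?X = "gr D" and ?X' = "gr D'"
  obtain h where h: "giso ?X ?X' h" "\<forall>k\<in>n. onA h (lab D k) = lab D' k"
    and dec: "\<And>e m. e \<in> el_ob \<Longrightarrow> m \<in> el_hom e ?X \<Longrightarrow> dec D' e (gcomp (el_graph e) h m) = dec D e m"
    using i unfolding diso_def by blast
  then obtain k where he: "etale ?X ?X' h" and k: "etale ?X' ?X k"
    and kh: "gcomp ?X k h = gid ?X" and hk: "gcomp ?X' h k = gid ?X'"
    unfolding giso_def by blast
  have X': "is_graph ?X'" "no_isolated_edges ?X'" using D' by (auto simp: is_dgraph_def effective_def)
  note s = embD(4)[OF D]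
  have khV: "onV k (onV h v) = v" if "v \<in> verts ?X" for v
    using arg_cong[OF kh, of "\<lambda>m. onV m v"] that by (simp add: gid_def)
  have hkV: "onV h (onV k v) = v" if "v \<in> verts ?X'" for v
    using arg_cong[OF hk, of "\<lambda>m. onV m v"] that by (simp add: gid_def)
  have khA: "onA k (onA h a) = a" if "a \<in> arcs ?X" for a
    using arg_cong[OF kh, of "\<lambda>m. onA m a"] that by (simp add: gid_def)
  let ?s = "gcomp ?X' s k"
  have e: "etale ?X' Y ?s" by (rule etale_gcomp[OF k s X'(1)])
  have "emb Y n W l D' ?s"
    unfolding emb_def
  proof (intro conjI)
    show "bij_betw (lab D') n (ports ?X')" using D' by (simp add: is_dgraph_def)
    show "inj_on (onV ?s) (verts ?X')"
    proof (rule inj_onI)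
      fix v w assume v: "v \<in> verts ?X'" "w \<in> verts ?X'" "onV ?s v = onV ?s w"
      then have "onV k v = onV k w"
        using inj_onD[OF embD(5)[OF D]] etaleD(3)[OF k] by simp
      then show "v = w" using hkV v by metis
    qed
    have "onV k ` verts ?X' = verts ?X"
    proof
      show "onV k ` verts ?X' \<subseteq> verts ?X" using etaleD(3)[OF k] by blast
      show "verts ?X \<subseteq> onV k ` verts ?X'" using khV etaleD(3)[OF he] by (metis imageI subsetI)
    qed
    then have "onV s ` onV k ` verts ?X' = W" using embD(6)[OF D] by simp
    then show "onV ?s ` verts ?X' = W" by (simp add: image_image)
    show "\<forall>i\<in>n. onA ?s (lab D' i) = l i"
    proof
      fix i assume i: "i \<in> n"
      have "lab D' i \<in> arcs ?X'" using h(2) i embD(10)[OF D i] etaleD(1)[OF he] by metis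
      then show "onA ?s (lab D' i) = l i"
        using embD(7,10)[OF D i] khA[OF embD(10)[OF D i]] h(2) i by simp
    qed
    show "dec D' = rep_map ?X' ?s"
    proof (rule nat_trans_eqI)
      show "nat_trans (rep ?X') (rep Y) (dec D')" using D' by (simp add: is_dgraph_def)
      show "nat_trans (rep ?X') (rep Y) (rep_map ?X' ?s)" by (rule nat_trans_rep_map[OF e])
    next
      fix e :: "'u el" and m :: "('u, 'c, 'l, 'z) probe"
      assume e: "e \<in> el_ob" and "m \<in> val (rep ?X') e"
      then have m: "m \<in> el_hom e ?X'" by simp
      let ?m = "gcomp (el_graph e) k m"
      have km: "?m \<in> el_hom e ?X" by (rule el_hom_gcomp[OF e m k])
      have "gcomp (el_graph e) h ?m = m"
        using m by (simp add: gcomp_assoc_el[OF m] hk gcomp_gid_left el_hom_def)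
      then show "dec D' e m = rep_map ?X' ?s e m"
        using dec[OF e km] e m km by (simp add: embD(8)[OF D] rep_map_def gcomp_assoc_el[OF m])
    qed
  qed (use X' e in blast)+
  then show ?thesis by blast
qed

text \<open>A single isomorphism class, or empty.\<close>

definition cls :: "('b, 'k, 'w) graph \<Rightarrow> 'u set \<Rightarrow> 'w set \<Rightarrow> ('u \<Rightarrow> 'b) \<Rightarrow>
    ('u, ('u, 'b, 'k, 'w) probe) udgraph set" where
  "cls Y n W l = {D. \<exists>s. emb Y n W l D s}"

text \<open>One inclusion transports the map to \<open>Y\<close> along an isomorphism, the other
  compares two graphs cut out in the same way. The class is thereby described without a
  representative, so a glued graph and a fibre can be compared although their types differ.\<close>

lemma iso_class_emb:
  assumes "emb Y n W l D s" "W \<noteq> {}" "is_graph Y"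
  shows "iso_class (rep Y) n D = cls Y n W l"
  using emb_transport[OF assms(1)] emb_diso[OF assms(1) _ assms(3)] emb_is_dgraph[OF _ assms(2)]
  unfolding iso_class_def cls_def by blast

lemma emb_cong: "(\<And>k. k \<in> n \<Longrightarrow> l k = l' k) \<Longrightarrow> emb Y n W l D s = emb Y n W l' D s"
  by (auto simp: emb_def)

lemma cls_cong: "(\<And>k. k \<in> n \<Longrightarrow> l k = l' k) \<Longrightarrow> cls Y n W l = cls Y n W l'"
  unfolding cls_def using emb_cong by metis

text \<open>Evaluating the decoration at the canonical corolla of \<open>v\<close> recovers the
  image of \<open>v\<close>. This also works at a vertex without half-edges, where the corolla is
  the one on the empty set.\<close>

lemma rep_map_onV:
  fixes X :: "('a, 'u, 'v) graph"
  assumes "rep_map X s = (rep_map X s' :: ('u, _, _) nat_tr)" "is_graph X" "v \<in> verts X"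
  shows "onV s v = onV s' v"
proof -
  let ?e = "Corolla (flags_at X v)"
  have "rep_map X s ?e (corolla_at X v) = rep_map X s' ?e (corolla_at X v)" using assms(1) by simp
  then have "gcomp (el_graph ?e) s (corolla_at X v) = gcomp (el_graph ?e) s' (corolla_at X v)"
    using corolla_at_in[OF assms(2,3)] finite_flags_at[OF assms(2)] by (simp add: rep_map_def)
  then have "onV (gcomp (el_graph ?e) s (corolla_at X v)) undefined =
      onV (gcomp (el_graph ?e) s' (corolla_at X v)) undefined" by simp
  then show ?thesis by (simp add: corolla_at_def)
qed

text \<open>The decoration of a single member determines its map to \<open>Y\<close> on vertices.
  This is what later recovers the fibres of a compression from its Kleisli morphism.\<close>

lemma cls_determines_image:
  assumes "D \<in> cls Y n W l" "D \<in> cls Y n W' l'"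
  shows "W = W'"
proof -
  obtain s s' where s: "emb Y n W l D s" and s': "emb Y n W' l' D s'" using assms by (auto simp: cls_def)
  have "onV s v = onV s' v" if "v \<in> verts (gr D)" for v
    using rep_map_onV[of "gr D" s s', OF _ embD(1)[OF s] that] embD(8)[OF s] embD(8)[OF s'] by simp
  then have "onV s ` verts (gr D) = onV s' ` verts (gr D)" by (rule image_cong[OF refl])
  then show ?thesis using embD(6)[OF s] embD(6)[OF s'] by simp
qed

lemma is_dgraphD:
  assumes "is_dgraph F n D"
  shows "is_graph (gr D)" "no_isolated_edges (gr D)" "bij_betw (lab D) n (ports (gr D))"
    "nat_trans (rep (gr D)) F (dec D)" "verts (gr D) \<noteq> {}"
    "k \<in> n \<Longrightarrow> lab D k \<in> ports (gr D)" "k \<in> n \<Longrightarrow> lab D k \<in> arcs (gr D)"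
proof -
  show 1: "is_graph (gr D)" "no_isolated_edges (gr D)" "bij_betw (lab D) n (ports (gr D))"
    "nat_trans (rep (gr D)) F (dec D)" using assms by (auto simp: is_dgraph_def effective_def)
  show p: "k \<in> n \<Longrightarrow> lab D k \<in> ports (gr D)" using bij_betwE[OF 1(3)] by blast
  then show "k \<in> n \<Longrightarrow> lab D k \<in> arcs (gr D)" by (simp add: ports_def)
  \<comment> \<open>Without vertices there are no half-edges, and then no arcs either, since edges
    are not isolated; this contradicts nonemptiness.\<close>
  show "verts (gr D) \<noteq> {}"
  proof
    assume v: "verts (gr D) = {}"
    then have h: "hedges (gr D) = {}" using graphD(6)[OF 1(1)] by blast
    then have "arcs (gr D) = {}" using arc_cases[OF 1(2,1)] by blast
    then show False using assms v h by (simp add: is_dgraph_def effective_def)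
  qed
qed

lemma diso_refl:
  fixes D :: "('u, 'a, 'h, 'v, 'x) dgraph"
  assumes "is_dgraph F n D"
  shows "diso n D D"
proof -
  note G = is_dgraphD[OF assms]
  have "gcomp (el_graph e) (gid (gr D)) m = m" if "m \<in> el_hom e (gr D)" for e :: "'u el" and m
    using that by (simp add: gcomp_gid_left el_hom_def)
  moreover have "onA (gid (gr D)) (lab D k) = lab D k" if "k \<in> n" for k
    using G(7)[OF that] by (simp add: gid_def)
  ultimately show ?thesis
    unfolding diso_def using giso_gid[OF G(1)] by (intro exI[of _ "gid (gr D)"]) simp
qed

lemma self_in_iso_class: "is_dgraph F n D \<Longrightarrow> D \<in> iso_class F n D"
  by (simp add: iso_class_def diso_refl)

section \<open>Compressions as refinements of graphs\<close>

text \<open>The object part of the quasi-inverse of \<open>phi_ob\<close>: ports are dropped, and a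
  half-edge whose opposite arc is a port becomes a tail.\<close>

definition bm_of :: "('a, 'u, 'u) graph \<Rightarrow> 'u bm_graph" where
  "bm_of Y = \<lparr>bm_verts = verts Y, bm_flags = hedges Y, bd = vtx Y,
     jinv = (\<lambda>f. if flip Y (src Y f) \<in> src Y ` hedges Y
                 then inv_into (hedges Y) (src Y) (flip Y (src Y f)) else f)\<rparr>"

lemma bm_of_simps [simp]:
  "bm_verts (bm_of Y) = verts Y" "bm_flags (bm_of Y) = hedges Y" "bd (bm_of Y) = vtx Y"
  by (simp_all add: bm_of_def)

lemma jinv_bm_of:
  assumes Y: "is_graph Y" and f: "f \<in> hedges Y"
  shows "g \<in> hedges Y \<Longrightarrow> flip Y (src Y f) = src Y g \<Longrightarrow> jinv (bm_of Y) f = g"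
    "flip Y (src Y f) \<in> ports Y \<longleftrightarrow> jinv (bm_of Y) f = f"
    "jinv (bm_of Y) f \<noteq> f \<Longrightarrow> src Y (jinv (bm_of Y) f) = flip Y (src Y f)"
    "jinv (bm_of Y) f \<in> hedges Y"
proof -
  have inj: "inj_on (src Y) (hedges Y)" using Y by (simp add: is_graph_def)
  show 1: "jinv (bm_of Y) f = g" if "g \<in> hedges Y" "flip Y (src Y f) = src Y g" for g
    using that inj by (simp add: bm_of_def)
  have 2: "jinv (bm_of Y) f = f" if "flip Y (src Y f) \<notin> src Y ` hedges Y"
    using that by (simp add: bm_of_def)
  have 3: "src Y g \<noteq> flip Y (src Y g)" if "g \<in> hedges Y" for g
    using graphD(3,4)[OF Y] that by metis
  have a: "flip Y (src Y f) \<in> arcs Y" using graphD(1,4)[OF Y] f by blast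
  show "flip Y (src Y f) \<in> ports Y \<longleftrightarrow> jinv (bm_of Y) f = f"
  proof
    show "flip Y (src Y f) \<in> ports Y \<Longrightarrow> jinv (bm_of Y) f = f" using 2 by (simp add: ports_def)
    show "flip Y (src Y f) \<in> ports Y" if j: "jinv (bm_of Y) f = f"
    proof (rule ccontr)
      assume "flip Y (src Y f) \<notin> ports Y"
      then obtain g where g: "g \<in> hedges Y" "flip Y (src Y f) = src Y g" using a by (auto simp: ports_def)
      then have "f = g" using 1 j by simp
      then show False using 3 g by metis
    qed
  qed
  show "jinv (bm_of Y) f \<noteq> f \<Longrightarrow> src Y (jinv (bm_of Y) f) = flip Y (src Y f)"
    using 1 2 by force
  show "jinv (bm_of Y) f \<in> hedges Y" using 1 2 f by force
qed

lemma is_bm_graph_bm_of: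
  assumes Y: "is_graph Y"
  shows "is_bm_graph (bm_of Y)"
proof -
  have "jinv (bm_of Y) (jinv (bm_of Y) f) = f" if f: "f \<in> hedges Y" for f
  proof (cases "jinv (bm_of Y) f = f")
    case False
    have "flip Y (src Y (jinv (bm_of Y) f)) = src Y f"
      using jinv_bm_of(3)[OF Y f False] graphD(2,4)[OF Y] f by metis
    then show ?thesis using jinv_bm_of(1)[OF Y jinv_bm_of(4)[OF Y f] f] by blast
  qed simp
  then show ?thesis
    using graphD(6,8,9)[OF Y] jinv_bm_of(4)[OF Y] by (auto simp: is_bm_graph_def)
qed

lemma phi_ob_simps [simp]:
  "arcs (phi_ob \<tau>) = Inl ` tails \<tau> \<union> Inr ` bm_flags \<tau>" "hedges (phi_ob \<tau>) = bm_flags \<tau>"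
  "verts (phi_ob \<tau>) = bm_verts \<tau>" "flip (phi_ob \<tau>) (Inl t) = Inr t"
  "flip (phi_ob \<tau>) (Inr f) = (if jinv \<tau> f = f then Inl f else Inr (jinv \<tau> f))"
  "src (phi_ob \<tau>) = Inr" "vtx (phi_ob \<tau>) = bd \<tau>"
  by (simp_all add: phi_ob_def)

lemma ports_phi_ob: "ports (phi_ob \<tau>) = Inl ` tails \<tau>"
  by (auto simp: ports_def)

lemma is_graph_phi_ob: "is_bm_graph \<tau> \<Longrightarrow> is_graph (phi_ob \<tau>)"
  using finite_subset[of "tails \<tau>" "bm_flags \<tau>"]
  by (auto simp: is_graph_def bm_graphD tails_def split: if_splits)

lemma no_isolated_edges_phi_ob: "no_isolated_edges (phi_ob \<tau>)"
  by (auto simp: no_isolated_edges_def ports_phi_ob tails_def)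

text \<open>\<open>h\<close> runs from the flags and vertices of \<open>Y\<close> to those of
  \<open>R\<close>, against the direction of the Kleisli morphism from \<open>R\<close> to
  \<open>Y\<close> that it induces.\<close>

locale refinement =
  fixes R Y :: "'u ugraph" and h :: "'u bm_mor"
  assumes R: "is_graph R" "no_isolated_edges R" and Y: "is_graph Y" "no_isolated_edges Y"
    and h: "comp_mor (bm_of Y) (bm_of R) h"
begin

lemmas hD = comp_morD[OF h, unfolded bm_of_simps]

text \<open>The extension of \<open>mF h\<close> from half-edges to all arcs that is compatible with
  \<open>flip\<close>; for an arc that is not a \<open>src\<close>, the opposite arc is one.\<close>

definition amap :: "'u + 'u \<Rightarrow> 'u + 'u" where
  "amap a = (if a \<in> src R ` hedges R then src Y (mF h (inv_into (hedges R) (src R) a))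
             else flip Y (src Y (mF h (inv_into (hedges R) (src R) (flip R a)))))"

lemma amap_src: "f \<in> hedges R \<Longrightarrow> amap (src R f) = src Y (mF h f)"
  using R(1) by (auto simp: amap_def is_graph_def)

text \<open>At a tail this is the second clause of the definition. At an inner edge the first clause
  applies to the opposite half-edge, and the clauses agree because \<open>mF h\<close> commutes with
  the involutions and is injective.\<close>

lemma amap_flip_src:
  assumes f: "f \<in> hedges R"
  shows "amap (flip R (src R f)) = flip Y (src Y (mF h f))"
proof (cases "jinv (bm_of R) f = f")
  case True
  then have "flip R (src R f) \<notin> src R ` hedges R" using jinv_bm_of(2)[OF R(1) f] by (simp add: ports_def)
  moreover have "inj_on (src R) (hedges R)" using R(1) by (simp add: is_graph_def)
  ultimately show ?thesis
    using f by (simp add: amap_def graphD(2)[OF R(1) graphD(4)[OF R(1) f]])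
next
  case False
  let ?g = "jinv (bm_of R) f"
  have g: "?g \<in> hedges R" by (rule jinv_bm_of(4)[OF R(1) f])
  have "amap (flip R (src R f)) = src Y (mF h ?g)"
    using jinv_bm_of(3)[OF R(1) f False] amap_src[OF g] by simp
  moreover have "mF h ?g \<noteq> mF h f" using inj_onD[OF hD(2)] f g False by blast
  then have "src Y (mF h ?g) = flip Y (src Y (mF h f))"
    using jinv_bm_of(3)[OF Y(1) hD(1)[OF f]] hD(6)[OF f] by simp
  ultimately show ?thesis by simp
qed

lemma amap_in: "a \<in> arcs R \<Longrightarrow> amap a \<in> arcs Y"
  using arc_cases[OF R(2,1)] amap_src amap_flip_src hD(1) graphD(1,4)[OF Y(1)] by metis

lemma amap_flip: "a \<in> arcs R \<Longrightarrow> amap (flip R a) = flip Y (amap a)"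
  using arc_cases[OF R(2,1)] amap_src amap_flip_src hD(1) graphD(2,4)[OF Y(1)] graphD(2,4)[OF R(1)]
  by metis

text \<open>This identifies \<open>amap\<close> wherever another formula for the action on arcs
  turns up: for identities, composites, the \<open>map_sum\<close> of \<open>phi_mor\<close>, and a
  given generic morphism.\<close>

lemma amap_unique:
  assumes "\<And>f. f \<in> hedges R \<Longrightarrow> \<alpha> (src R f) = src Y (mF h f)"
    and "\<And>f. f \<in> hedges R \<Longrightarrow> \<alpha> (flip R (src R f)) = flip Y (\<alpha> (src R f))" and "a \<in> arcs R"
  shows "\<alpha> a = amap a"
  using arc_cases[OF R(2,1) assms(3)] assms(1,2) amap_src amap_flip_src by metis

definition fib :: "'u \<Rightarrow> 'u ugraph" where
  "fib x = phi_ob (fibre (bm_of Y) (bm_of R) h x)"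

definition fib_map :: "'u \<Rightarrow> ('u, 'u + 'u, 'u, 'u) probe" where
  "fib_map x = \<lparr>onA = (\<lambda>a\<in>arcs (fib x). case a of Inl f \<Rightarrow> flip Y (src Y f) | Inr f \<Rightarrow> src Y f),
      onH = (\<lambda>f\<in>hedges (fib x). f), onV = (\<lambda>v\<in>verts (fib x). v)\<rparr>"

lemma fibre_simps:
  "bm_verts (fibre (bm_of Y) (bm_of R) h x) = {v \<in> verts Y. mV h v = x}"
  "bm_flags (fibre (bm_of Y) (bm_of R) h x) = {f \<in> hedges Y. mV h (vtx Y f) = x}"
  "bd (fibre (bm_of Y) (bm_of R) h x) = vtx Y"
  "f \<in> hedges Y \<Longrightarrow> jinv (fibre (bm_of Y) (bm_of R) h x) f =
     (if f \<in> mF h ` hedges R then f else jinv (bm_of Y) f)"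
  by (simp_all add: fibre_def hD(5))

lemmas compl_jinv = comp_mor_compl_jinv[OF h is_bm_graph_bm_of[OF Y(1)] is_bm_graph_bm_of[OF R(1)],
    unfolded bm_of_simps]

lemma is_bm_graph_fibre: "is_bm_graph (fibre (bm_of Y) (bm_of R) h x)"
proof -
  note B = bm_graphD[OF is_bm_graph_bm_of[OF Y(1)], unfolded bm_of_simps]
  have "jinv (bm_of Y) f \<noteq> mF h g" if "f \<in> hedges Y" "f \<notin> mF h ` hedges R" "g \<in> hedges R" for f g
    using compl_jinv[OF that(1,2)] that(3) by blast
  then show ?thesis
    using B(3-5) hD(9) finite_subset[OF _ B(1)] finite_subset[OF _ B(2)]
    by (auto simp: is_bm_graph_def fibre_simps)
qed

text \<open>A contracted flag is never fixed by the involution, so the tails of a fibre are the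
  flags at which it is cut, and these come from the half-edges of \<open>R\<close> at
  \<open>x\<close>.\<close>

lemma tails_fibre: "tails (fibre (bm_of Y) (bm_of R) h x) = mF h ` flags_at R x"
proof -
  have "jinv (fibre (bm_of Y) (bm_of R) h x) f = f \<longleftrightarrow> f \<in> mF h ` hedges R" if "f \<in> hedges Y" for f
    using that hD(8) by (simp add: fibre_simps)
  then have "tails (fibre (bm_of Y) (bm_of R) h x) =
      {f \<in> hedges Y. mV h (vtx Y f) = x \<and> f \<in> mF h ` hedges R}"
    by (auto simp: tails_def fibre_simps(2))
  also have "\<dots> = mF h ` flags_at R x" using hD(1,7) by (auto simp: flags_at_def)
  finally show ?thesis .
qed

text \<open>At a cut flag \<open>f\<close> the new port is placed over the arc opposite
  \<open>src Y f\<close>. At a contracted flag the opposite flag lies in the same fibre, so the edge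
  is kept and commutation with \<open>flip\<close> is inherited from \<open>Y\<close>.\<close>

lemma etale_fib_map: "etale (fib x) Y (fib_map x)"
proof -
  let ?F = "fibre (bm_of Y) (bm_of R) h x"
  have T: "t \<in> hedges Y" "mV h (vtx Y t) = x" if "t \<in> tails ?F" for t
    using that by (auto simp: tails_def fibre_simps)
  show ?thesis
    unfolding etale_def
  proof (intro conjI)
    show "onA (fib_map x) \<in> arcs (fib x) \<rightarrow>\<^sub>E arcs Y"
      using T graphD(1,4)[OF Y(1)] by (auto simp: fib_map_def fib_def fibre_simps)
    show "\<forall>a\<in>arcs (fib x). onA (fib_map x) (flip (fib x) a) = flip Y (onA (fib_map x) a)"
    proof
      fix a assume a: "a \<in> arcs (fib x)"
      then have fa: "flip (fib x) a \<in> arcs (fib x)"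
        using graphD(1)[OF is_graph_phi_ob[OF is_bm_graph_fibre]] by (simp only: fib_def)
      show "onA (fib_map x) (flip (fib x) a) = flip Y (onA (fib_map x) a)"
      proof (cases a)
        case (Inl t)
        then have "t \<in> tails ?F" using a by (auto simp: fib_def)
        then show ?thesis
          using a fa Inl T(1) graphD(2,4)[OF Y(1)] by (simp add: fib_map_def) (simp add: fib_def)
      next
        case (Inr f)
        then have f: "f \<in> hedges Y" "mV h (vtx Y f) = x" using a by (auto simp: fib_def fibre_simps)
        show ?thesis
        proof (cases "f \<in> mF h ` hedges R")
          case True
          then have "flip (fib x) a = Inl f" using Inr f by (simp add: fib_def fibre_simps)
          then show ?thesis using a fa Inr by (simp add: fib_map_def)
        next
          case False
          then have "flip (fib x) a = Inr (jinv (bm_of Y) f)"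
            using Inr f hD(8) by (simp add: fib_def fibre_simps)
          then show ?thesis
            using a fa Inr jinv_bm_of(3)[OF Y(1) f(1) hD(8)[OF f(1) False]] by (simp add: fib_map_def)
        qed
      qed
    qed
  qed (auto simp: fib_map_def fib_def fibre_simps graphD(6)[OF Y(1)])
qed

lemma emb_fib:
  assumes x: "x \<in> verts R" and i: "bij_betw i n (flags_at R x)"
  shows "emb Y n {v \<in> verts Y. mV h v = x} (\<lambda>k. flip Y (src Y (mF h (i k))))
    \<lparr>gr = fib x, lab = (\<lambda>k. Inl (mF h (i k))), dec = rep_map (fib x) (fib_map x)\<rparr> (fib_map x)"
  unfolding emb_def dgraph.simps
proof (intro conjI)
  show "is_graph (fib x)" "no_isolated_edges (fib x)"
    by (simp_all add: fib_def is_graph_phi_ob is_bm_graph_fibre no_isolated_edges_phi_ob)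
  have "inj_on (mF h) (flags_at R x)" using hD(2) by (auto simp: flags_at_def inj_on_def)
  then have "bij_betw (Inl \<circ> (mF h \<circ> i)) n (Inl ` mF h ` flags_at R x)"
    by (intro bij_betw_trans[OF bij_betw_trans[OF i]] bij_betw_imageI refl) simp_all
  then show "bij_betw (\<lambda>k. Inl (mF h (i k))) n (ports (fib x))"
    by (simp add: fib_def ports_phi_ob tails_fibre o_def)
  show "inj_on (onV (fib_map x)) (verts (fib x))" by (simp add: fib_map_def inj_on_def)
  show "onV (fib_map x) ` verts (fib x) = {v \<in> verts Y. mV h v = x}"
    by (simp add: fib_map_def) (simp add: fib_def fibre_simps)
  show "\<forall>k\<in>n. onA (fib_map x) (Inl (mF h (i k))) = flip Y (src Y (mF h (i k)))"
    using bij_betwE[OF i] by (auto simp: fib_map_def fib_def tails_fibre)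
qed (simp_all add: etale_fib_map)

text \<open>This form of \<open>phi_mor\<close> makes sense between arbitrary graphs. Its value on
  corollas is a \<open>cls\<close>, so computing with it amounts to tracking a vertex set and a
  family of arcs.\<close>

definition kl :: "'u kl_mor" where
  "kl = (\<lambda>e\<in>el_ob. \<lambda>m\<in>el_hom e R. case e of
       Unit \<Rightarrow> Inl (unit_probe (\<lambda>a. amap (onA m a)))
     | Corolla n \<Rightarrow> Inr (cls Y n {v \<in> verts Y. mV h v = onV m undefined} (\<lambda>k. amap (onA m (Inl k)))))"

lemma fibre_nonempty: "x \<in> verts R \<Longrightarrow> {v \<in> verts Y. mV h v = x} \<noteq> {}"
proof -
  assume "x \<in> verts R"
  then have "x \<in> mV h ` verts Y" by (simp only: hD(4))
  then show ?thesis by auto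
qed

lemma kl_Unit:
  assumes m: "m \<in> el_hom Unit R"
  shows "kl Unit m = Inl (uprobe Y (amap (onA m (Inl undefined))))"
  using m unit_probe_eq_uprobe[of "\<lambda>a. amap (onA m a)" Y] amap_flip uprobe_cases[OF m]
  by (simp add: kl_def)

lemma kl_Corolla:
  "m \<in> el_hom (Corolla n) R \<Longrightarrow> finite n \<Longrightarrow> kl (Corolla n) m =
     Inr (cls Y n {v \<in> verts Y. mV h v = onV m undefined} (\<lambda>k. amap (onA m (Inl k))))"
  by (simp add: kl_def)

lemma emb_fib_probe:
  assumes m: "m \<in> el_hom (Corolla n) R"
  shows "emb Y n {v \<in> verts Y. mV h v = onV m undefined} (\<lambda>k. amap (onA m (Inl k)))
    \<lparr>gr = fib (onV m undefined), lab = (\<lambda>k. Inl (mF h (onH m k))),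
     dec = rep_map (fib (onV m undefined)) (fib_map (onV m undefined))\<rparr> (fib_map (onV m undefined))"
proof -
  have "amap (onA m (Inl k)) = flip Y (src Y (mF h (onH m k)))" if "k \<in> n" for k
    using corolla_cases(4,6)[OF m that] amap_flip_src by simp
  then show ?thesis by (rule iffD2[OF emb_cong emb_fib[OF corolla_cases(2,1)[OF m]]])
qed

lemma kl_Corolla_iso_class:
  assumes m: "m \<in> el_hom (Corolla n) R" and n: "finite n"
  shows "kl (Corolla n) m = Inr (iso_class (rep Y) n
    \<lparr>gr = fib (onV m undefined), lab = (\<lambda>k. Inl (mF h (onH m k))),
     dec = rep_map (fib (onV m undefined)) (fib_map (onV m undefined))\<rparr>)"
  using kl_Corolla[OF assms] iso_class_emb[OF emb_fib_probe[OF m] fibre_nonempty[OF corolla_cases(2)[OF m]] Y(1)]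
  by simp

end

section \<open>The Kleisli morphism of a refinement\<close>

lemma bar_simps [simp]: "val (bar F) e = bar_val F e" "act (bar F) = bar_act F"
  by (simp_all add: bar_def)

text \<open>The action evaluates a representative picked by \<open>SOME\<close>, but every member of
  the class has its port \<open>k\<close> over \<open>l k\<close>, so the result is independent of
  the choice.\<close>

lemma bar_act_Unit_cls:
  fixes Y :: "('b, 'k, 'w) graph" and n :: "'u set"
  assumes m: "m \<in> el_hom Unit (corolla n)" and ne: "cls Y n W l \<noteq> {}"
  shows "bar_act (rep Y) Unit (Corolla n) m (Inr (cls Y n W l)) =
    Inl (uprobe Y (case onA m (Inl undefined) of Inl k \<Rightarrow> l k | Inr k \<Rightarrow> flip Y (l k)))"
proof -
  define D where "D = (SOME D. D \<in> cls Y n W l)"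
  have "D \<in> cls Y n W l" unfolding D_def using ne by (rule some_in_eq[THEN iffD2])
  then obtain s where s: "emb Y n W l D s" by (auto simp: cls_def)
  note D = embD[OF s]
  let ?a = "onA m (Inl undefined)" and ?c = "corolla_arc D"
  have a: "?a \<in> Inl ` n \<union> Inr ` n" using uprobe_cases(2)[OF m] by simp
  have a2: "onA m (Inr undefined) = flip (corolla n) ?a" by (rule uprobe_cases(3)[OF m])
  have c: "?c ?a \<in> arcs (gr D)" using a D(10) graphD(1)[OF D(1)] by (auto simp: corolla_arc_def)
  have "?c (onA m (Inr undefined)) = flip (gr D) (?c ?a)"
    using a a2 D(10) graphD(2)[OF D(1)] by (auto simp: corolla_arc_def)
  then have "unit_probe (\<lambda>a. ?c (onA m a)) = uprobe (gr D) (?c ?a)"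
    by (rule unit_probe_eq_uprobe)
  moreover have "(uprobe (gr D) (?c ?a) :: ('u, _, _, _) probe) \<in> el_hom Unit (gr D)"
    by (rule uprobe_in[OF D(1) c])
  moreover have "gcomp unit_graph s (uprobe (gr D) (?c ?a)) = (uprobe Y (onA s (?c ?a)) :: ('u, _, _, _) probe)"
    by (rule gcomp_uprobe[OF D(4,1) c])
  ultimately have "dec D Unit (unit_probe (\<lambda>a. ?c (onA m a))) = uprobe Y (onA s (?c ?a))"
    using D(8) by (simp add: rep_map_def)
  moreover have "onA s (?c ?a) = (case ?a of Inl k \<Rightarrow> l k | Inr k \<Rightarrow> flip Y (l k))"
    using a D(7) etaleD(4)[OF D(4) D(10)] by (auto simp: corolla_arc_def)
  ultimately show ?thesis by (simp add: D_def Let_def)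
qed

lemma emb_in_cls: "emb Y n W l D s \<Longrightarrow> D \<in> cls Y n W l"
  by (auto simp: cls_def)

lemma emb_relabel:
  assumes s: "emb Y n W l D s" and i: "bij_betw i k n"
  shows "emb Y k W (\<lambda>j. l (i j)) (D\<lparr>lab := \<lambda>j. lab D (i j)\<rparr>) s"
  using embD[OF s] bij_betw_trans[OF i embD(3)[OF s]] bij_betwE[OF i]
  by (auto simp: emb_def o_def)

text \<open>Relabelling any member along the bijection \<open>onH m\<close> gives the same class, so
  the union in \<open>bar_act\<close> is a union of equal sets over a nonempty index set.\<close>

lemma bar_act_Corolla_cls:
  assumes m: "m \<in> el_hom (Corolla k) (corolla n)" and ne: "cls Y n W l \<noteq> {}"
    and W: "W \<noteq> {}" and Y: "is_graph Y"
  shows "bar_act (rep Y) (Corolla k) (Corolla n) m (Inr (cls Y n W l)) =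
    Inr (cls Y k W (\<lambda>i. l (onH m i)))"
proof -
  have "iso_class (rep Y) k (D\<lparr>lab := \<lambda>j. lab D (onH m j)\<rparr>) = cls Y k W (\<lambda>i. l (onH m i))"
    if D: "D \<in> cls Y n W l" for D
  proof -
    obtain s where "emb Y n W l D s" using D by (auto simp: cls_def)
    from iso_class_emb[OF emb_relabel[OF this corolla_to_corolla(1)[OF m]] W Y] show ?thesis .
  qed
  then show ?thesis using ne by (simp add: SUP_eq_const)
qed

context refinement
begin

lemma cls_nonempty:
  fixes n :: "'u set"
  assumes m: "m \<in> el_hom (Corolla n) R"
  shows "cls Y n {v \<in> verts Y. mV h v = onV m undefined} (\<lambda>k. amap (onA m (Inl k))) \<noteq> {}"
  using emb_in_cls[OF emb_fib_probe[OF m]] by auto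

lemma kl_in:
  assumes e: "e \<in> el_ob" and m: "m \<in> el_hom e R"
  shows "kl e m \<in> bar_val (rep Y) e"
  using e
proof (cases rule: el_ob_cases)
  case 1
  then show ?thesis using m kl_Unit uprobe_in[OF Y(1)] amap_in uprobe_cases(2) by fastforce
next
  case (2 n)
  then have m: "m \<in> el_hom (Corolla n) R" using m by simp
  show ?thesis
    using 2 kl_Corolla_iso_class[OF m 2(2)]
      emb_is_dgraph[OF emb_fib_probe[OF m] fibre_nonempty[OF corolla_cases(2)[OF m]]]
    by auto
qed

text \<open>There is no map from a corolla to the unit graph, which leaves three shapes of
  \<open>m\<close>. Naturality on arcs is the compatibility of \<open>amap\<close> with
  \<open>src\<close> and \<open>flip\<close>; between corollas it is relabelling, with the vertex
  unchanged.\<close>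

lemma kl_natural:
  assumes e: "e \<in> el_ob" and d: "d \<in> el_ob" and m: "m \<in> el_hom e (el_graph d)" and x: "x \<in> el_hom d R"
  shows "kl e (gcomp (el_graph e) x m) = bar_act (rep Y) e d m (kl d x)"
proof -
  have xe: "etale (el_graph d) R x" using x by (simp add: el_hom_def)
  have xm: "gcomp (el_graph e) x m \<in> el_hom e R" by (rule el_hom_gcomp[OF e m xe])
  show ?thesis
    using d
  proof (cases rule: el_ob_cases)
    case 1
    have eU: "e = Unit" using e m no_corolla_to_unit 1 by (cases rule: el_ob_cases) auto
    have m1: "m \<in> el_hom Unit unit_graph" and x1: "x \<in> el_hom Unit R" using m x 1 eU by simp_all
    let ?b = "onA m (Inl undefined)" and ?p = "uprobe Y (amap (onA x (Inl undefined)))"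
    have xa: "onA x (Inl undefined) \<in> arcs R" by (rule uprobe_cases(2)[OF x1])
    have b: "?b \<in> arcs unit_graph" by (rule uprobe_cases(2)[OF m1])
    have pe: "etale unit_graph Y ?p"
      using uprobe_in[OF Y(1) amap_in[OF xa]] by (simp add: el_hom_def)
    have U: "is_graph unit_graph" using is_graph_el_graph[of Unit] by simp
    have "gcomp unit_graph ?p m = gcomp unit_graph ?p (uprobe unit_graph ?b)"
      using uprobe_cases(1)[OF m1] by simp
    also have "\<dots> = uprobe Y (onA ?p ?b)" by (rule gcomp_uprobe[OF pe U b])
    also have "onA ?p ?b = amap (onA x ?b)"
      using b uprobe_cases(3)[OF x1] amap_flip[OF xa] by (auto simp: unit_graph_def)
    finally have "gcomp unit_graph ?p m = uprobe Y (amap (onA x ?b))" .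
    moreover have "onA (gcomp unit_graph x m) (Inl undefined) = onA x ?b" by (simp add: unit_graph_def)
    ultimately show ?thesis using 1 eU xm kl_Unit[OF x1] kl_Unit by simp
  next
    case (2 n)
    then have x2: "x \<in> el_hom (Corolla n) R" using x by simp
    have vx: "onV x undefined \<in> verts R" by (rule corolla_cases(2)[OF x2])
    show ?thesis
      using e
    proof (cases rule: el_ob_cases)
      case 1
      let ?b = "onA m (Inl undefined)"
      have m1: "m \<in> el_hom Unit (corolla n)" using m 1 2 by simp
      have b: "?b \<in> Inl ` n \<union> Inr ` n" using uprobe_cases(2)[OF m1] by simp
      have "amap (onA x ?b) = (case ?b of Inl k \<Rightarrow> amap (onA x (Inl k)) | Inr k \<Rightarrow> flip Y (amap (onA x (Inl k))))"
        using b corolla_cases(4,6)[OF x2] amap_src[OF corolla_cases(6)[OF x2]]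
          amap_flip_src[OF corolla_cases(6)[OF x2]] corolla_cases(5)[OF x2]
          graphD(2,4)[OF Y(1)] hD(1)[OF corolla_cases(6)[OF x2]] by auto
      moreover have "onA (gcomp unit_graph x m) (Inl undefined) = onA x ?b" by (simp add: unit_graph_def)
      ultimately show ?thesis
        using 1 2 bar_act_Unit_cls[OF m1 cls_nonempty[OF x2]] kl_Corolla[OF x2 2(2)] xm
          kl_Unit[of "gcomp unit_graph x m"] by simp
    next
      case e: (2 k)
      have m2: "m \<in> el_hom (Corolla k) (corolla n)" using m e 2 by simp
      let ?xm = "gcomp (corolla k) x m"
      have xm2: "?xm \<in> el_hom (Corolla k) R" using xm e by simp
      have "onA ?xm (Inl i) = onA x (Inl (onH m i))" if "i \<in> k" for i
        using that corolla_to_corolla(3)[OF m2 that] by simp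
      then have "cls Y k W (\<lambda>i. amap (onA ?xm (Inl i))) = cls Y k W (\<lambda>i. amap (onA x (Inl (onH m i))))" for W
        by (intro cls_cong) simp
      moreover have "onV ?xm undefined = onV x undefined" using corolla_to_corolla(2)[OF m2] by simp
      ultimately show ?thesis
        using e 2 bar_act_Corolla_cls[OF m2 cls_nonempty[OF x2] fibre_nonempty[OF vx] Y(1)]
          kl_Corolla[OF x2 2(2)] kl_Corolla[OF xm2 e(2)] by simp
    qed
  qed
qed

lemma kl_nat_trans: "nat_trans (rep R) (bar (rep Y)) kl"
  unfolding nat_trans_def
proof (intro conjI ballI)
  show "kl \<in> (\<Pi>\<^sub>E e\<in>el_ob. val (rep R) e \<rightarrow>\<^sub>E val (bar (rep Y)) e)"
    using kl_in by (auto simp: kl_def)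
  show "kl e (act (rep R) e d m x) = act (bar (rep Y)) e d m (kl d x)"
    if "e \<in> el_ob" "d \<in> el_ob" "m \<in> el_hom e (el_graph d)" "x \<in> val (rep R) d" for e d m x
    using kl_natural that by simp
qed

end

text \<open>Values on arcs recover \<open>mF\<close>. The value at the canonical corolla of a vertex
  \<open>x\<close> determines the vertex set of its members, which is the fibre over
  \<open>x\<close>, and the fibres recover \<open>mV\<close>.\<close>

lemma kl_inject:
  fixes R Y :: "'u ugraph"
  assumes h: "refinement R Y h" and k: "refinement R Y k"
    and eq: "refinement.kl R Y h = refinement.kl R Y k"
  shows "h = k"
proof -
  interpret h: refinement R Y h by fact
  interpret k: refinement R Y k by fact
  have a: "h.amap a = k.amap a" if a: "a \<in> arcs R" for a
  proof -
    let ?m = "uprobe R a :: ('u, 'u + 'u, 'u, 'u) probe"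
    have m: "?m \<in> el_hom Unit R" by (rule uprobe_in[OF h.R(1) a])
    have "h.kl Unit ?m = k.kl Unit ?m" by (simp only: eq)
    then have "(uprobe Y (h.amap a) :: ('u, _, _, _) probe) = uprobe Y (k.amap a)"
      by (simp add: h.kl_Unit[OF m] k.kl_Unit[OF m])
    then have "onA (uprobe Y (h.amap a) :: ('u, _, _, _) probe) (Inl undefined) =
        onA (uprobe Y (k.amap a) :: ('u, _, _, _) probe) (Inl undefined)" by (simp only:)
    then show ?thesis by simp
  qed
  show ?thesis
  proof (rule comp_mor_eqI[OF h.h k.h], unfold bm_of_simps)
    fix f assume f: "f \<in> hedges R"
    have "src Y (mF h f) = src Y (mF k f)"
      using a graphD(4)[OF h.R(1) f] h.amap_src[OF f] k.amap_src[OF f] by metis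
    then show "mF h f = mF k f" using graphD(5)[OF h.Y(1) h.hD(1)[OF f] k.hD(1)[OF f]] by blast
  next
    fix v assume v: "v \<in> verts Y"
    let ?x = "mV h v"
    have x: "?x \<in> verts R" by (rule h.hD(3)[OF v])
    note m = corolla_at_in[OF h.R(1) x]
    let ?n = "flags_at R ?x" and ?m = "corolla_at R ?x"
    have n: "finite ?n" by (rule finite_flags_at[OF h.R(1)])
    let ?C = "cls Y ?n {v \<in> verts Y. mV h v = ?x} (\<lambda>k. h.amap (onA ?m (Inl k)))"
    have V: "onV ?m undefined = ?x" by (simp add: corolla_at_def)
    have "h.kl (Corolla ?n) ?m = k.kl (Corolla ?n) ?m" by (simp only: eq)
    then have C: "?C = cls Y ?n {v \<in> verts Y. mV k v = ?x} (\<lambda>i. k.amap (onA ?m (Inl i)))"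
      using h.kl_Corolla[OF m n] k.kl_Corolla[OF m n] by (simp add: V)
    obtain D where D: "D \<in> ?C" using h.cls_nonempty[OF m] V by auto
    have eqW: "{v \<in> verts Y. mV h v = ?x} = {v \<in> verts Y. mV k v = ?x}"
      by (rule cls_determines_image[OF D]) (use D C in simp)
    have "v \<in> {v \<in> verts Y. mV h v = ?x}" using v by simp
    then show "mV h v = mV k v" unfolding eqW by simp
  qed
qed

lemma refinement_id: "is_graph R \<Longrightarrow> no_isolated_edges R \<Longrightarrow> refinement R R (bm_id (bm_of R))"
  by (simp add: refinement_def comp_mor_id is_bm_graph_bm_of)

text \<open>The corolla underlying the monad unit is cut out of \<open>R\<close> by the probe
  itself, around a single vertex; this is also the fibre of the identity compression.\<close>

lemma emb_unit:
  fixes R :: "('a, 'h, 'v) graph"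
  assumes x: "x \<in> el_hom (Corolla n) R" and n: "finite n"
  shows "emb R n {onV x undefined} (\<lambda>k. onA x (Inl k))
    \<lparr>gr = corolla n, lab = Inl,
     dec = (\<lambda>d\<in>el_ob. \<lambda>m\<in>el_hom d (corolla n). act (rep R) d (Corolla n) m x)\<rparr> x"
proof -
  have "is_graph (corolla n)" using is_graph_el_graph[of "Corolla n"] n by simp
  moreover have p: "ports (corolla n) = Inl ` n" by (auto simp: ports_def)
  moreover have "no_isolated_edges (corolla n)" by (auto simp: no_isolated_edges_def p)
  ultimately show ?thesis using x by (simp add: emb_def el_hom_def rep_map_def bij_betw_def)
qed

lemma kl_id:
  assumes "is_graph R" "no_isolated_edges R"
  shows "refinement.kl R R (bm_id (bm_of R)) = unit_tr (rep R)"
proof -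
  interpret refinement R R "bm_id (bm_of R)" by (rule refinement_id[OF assms])
  have a: "amap a = a" if "a \<in> arcs R" for a
    by (rule amap_unique[OF _ _ that, symmetric]) (simp_all add: bm_id_def)
  have "kl e m = unit_tr (rep R) e m" if e: "e \<in> el_ob" and m: "m \<in> el_hom e R" for e m
    using e
  proof (cases rule: el_ob_cases)
    case 1
    then have "kl e m = Inl (uprobe R (onA m (Inl undefined)))"
      using m kl_Unit a uprobe_cases(2) by fastforce
    then show ?thesis using 1 m uprobe_cases(1) by (fastforce simp: unit_tr_def)
  next
    case (2 n)
    then have m: "m \<in> el_hom (Corolla n) R" using m by simp
    have "onA m (Inl k) \<in> arcs R" if "k \<in> n" for k
      using etaleD(1)[of "corolla n" R m] m that by (simp add: el_hom_def)
    then have "cls R n W (\<lambda>k. amap (onA m (Inl k))) = cls R n W (\<lambda>k. onA m (Inl k))" for W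
      using a by (intro cls_cong) blast
    moreover have "{v \<in> verts R. mV (bm_id (bm_of R)) v = onV m undefined} = {onV m undefined}"
      using corolla_cases(2)[OF m] by (auto simp: bm_id_def)
    moreover have "unit_tr (rep R) e m = Inr (cls R n {onV m undefined} (\<lambda>k. onA m (Inl k)))"
      using iso_class_emb[OF emb_unit[OF m 2(2)] _ assms(1)] m 2 by (simp add: unit_tr_def)
    ultimately show ?thesis using kl_Corolla[OF m 2(2)] 2 by simp
  qed
  then show ?thesis
    by (intro ext) (auto simp: kl_def unit_tr_def restrict_def)
qed

lemma jinv_phi_ob:
  assumes \<tau>: "is_bm_graph \<tau>" and f: "f \<in> bm_flags \<tau>"
  shows "jinv (bm_of (phi_ob \<tau>)) f = jinv \<tau> f"
proof (cases "jinv \<tau> f = f")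
  case True
  then have "flip (phi_ob \<tau>) (src (phi_ob \<tau>) f) \<in> ports (phi_ob \<tau>)"
    using f by (simp add: ports_phi_ob tails_def)
  then show ?thesis using jinv_bm_of(2)[OF is_graph_phi_ob[OF \<tau>], of f] f True by simp
next
  case False
  then show ?thesis
    using jinv_bm_of(1)[OF is_graph_phi_ob[OF \<tau>], of f "jinv \<tau> f"] f bm_graphD(4)[OF \<tau> f] by simp
qed

text \<open>\<open>bm_of (phi_ob \<tau>)\<close> is known to agree with \<open>\<tau>\<close> only
  on the carriers, not as a record, so compressions are transferred by this congruence.\<close>

lemma comp_mor_cong:
  assumes "bm_verts \<tau> = bm_verts \<tau>'" "bm_flags \<tau> = bm_flags \<tau>'" "bm_verts \<sigma> = bm_verts \<sigma>'"
    "bm_flags \<sigma> = bm_flags \<sigma>'" "is_bm_graph \<tau>" "is_bm_graph \<sigma>"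
    "\<And>f. f \<in> bm_flags \<tau> \<Longrightarrow> bd \<tau> f = bd \<tau>' f \<and> jinv \<tau> f = jinv \<tau>' f"
    "\<And>f. f \<in> bm_flags \<sigma> \<Longrightarrow> bd \<sigma> f = bd \<sigma>' f \<and> jinv \<sigma> f = jinv \<sigma>' f"
    and c: "comp_mor \<tau> \<sigma> h"
  shows "comp_mor \<tau>' \<sigma>' h"
proof -
  note D = comp_morD[OF c]
  have "bd \<tau>' f = bd \<tau> f" "jinv \<tau>' f = jinv \<tau> f" if "f \<in> bm_flags \<tau>'" for f using assms(2,7) that by auto
  moreover have "bd \<sigma>' f = bd \<sigma> f" "jinv \<sigma>' f = jinv \<sigma> f" if "f \<in> bm_flags \<sigma>'" for f
    using assms(4,8) that by auto
  moreover have "restrict (jinv \<tau>) (bm_flags \<tau> - A) = restrict (jinv \<tau>') (bm_flags \<tau>' - A)" for A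
    using assms(2,7) by (auto simp: restrict_def)
  ultimately show ?thesis
    using c bm_graphD(4)[OF assms(5)] D(1) unfolding comp_mor_def by (simp add: assms(1-4)[symmetric])
qed

lemma comp_mor_phi_ob:
  assumes "is_bm_graph \<tau>" "is_bm_graph \<sigma>"
  shows "comp_mor (bm_of (phi_ob \<tau>)) (bm_of (phi_ob \<sigma>)) h \<longleftrightarrow> comp_mor \<tau> \<sigma> h"
proof
  note B = is_bm_graph_bm_of[OF is_graph_phi_ob] and J = jinv_phi_ob
  show "comp_mor \<tau> \<sigma> h" if "comp_mor (bm_of (phi_ob \<tau>)) (bm_of (phi_ob \<sigma>)) h"
    using comp_mor_cong[OF _ _ _ _ B[OF assms(1)] B[OF assms(2)] _ _ that] J[OF assms(1)] J[OF assms(2)]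
    by simp
  show "comp_mor (bm_of (phi_ob \<tau>)) (bm_of (phi_ob \<sigma>)) h" if "comp_mor \<tau> \<sigma> h"
    by (rule comp_mor_cong[OF _ _ _ _ assms _ _ that]) (simp_all add: J[OF assms(1)] J[OF assms(2)])
qed

lemma refinement_phi_ob:
  "is_bm_graph \<tau> \<Longrightarrow> is_bm_graph \<sigma> \<Longrightarrow> comp_mor \<tau> \<sigma> h \<Longrightarrow> refinement (phi_ob \<sigma>) (phi_ob \<tau>) h"
  by (simp add: refinement_def is_graph_phi_ob no_isolated_edges_phi_ob comp_mor_phi_ob)

text \<open>On values of \<open>phi_ob\<close> the map \<open>map_sum (mF h) (mF h)\<close>
  satisfies the equations characterising \<open>amap\<close>, and the two descriptions of the fibre
  and of its map to \<open>phi_ob \<tau>\<close> coincide.\<close>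

lemma phi_mor_eq_kl:
  assumes \<tau>: "is_bm_graph \<tau>" and \<sigma>: "is_bm_graph \<sigma>" and c: "comp_mor \<tau> \<sigma> h"
  shows "phi_mor \<tau> \<sigma> h = refinement.kl (phi_ob \<sigma>) (phi_ob \<tau>) h"
proof -
  interpret refinement "phi_ob \<sigma>" "phi_ob \<tau>" h by (rule refinement_phi_ob[OF assms])
  have a: "map_sum (mF h) (mF h) a = amap a" if "a \<in> arcs (phi_ob \<sigma>)" for a
    by (rule amap_unique[OF _ _ that])
      (use comp_morD(1,2,6)[OF c] bm_graphD(4)[OF \<sigma>] in \<open>auto simp: inj_on_eq_iff\<close>)
  have f: "fib x = phi_ob (fibre \<tau> \<sigma> h x)" for x by (simp add: fib_def fibre_def)
  have fm: "fib_map x = fibre_map \<tau> \<sigma> h x" for x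
    by (auto simp: fib_map_def fibre_map_def Let_def f cong: restrict_cong sum.case_cong)
  have "kl e m = phi_mor \<tau> \<sigma> h e m" if e: "e \<in> el_ob" and m: "m \<in> el_hom e (phi_ob \<sigma>)" for e m
    using e
  proof (cases rule: el_ob_cases)
    case 1
    have "onA m a \<in> arcs (phi_ob \<sigma>)" if "a \<in> arcs unit_graph" for a
      using m 1 that etaleD(1) by (fastforce simp: el_hom_def)
    then have "unit_probe (\<lambda>a. amap (onA m a)) = unit_probe (\<lambda>a. map_sum (mF h) (mF h) (onA m a))"
      using a by (intro unit_probe_cong) (simp_all add: unit_graph_def)
    then show ?thesis using 1 m by (simp add: kl_def phi_mor_def)
  next
    case (2 n)
    then show ?thesis using m kl_Corolla_iso_class[of m n] by (simp add: phi_mor_def Let_def f fm)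
  qed
  then show ?thesis by (intro ext) (auto simp: kl_def phi_mor_def restrict_def)
qed

section \<open>Gluing\<close>

locale gluing =
  fixes R :: "'u ugraph" and F :: "('u, 'x) species"
    and \<phi> :: "('u, ('u, 'u + 'u, 'u, 'u) probe, ('u, 'x) bar) nat_tr"
  assumes R: "is_graph R" "no_isolated_edges R" and \<phi>: "nat_trans (rep R) (bar F) \<phi>"
begin

abbreviation S where "S \<equiv> piece R \<phi>"
abbreviation G where "G \<equiv> glue_graph R S"

lemma piece_class:
  assumes x: "x \<in> verts R"
  obtains D :: "('u, 'x) udgraph" where "is_dgraph F (flags_at R x) D"
    "\<phi> (Corolla (flags_at R x)) (corolla_at R x) = Inr (iso_class F (flags_at R x) D)"
    "S x \<in> iso_class F (flags_at R x) D"
proof -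
  have "\<phi> (Corolla (flags_at R x)) (corolla_at R x) \<in> bar_val F (Corolla (flags_at R x))"
    using nat_transD(1)[OF \<phi>] corolla_at_in[OF R(1) x] finite_flags_at[OF R(1)] by force
  then obtain D :: "('u, 'x) udgraph" where D: "is_dgraph F (flags_at R x) D"
    "\<phi> (Corolla (flags_at R x)) (corolla_at R x) = Inr (iso_class F (flags_at R x) D)" by auto
  have "S x = (SOME D'. D' \<in> iso_class F (flags_at R x) D)" by (simp add: piece_def D(2))
  then have "S x \<in> iso_class F (flags_at R x) D"
    using someI[of "\<lambda>D'. D' \<in> iso_class F (flags_at R x) D", OF self_in_iso_class[OF D(1)]] by simp
  then show thesis using that D by blast
qed

lemma piece_dgraph: "x \<in> verts R \<Longrightarrow> is_dgraph F (flags_at R x) (S x)"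
  using piece_class by (metis (no_types, lifting) iso_class_def mem_Collect_eq)

lemmas SD = is_dgraphD[OF piece_dgraph]

lemma vtxR: "f \<in> hedges R \<Longrightarrow> vtx R f \<in> verts R" "f \<in> hedges R \<Longrightarrow> f \<in> flags_at R (vtx R f)"
  using graphD(6)[OF R(1)] by (auto simp: flags_at_def)

text \<open>Each of the two arcs at \<open>f\<close> factors through the canonical corolla at
  \<open>x\<close>, so naturality expresses its value by the action on the value at that corolla.
  The action picks its representative by the same \<open>SOME\<close> as \<open>piece\<close>, which
  makes \<open>S x\<close> appear.\<close>

lemma phi_Unit:
  assumes f: "f \<in> hedges R"
  defines "x \<equiv> vtx R f"
  shows "\<phi> Unit (uprobe R (flip R (src R f))) = Inl (dec (S x) Unit (uprobe (gr (S x)) (lab (S x) f)))"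
    "\<phi> Unit (uprobe R (src R f)) =
      Inl (dec (S x) Unit (uprobe (gr (S x)) (flip (gr (S x)) (lab (S x) f))))"
proof -
  have x: "x \<in> verts R" "f \<in> flags_at R x" using vtxR[OF f] by (simp_all add: x_def)
  let ?n = "flags_at R x"
  have n: "finite ?n" by (rule finite_flags_at[OF R(1)])
  note c = corolla_at_in[OF R(1) x(1)]
  have C: "is_graph (corolla ?n)" using is_graph_el_graph[of "Corolla ?n"] n by simp
  have *: "\<phi> Unit (uprobe R (onA (corolla_at R x) a)) =
      Inl (dec (S x) Unit (unit_probe (\<lambda>b. corolla_arc (S x) (onA (uprobe (corolla ?n) a) b))))"
    if a: "a \<in> arcs (corolla ?n)" for a
  proof -
    let ?u = "uprobe (corolla ?n) a :: ('u, _, _, _) probe"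
    have u: "?u \<in> el_hom Unit (corolla ?n)" by (rule uprobe_in[OF C a])
    have "\<phi> Unit (act (rep R) Unit (Corolla ?n) ?u (corolla_at R x)) =
        act (bar F) Unit (Corolla ?n) ?u (\<phi> (Corolla ?n) (corolla_at R x))"
      using nat_transD(2)[OF \<phi>, of Unit "Corolla ?n" ?u "corolla_at R x"] n u c by simp
    moreover have "gcomp unit_graph (corolla_at R x) ?u = uprobe R (onA (corolla_at R x) a)"
      using c by (intro gcomp_uprobe[OF _ C a]) (simp add: el_hom_def)
    ultimately show ?thesis by (simp add: piece_def Let_def)
  qed
  note lx = SD(7)[OF x]
  have "unit_probe (\<lambda>b. corolla_arc (S x) (onA (uprobe (corolla ?n) (Inl f)) b)) =
      (uprobe (gr (S x)) (lab (S x) f) :: ('u, _, _, _) probe)"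
    by (subst unit_probe_eq_uprobe[of _ "gr (S x)"]) (simp_all add: corolla_arc_def)
  then show "\<phi> Unit (uprobe R (flip R (src R f))) = Inl (dec (S x) Unit (uprobe (gr (S x)) (lab (S x) f)))"
    using *[of "Inl f"] x(2) by (simp add: corolla_at_eq)
  have "unit_probe (\<lambda>b. corolla_arc (S x) (onA (uprobe (corolla ?n) (Inr f)) b)) =
      (uprobe (gr (S x)) (flip (gr (S x)) (lab (S x) f)) :: ('u, _, _, _) probe)"
    by (subst unit_probe_eq_uprobe[of _ "gr (S x)"])
      (simp_all add: corolla_arc_def graphD(2)[OF SD(1)[OF x(1)] lx])
  then show "\<phi> Unit (uprobe R (src R f)) =
      Inl (dec (S x) Unit (uprobe (gr (S x)) (flip (gr (S x)) (lab (S x) f))))"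
    using *[of "Inr f"] x(2) by (simp add: corolla_at_eq)
qed

text \<open>Gluing identifies the port \<open>pt f\<close> of a piece with the neighbour \<open>nb f'\<close> of another port for each
  inner edge \<open>{src R f, src R f'}\<close>.  Ports and their neighbours are disjoint, so classes have at most
  two elements.\<close>

definition pt :: "'u \<Rightarrow> 'u \<times> ('u + 'u)" where
  "pt f = (vtx R f, lab (S (vtx R f)) f)"

definition nb :: "'u \<Rightarrow> 'u \<times> ('u + 'u)" where
  "nb f = (vtx R f, flip (gr (S (vtx R f))) (lab (S (vtx R f)) f))"

lemma lab_port:
  assumes "f \<in> hedges R"
  shows "lab (S (vtx R f)) f \<in> ports (gr (S (vtx R f)))" "lab (S (vtx R f)) f \<in> arcs (gr (S (vtx R f)))"
    "flip (gr (S (vtx R f))) (lab (S (vtx R f)) f) \<in> arcs (gr (S (vtx R f)))"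
    "flip (gr (S (vtx R f))) (lab (S (vtx R f)) f) \<notin> ports (gr (S (vtx R f)))"
    "flip (gr (S (vtx R f))) (flip (gr (S (vtx R f))) (lab (S (vtx R f)) f)) = lab (S (vtx R f)) f"
proof -
  note x = vtxR[OF assms]
  note X = SD(1,2)[OF x(1)]
  show p: "lab (S (vtx R f)) f \<in> ports (gr (S (vtx R f)))" by (rule SD(6)[OF x])
  show a: "lab (S (vtx R f)) f \<in> arcs (gr (S (vtx R f)))" by (rule SD(7)[OF x])
  show "flip (gr (S (vtx R f))) (lab (S (vtx R f)) f) \<in> arcs (gr (S (vtx R f)))"
    by (rule graphD(1)[OF X(1) a])
  show "flip (gr (S (vtx R f))) (lab (S (vtx R f)) f) \<notin> ports (gr (S (vtx R f)))"
    using X(2) a p by (auto simp: no_isolated_edges_def)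
  show "flip (gr (S (vtx R f))) (flip (gr (S (vtx R f))) (lab (S (vtx R f)) f)) = lab (S (vtx R f)) f"
    by (rule graphD(2)[OF X(1) a])
qed

lemma pt_inject:
  assumes "f \<in> hedges R" "g \<in> hedges R" "pt f = pt g"
  shows "f = g"
proof -
  have v: "vtx R f = vtx R g" and "lab (S (vtx R g)) f = lab (S (vtx R g)) g"
    using assms(3) by (auto simp: pt_def)
  moreover have "inj_on (lab (S (vtx R g))) (flags_at R (vtx R g))"
    using SD(3)[OF vtxR(1)[OF assms(2)]] by (simp add: bij_betw_def)
  ultimately show ?thesis using vtxR(2)[OF assms(1)] vtxR(2)[OF assms(2)] by (simp add: inj_on_eq_iff)
qed

lemma nb_inject:
  assumes "f \<in> hedges R" "g \<in> hedges R" "nb f = nb g"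
  shows "f = g"
proof (rule pt_inject[OF assms(1,2)])
  have v: "vtx R f = vtx R g" using assms(3) by (simp add: nb_def)
  have "lab (S (vtx R f)) f = lab (S (vtx R f)) g"
    using assms(3) lab_port(5)[OF assms(1)] lab_port(5)[OF assms(2)] v
    unfolding nb_def by (metis prod.inject)
  then show "pt f = pt g" by (simp add: pt_def v)
qed

lemma pt_neq_nb: "f \<in> hedges R \<Longrightarrow> g \<in> hedges R \<Longrightarrow> pt f \<noteq> nb g"
  using lab_port(1)[of f] lab_port(4)[of g] by (auto simp: pt_def nb_def)

lemma glue_step_iff:
  "(p, q) \<in> glue_step R S \<longleftrightarrow>
    (\<exists>f f'. p = pt f \<and> q = nb f' \<and> f \<in> hedges R \<and> f' \<in> hedges R \<and> flip R (src R f) = src R f')"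
  by (auto simp: glue_step_def pt_def nb_def)

text \<open>A port occurs in \<open>glue_step\<close> only on the left and a neighbour only on the
  right. Each determines its half-edge of \<open>R\<close>, and \<open>flip R\<close> determines the
  partner, so two consecutive steps in the symmetric closure lead back to the start.\<close>

lemma glue_classes:
  shows "glue_class R S p = insert p {q. (p, q) \<in> glue_step R S \<or> (q, p) \<in> glue_step R S}"
    "glue_class R S p = glue_class R S q \<longleftrightarrow> p = q \<or> (p, q) \<in> glue_step R S \<or> (q, p) \<in> glue_step R S"
proof -
  let ?E = "glue_step R S \<union> (glue_step R S)\<inverse>"
  have flipR: "flip R (src R f) = src R f' \<Longrightarrow> flip R (src R f') = src R f"
    if "f \<in> hedges R" for f f' using graphD(2,4)[OF R(1)] that by metis
  have "r = p" if E: "(p, q) \<in> ?E" "(q, r) \<in> ?E" for p q r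
  proof -
    consider f f' where "p = pt f" "q = nb f'" "f \<in> hedges R" "f' \<in> hedges R" "flip R (src R f) = src R f'"
      | f f' where "q = pt f" "p = nb f'" "f \<in> hedges R" "f' \<in> hedges R" "flip R (src R f) = src R f'"
      using E(1) by (auto simp: glue_step_iff)
    then show ?thesis
    proof cases
      case 1
      have "(q, r) \<notin> glue_step R S" using pt_neq_nb 1 unfolding glue_step_iff by metis
      then have "(r, q) \<in> glue_step R S" using E(2) by simp
      then obtain g g' where g: "r = pt g" "q = nb g'" "g \<in> hedges R" "g' \<in> hedges R"
        "flip R (src R g) = src R g'" unfolding glue_step_iff by blast
      then have "g' = f'" using nb_inject 1 by metis
      then have "src R g = src R f" using flipR g 1 by metis
      then show ?thesis using graphD(5)[OF R(1) g(3) 1(3)] g(1) 1(1) by simp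
    next
      case 2
      have "(r, q) \<notin> glue_step R S" using pt_neq_nb 2 unfolding glue_step_iff by metis
      then have "(q, r) \<in> glue_step R S" using E(2) by simp
      then obtain g g' where g: "q = pt g" "r = nb g'" "g \<in> hedges R" "g' \<in> hedges R"
        "flip R (src R g) = src R g'" unfolding glue_step_iff by blast
      then have "g = f" using pt_inject 2 by metis
      then have "src R g' = src R f'" using g 2 by metis
      then show ?thesis using graphD(5)[OF R(1) g(4) 2(4)] g(2) 2(2) by simp
    qed
  qed
  then have E: "(p, q) \<in> ?E\<^sup>* \<longleftrightarrow> p = q \<or> (p, q) \<in> ?E" for p q
  proof -
    assume *: "\<And>p q r. (p, q) \<in> ?E \<Longrightarrow> (q, r) \<in> ?E \<Longrightarrow> r = p"
    have "p = q \<or> (p, q) \<in> ?E" if "(p, q) \<in> ?E\<^sup>*"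
      using that
    proof (induction rule: rtrancl_induct)
      case (step y z)
      then show ?case using *[OF _ step(2), of p] by metis
    qed simp
    then show ?thesis by blast
  qed
  have sym: "sym (?E\<^sup>*)" by (rule sym_rtrancl) (auto simp: sym_def)
  show "glue_class R S p = insert p {q. (p, q) \<in> glue_step R S \<or> (q, p) \<in> glue_step R S}"
    unfolding glue_class_def using E by auto
  have "glue_class R S p = glue_class R S q \<longleftrightarrow> (p, q) \<in> ?E\<^sup>*"
    unfolding glue_class_def using sym by (auto dest: symD rtrancl_trans)
  then show "glue_class R S p = glue_class R S q \<longleftrightarrow> p = q \<or> (p, q) \<in> glue_step R S \<or> (q, p) \<in> glue_step R S"
    using E by auto
qed

lemma glue_class_eqE:
  assumes "glue_class R S p = glue_class R S q"
  obtains "p = q"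
    | f f' where "p = pt f" "q = nb f'" "f \<in> hedges R" "f' \<in> hedges R" "flip R (src R f) = src R f'"
    | f f' where "q = pt f" "p = nb f'" "f \<in> hedges R" "f' \<in> hedges R" "flip R (src R f) = src R f'"
  using assms unfolding glue_classes(2) glue_step_iff by blast

lemma glue_class_pt_nb:
  "f \<in> hedges R \<Longrightarrow> f' \<in> hedges R \<Longrightarrow> flip R (src R f) = src R f' \<Longrightarrow>
    glue_class R S (pt f) = glue_class R S (nb f')"
  unfolding glue_classes(2) glue_step_iff by blast

lemma glue_arcs_iff: "(x, a) \<in> glue_arcs R S \<longleftrightarrow> x \<in> verts R \<and> a \<in> arcs (gr (S x))"
  by (simp add: glue_arcs_def)

lemma pt_nb_in: "f \<in> hedges R \<Longrightarrow> pt f \<in> glue_arcs R S" "f \<in> hedges R \<Longrightarrow> nb f \<in> glue_arcs R S"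
  using lab_port vtxR by (simp_all add: pt_def nb_def glue_arcs_iff)

lemma glue_class_subset: "p \<in> glue_arcs R S \<Longrightarrow> q \<in> glue_class R S p \<Longrightarrow> q \<in> glue_arcs R S"
  using pt_nb_in unfolding glue_classes(1) glue_step_iff by blast

lemma mem_glue_class: "q \<in> glue_class R S p \<Longrightarrow> glue_class R S q = glue_class R S p"
  using glue_classes(1)[of p] glue_classes(2)[of q p] by auto

section \<open>The glued graph and its ports\<close>

definition fl :: "'u \<times> ('u + 'u) \<Rightarrow> 'u \<times> ('u + 'u)" where
  "fl = (\<lambda>(x, a). (x, flip (gr (S x)) a))"

lemma fl_pt: "f \<in> hedges R \<Longrightarrow> fl (pt f) = nb f" "f \<in> hedges R \<Longrightarrow> fl (nb f) = pt f"
  using lab_port(5) by (simp_all add: fl_def pt_def nb_def)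

lemma fl_fl: "p \<in> glue_arcs R S \<Longrightarrow> fl (fl p) = p" "p \<in> glue_arcs R S \<Longrightarrow> fl p \<in> glue_arcs R S"
  "p \<in> glue_arcs R S \<Longrightarrow> fl p \<noteq> p"
  using graphD(1,2,3)[OF SD(1)] by (auto simp: fl_def glue_arcs_def)

lemma flipR_src: "f \<in> hedges R \<Longrightarrow> flip R (src R f) = src R f' \<Longrightarrow> flip R (src R f') = src R f"
  using graphD(2,4)[OF R(1)] by metis

text \<open>\<open>fl\<close> exchanges \<open>pt f\<close> and \<open>nb f\<close>. It thus takes
  the step of \<open>(f, f')\<close> to the reverse of the step of \<open>(f', f)\<close>, which is
  again an identification because \<open>flip R\<close> is an involution.\<close>

lemma glue_class_fl:
  assumes "p \<in> glue_arcs R S"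
  shows "fl ` glue_class R S p = glue_class R S (fl p)"
proof -
  have *: "fl q \<in> glue_class R S (fl p)" if p: "p \<in> glue_arcs R S" and q: "q \<in> glue_class R S p" for p q
  proof -
    have "glue_class R S p = glue_class R S q" using mem_glue_class[OF q] by simp
    then show ?thesis
    proof (cases rule: glue_class_eqE)
      case 1
      then show ?thesis by (simp add: glue_classes(1))
    next
      case (2 f f')
      then have "(fl q, fl p) \<in> glue_step R S" unfolding glue_step_iff using fl_pt flipR_src by metis
      then show ?thesis by (simp add: glue_classes(1))
    next
      case (3 f f')
      then have "(fl p, fl q) \<in> glue_step R S" unfolding glue_step_iff using fl_pt flipR_src by metis
      then show ?thesis by (simp add: glue_classes(1))
    qed
  qed
  show ?thesis
  proof
    show "fl ` glue_class R S p \<subseteq> glue_class R S (fl p)" using * assms by blast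
    show "glue_class R S (fl p) \<subseteq> fl ` glue_class R S p"
    proof
      fix q assume q: "q \<in> glue_class R S (fl p)"
      have "fl q \<in> glue_class R S p" using *[OF fl_fl(2)[OF assms] q] fl_fl(1)[OF assms] by simp
      moreover have "fl (fl q) = q" by (rule fl_fl(1)[OF glue_class_subset[OF fl_fl(2)[OF assms] q]])
      ultimately show "q \<in> fl ` glue_class R S p" by (metis imageI)
    qed
  qed
qed

lemma G_simps:
  "arcs G = glue_class R S ` glue_arcs R S" "hedges G = (SIGMA x:verts R. hedges (gr (S x)))"
  "verts G = (SIGMA x:verts R. verts (gr (S x)))" "src G (x, h) = glue_class R S (x, src (gr (S x)) h)"
  "vtx G (x, h) = (x, vtx (gr (S x)) h)"
  "p \<in> glue_arcs R S \<Longrightarrow> flip G (glue_class R S p) = glue_class R S (fl p)"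
  using glue_class_fl by (simp_all add: glue_graph_def fl_def)

lemma src_in: "x \<in> verts R \<Longrightarrow> h \<in> hedges (gr (S x)) \<Longrightarrow> (x, src (gr (S x)) h) \<in> glue_arcs R S"
  using graphD(4)[OF SD(1)] by (simp add: glue_arcs_iff)

lemma src_neq_pt: "x \<in> verts R \<Longrightarrow> h \<in> hedges (gr (S x)) \<Longrightarrow> f \<in> hedges R \<Longrightarrow> (x, src (gr (S x)) h) \<noteq> pt f"
  using lab_port(1)[of f] by (auto simp: pt_def ports_def dest: sym)

text \<open>A fixed point of the glued flip would force a fixed point of \<open>flip R\<close>. The
  glued \<open>src\<close> is injective because a nontrivial identification involves some
  \<open>pt f\<close>, a port of a piece, whereas \<open>src\<close> never meets ports.\<close>

lemma is_graph_G: "is_graph G"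
  unfolding is_graph_def
proof (intro conjI)
  have fA: "finite (glue_arcs R S)"
    using graphD(9)[OF R(1)] graphD(7)[OF SD(1)] by (simp add: glue_arcs_def)
  then show "finite (arcs G)" by (simp add: G_simps)
  show "finite (hedges G)" using graphD(9)[OF R(1)] graphD(8)[OF SD(1)] by (simp add: G_simps)
  show "finite (verts G)" using graphD(9)[OF R(1)] graphD(9)[OF SD(1)] by (simp add: G_simps)
  show "flip G \<in> arcs G \<rightarrow> arcs G" using fl_fl(2) by (auto simp: G_simps)
  show "\<forall>a\<in>arcs G. flip G (flip G a) = a \<and> flip G a \<noteq> a"
  proof
    fix a assume "a \<in> arcs G"
    then obtain p where p: "p \<in> glue_arcs R S" "a = glue_class R S p" by (auto simp: G_simps)
    have "glue_class R S (fl p) \<noteq> glue_class R S p"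
    proof
      assume "glue_class R S (fl p) = glue_class R S p"
      then show False
      proof (cases rule: glue_class_eqE)
        case 1 then show False using fl_fl(3)[OF p(1)] by simp
      next
        case (2 f f')
        \<comment> \<open>An arc glued to its own flip would give \<open>f = f'\<close>, that is, a
          half-edge of \<open>R\<close> whose arc is fixed by \<open>flip R\<close>.\<close>
        then have "nb f = nb f'" using fl_pt(1)[OF 2(3)] fl_fl(1)[OF p(1)] by metis
        then have "f = f'" using nb_inject 2 by blast
        then show False using 2 graphD(3,4)[OF R(1)] by metis
      next
        case (3 f f')
        then have "nb f = nb f'" using fl_pt(1)[OF 3(3)] by metis
        then have "f = f'" using nb_inject 3 by blast
        then show False using 3 graphD(3,4)[OF R(1)] by metis
      qed
    qed
    then show "flip G (flip G a) = a \<and> flip G a \<noteq> a" using p fl_fl(1,2)[OF p(1)] by (simp add: G_simps(6))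
  qed
  show "src G \<in> hedges G \<rightarrow> arcs G" using src_in by (auto simp: G_simps)
  show "inj_on (src G) (hedges G)"
  proof (rule inj_onI)
    fix k l assume k: "k \<in> hedges G" and l: "l \<in> hedges G" and eq: "src G k = src G l"
    obtain x h y g where xy: "k = (x, h)" "l = (y, g)" by fastforce
    with k l have h: "x \<in> verts R" "h \<in> hedges (gr (S x))" "y \<in> verts R" "g \<in> hedges (gr (S y))"
      by (auto simp: G_simps)
    from eq have "glue_class R S (x, src (gr (S x)) h) = glue_class R S (y, src (gr (S y)) g)"
      by (simp add: xy G_simps)
    then show "k = l"
    proof (cases rule: glue_class_eqE)
      case 1 then show ?thesis using graphD(5)[OF SD(1)[OF h(1)]] h xy by auto
    next
      case 2 then show ?thesis using src_neq_pt h by metis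
    next
      case 3 then show ?thesis using src_neq_pt h by metis
    qed
  qed
  show "vtx G \<in> hedges G \<rightarrow> verts G" using graphD(6)[OF SD(1)] by (auto simp: G_simps)
qed

lemma src_G_in: "x \<in> verts R \<Longrightarrow> h \<in> hedges (gr (S x)) \<Longrightarrow> glue_class R S (x, src (gr (S x)) h) \<in> src G ` hedges G"
  using G_simps(4) by (force simp: G_simps(2))

lemma no_isolated_G: "no_isolated_edges G"
  unfolding no_isolated_edges_def
proof
  fix a assume "a \<in> arcs G"
  then obtain x b where p: "x \<in> verts R" "b \<in> arcs (gr (S x))" "a = glue_class R S (x, b)"
    by (auto simp: G_simps glue_arcs_def)
  note X = SD(1,2)[OF p(1)]
  from X(2,1) p(2) show "\<not> (a \<in> ports G \<and> flip G a \<in> ports G)"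
  proof (cases rule: arc_cases)
    case (src h)
    then show ?thesis using src_G_in[OF p(1)] p(3) by (auto simp: ports_def)
  next
    case (flip h)
    have "flip G a = glue_class R S (fl (x, b))" using p by (simp add: G_simps(6) glue_arcs_iff)
    also have "fl (x, b) = (x, src (gr (S x)) h)"
      using flip graphD(2,4)[OF X(1)] by (simp add: fl_def)
    finally show ?thesis using src_G_in[OF p(1) flip(1)] by (auto simp: ports_def)
  qed
qed

lemma glue_port_eq:
  assumes "f \<in> hedges R"
  shows "glue_port R S (flip R (src R f)) = glue_class R S (pt f)"
proof -
  have "g = f" if "g \<in> hedges R" "flip R (src R g) = flip R (src R f)" for g
    using graphD(2,4,5)[OF R(1)] that assms by metis
  then have "(THE g. g \<in> hedges R \<and> flip R (src R g) = flip R (src R f)) = f"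
    using assms by (intro the_equality) auto
  then show ?thesis by (simp add: glue_port_def pt_def)
qed

text \<open>If \<open>flip R (src R f)\<close> is some \<open>src R f'\<close>, then
  \<open>pt f\<close> is glued to \<open>nb f'\<close>, which is the \<open>src\<close> of a
  half-edge of a piece. Otherwise \<open>pt f\<close> is glued to nothing and stays a port.\<close>

lemma pt_port_iff:
  assumes f: "f \<in> hedges R"
  shows "glue_class R S (pt f) \<in> ports G \<longleftrightarrow> flip R (src R f) \<in> ports R"
proof -
  have fa: "flip R (src R f) \<in> arcs R" using graphD(1,4)[OF R(1)] f by blast
  have pa: "glue_class R S (pt f) \<in> arcs G" using pt_nb_in(1)[OF f] by (simp add: G_simps)
  have "glue_class R S (pt f) \<in> src G ` hedges G \<longleftrightarrow> flip R (src R f) \<in> src R ` hedges R"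
  proof
    assume "glue_class R S (pt f) \<in> src G ` hedges G"
    then obtain x h where h: "x \<in> verts R" "h \<in> hedges (gr (S x))"
      and "glue_class R S (pt f) = glue_class R S (x, src (gr (S x)) h)" by (auto simp: G_simps)
    from this(3) show "flip R (src R f) \<in> src R ` hedges R"
    proof (cases rule: glue_class_eqE)
      case 1 then show ?thesis using src_neq_pt[OF h f] by simp
    next
      case (2 g g') then show ?thesis using pt_inject[OF f] by (metis imageI)
    next
      case (3 g g') then show ?thesis using pt_neq_nb f by metis
    qed
  next
    assume "flip R (src R f) \<in> src R ` hedges R"
    then obtain f' where f': "f' \<in> hedges R" "flip R (src R f) = src R f'" by blast
    note x = vtxR(1)[OF f'(1)]
    obtain h where h: "h \<in> hedges (gr (S (vtx R f')))" "nb f' = (vtx R f', src (gr (S (vtx R f'))) h)"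
      using lab_port(3,4)[OF f'(1)] by (auto simp: nb_def ports_def)
    have "glue_class R S (pt f) = glue_class R S (vtx R f', src (gr (S (vtx R f'))) h)"
      using glue_class_pt_nb[OF f f'] h(2) by simp
    then show "glue_class R S (pt f) \<in> src G ` hedges G" using src_G_in[OF x h(1)] by simp
  qed
  then show ?thesis using fa pa by (simp add: ports_def)
qed

lemma bij_glue_port: "bij_betw (glue_port R S) (ports R) (ports G)"
  unfolding bij_betw_def
proof
  show "inj_on (glue_port R S) (ports R)"
  proof (rule inj_onI)
    fix a b assume ab: "a \<in> ports R" "b \<in> ports R" "glue_port R S a = glue_port R S b"
    obtain f where f: "f \<in> hedges R" "a = flip R (src R f)" by (rule port_cases[OF R(2,1) ab(1)])
    obtain g where g: "g \<in> hedges R" "b = flip R (src R g)" by (rule port_cases[OF R(2,1) ab(2)])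
    have "glue_class R S (pt f) = glue_class R S (pt g)" using ab(3) f g glue_port_eq by simp
    then show "a = b"
      by (cases rule: glue_class_eqE) (use pt_inject pt_neq_nb f g in blast)+
  qed
  show "glue_port R S ` ports R = ports G"
  proof
    show "glue_port R S ` ports R \<subseteq> ports G"
    proof (rule image_subsetI)
      fix a assume a: "a \<in> ports R"
      obtain f where f: "f \<in> hedges R" "a = flip R (src R f)" by (rule port_cases[OF R(2,1) a])
      then show "glue_port R S a \<in> ports G" using a glue_port_eq pt_port_iff by simp
    qed
    show "ports G \<subseteq> glue_port R S ` ports R"
    proof
      fix c assume c: "c \<in> ports G"
      then obtain x a where a: "x \<in> verts R" "a \<in> arcs (gr (S x))" "c = glue_class R S (x, a)"
        by (auto simp: ports_def G_simps glue_arcs_def)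
      have "a \<in> ports (gr (S x))" using a c src_G_in[OF a(1)] by (auto simp: ports_def)
      then obtain f where f: "f \<in> flags_at R x" "a = lab (S x) f"
        using SD(3)[OF a(1)] by (auto simp: bij_betw_def)
      then have "f \<in> hedges R" "c = glue_class R S (pt f)" using a by (auto simp: flags_at_def pt_def)
      then show "c \<in> glue_port R S ` ports R" using c pt_port_iff glue_port_eq by (metis imageI)
    qed
  qed
qed

section \<open>Inclusions of the pieces and the induced decoration\<close>

abbreviation incl where "incl \<equiv> glue_incl R S"

lemma incl_simps:
  "a \<in> arcs (gr (S x)) \<Longrightarrow> onA (incl x) a = glue_class R S (x, a)"
  "h \<in> hedges (gr (S x)) \<Longrightarrow> onH (incl x) h = (x, h)" "v \<in> verts (gr (S x)) \<Longrightarrow> onV (incl x) v = (x, v)"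
  by (simp_all add: glue_incl_def)

lemma etale_incl:
  assumes x: "x \<in> verts R"
  shows "etale (gr (S x)) G (incl x)"
  unfolding etale_def
proof (intro conjI)
  note X = SD(1)[OF x]
  show "onA (incl x) \<in> arcs (gr (S x)) \<rightarrow>\<^sub>E arcs G" "onH (incl x) \<in> hedges (gr (S x)) \<rightarrow>\<^sub>E hedges G"
    "onV (incl x) \<in> verts (gr (S x)) \<rightarrow>\<^sub>E verts G"
    using x by (auto simp: glue_incl_def G_simps glue_arcs_def)
  show "\<forall>a\<in>arcs (gr (S x)). onA (incl x) (flip (gr (S x)) a) = flip G (onA (incl x) a)"
    using x graphD(1)[OF X] by (simp add: incl_simps G_simps(6) glue_arcs_iff fl_def)
  show "\<forall>h\<in>hedges (gr (S x)). onA (incl x) (src (gr (S x)) h) = src G (onH (incl x) h)"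
    using graphD(4)[OF X] by (simp add: incl_simps G_simps(4))
  show "\<forall>h\<in>hedges (gr (S x)). onV (incl x) (vtx (gr (S x)) h) = vtx G (onH (incl x) h)"
    using graphD(6)[OF X] by (simp add: incl_simps G_simps(5))
  show "\<forall>v\<in>verts (gr (S x)). \<forall>k\<in>hedges G. vtx G k = onV (incl x) v \<longrightarrow>
      (\<exists>!h. h \<in> hedges (gr (S x)) \<and> vtx (gr (S x)) h = v \<and> onH (incl x) h = k)"
    by (auto simp: incl_simps G_simps)
qed

text \<open>An arc of the gluing is represented in some piece. For a corolla the reason is that
  gluing does not touch vertices: the half-edges at \<open>(x, v)\<close> are those at
  \<open>v\<close> in the piece \<open>S x\<close>.\<close>

lemma incl_factor:
  fixes e :: "'u el"
  assumes e: "e \<in> el_ob" and m: "m \<in> el_hom e G"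
  obtains x k where "x \<in> verts R" "k \<in> el_hom e (gr (S x))" "m = gcomp (el_graph e) (incl x) k"
  using e
proof (cases rule: el_ob_cases)
  case 1
  then have m: "m \<in> el_hom Unit G" using m by simp
  obtain x a where a: "x \<in> verts R" "a \<in> arcs (gr (S x))" "onA m (Inl undefined) = glue_class R S (x, a)"
    using uprobe_cases(2)[OF m] by (auto simp: G_simps glue_arcs_def)
  have "gcomp unit_graph (incl x) (uprobe (gr (S x)) a) =
      (uprobe G (glue_class R S (x, a)) :: ('u, _, _, _) probe)"
    using gcomp_uprobe[OF etale_incl[OF a(1)] SD(1)[OF a(1)] a(2)] a(2) by (simp add: incl_simps)
  then have "m = gcomp (el_graph e) (incl x) (uprobe (gr (S x)) a)"
    using uprobe_cases(1)[OF m] a(3) 1 by simp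
  then show thesis using that[OF a(1)] uprobe_in[OF SD(1)[OF a(1)] a(2)] 1 by blast
next
  case (2 n)
  then have m: "m \<in> el_hom (Corolla n) G" using m by simp
  note M = corolla_cases[OF m]
  obtain x v where v: "onV m undefined = (x, v)" "x \<in> verts R" "v \<in> verts (gr (S x))"
    using M(2) by (auto simp: G_simps)
  have "flags_at G (x, v) = Pair x ` flags_at (gr (S x)) v"
    using v(2) by (auto simp: flags_at_def G_simps)
  then have "bij_betw snd (flags_at G (x, v)) (flags_at (gr (S x)) v)"
    by (simp add: bij_betw_def inj_on_def image_image)
  then have i: "bij_betw (\<lambda>k. snd (onH m k)) n (flags_at (gr (S x)) v)"
    using bij_betw_trans[OF M(1)] v(1) by (simp add: o_def)
  have f: "onH m k = (x, snd (onH m k))" "snd (onH m k) \<in> hedges (gr (S x))" if "k \<in> n" for k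
    using M(6,7)[OF that] v(1) by (auto simp: G_simps)
  let ?k = "cmap (gr (S x)) n v (\<lambda>k. snd (onH m k))"
  have "gcomp (corolla n) (incl x) ?k = cmap G n (onV (incl x) v) (\<lambda>k. onH (incl x) (snd (onH m k)))"
    by (rule gcomp_cmap[OF etale_incl[OF v(2)] SD(1)[OF v(2)] v(3) i 2(2)])
  also have "\<dots> = cmap G n (onV m undefined) (onH m)"
    using v f by (intro cmap_cong) (simp_all add: incl_simps)
  also have "\<dots> = m" using M(3) by simp
  finally show thesis using that[OF v(2), of ?k] cmap_in[OF SD(1)[OF v(2)] v(3) i] 2 by simp
qed

text \<open>Both sides are the value of \<open>\<phi>\<close> at one arc of \<open>R\<close>, read
  off at the two ends of an inner edge.\<close>

lemma dec_compat:
  assumes "f \<in> hedges R" "f' \<in> hedges R" "flip R (src R f) = src R f'"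
  shows "dec (S (vtx R f)) Unit (uprobe (gr (S (vtx R f))) (snd (pt f))) =
    dec (S (vtx R f')) Unit (uprobe (gr (S (vtx R f'))) (snd (nb f')))"
  using phi_Unit(1)[OF assms(1)] phi_Unit(2)[OF assms(2)] assms(3) by (simp add: pt_def nb_def)

text \<open>This justifies the definite description in \<open>glue_dec\<close>. Two factorisations
  of an arc differ by at most one identification, where decorations agree by
  \<open>dec_compat\<close>; a corolla factors in only one way, as its vertex names the
  piece.\<close>

lemma dec_unique:
  assumes e: "e \<in> el_ob" and x: "x \<in> verts R" "k \<in> el_hom e (gr (S x))"
    and y: "y \<in> verts R" "l \<in> el_hom e (gr (S y))"
    and eq: "gcomp (el_graph e) (incl x) k = gcomp (el_graph e) (incl y) l"
  shows "dec (S x) e k = dec (S y) e l"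
  using e
proof (cases rule: el_ob_cases)
  case 1
  let ?a = "onA k (Inl undefined)" and ?b = "onA l (Inl undefined)"
  have k: "k \<in> el_hom Unit (gr (S x))" and l: "l \<in> el_hom Unit (gr (S y))" using x y 1 by simp_all
  have "onA (gcomp (el_graph e) (incl x) k) (Inl undefined) = onA (gcomp (el_graph e) (incl y) l) (Inl undefined)"
    by (simp only: eq)
  then have "glue_class R S (x, ?a) = glue_class R S (y, ?b)"
    using uprobe_cases(2)[OF k] uprobe_cases(2)[OF l] by (simp add: 1 unit_graph_def incl_simps)
  then have "dec (S x) Unit (uprobe (gr (S x)) ?a) = dec (S y) Unit (uprobe (gr (S y)) ?b)"
  proof (cases rule: glue_class_eqE)
    case 1 then show ?thesis by simp
  next
    case (2 f f')
    then have "x = vtx R f" "?a = snd (pt f)" "y = vtx R f'" "?b = snd (nb f')"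
      by (simp_all add: pt_def nb_def)
    then show ?thesis using dec_compat[OF 2(3-5)] by simp
  next
    case (3 f f')
    then have "y = vtx R f" "?b = snd (pt f)" "x = vtx R f'" "?a = snd (nb f')"
      by (simp_all add: pt_def nb_def)
    then show ?thesis using dec_compat[OF 3(3-5)] by simp
  qed
  then show ?thesis using uprobe_cases(1)[OF k] uprobe_cases(1)[OF l] 1 by simp
next
  case (2 n)
  have k: "k \<in> el_hom (Corolla n) (gr (S x))" and l: "l \<in> el_hom (Corolla n) (gr (S y))" using x y 2 by simp_all
  have "onV (gcomp (el_graph e) (incl x) k) undefined = onV (gcomp (el_graph e) (incl y) l) undefined"
    by (simp only: eq)
  then have v: "x = y" "onV k undefined = onV l undefined"
    using corolla_cases(2)[OF k] corolla_cases(2)[OF l] by (simp_all add: 2 incl_simps)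
  have "onH k i = onH l i" if i: "i \<in> n" for i
  proof -
    have "onH (gcomp (el_graph e) (incl x) k) i = onH (gcomp (el_graph e) (incl y) l) i"
      by (simp only: eq)
    then show ?thesis
      using corolla_cases(6)[OF k i] corolla_cases(6)[OF l i] i by (simp add: 2 incl_simps)
  qed
  then have "cmap (gr (S x)) n (onV k undefined) (onH k) = cmap (gr (S y)) n (onV l undefined) (onH l)"
    using v by (metis cmap_cong)
  then have "k = l" using corolla_cases(3)[OF k] corolla_cases(3)[OF l] by simp
  then show ?thesis using v by simp
qed

lemma glue_dec_incl:
  assumes e: "e \<in> el_ob" and x: "x \<in> verts R" and k: "k \<in> el_hom e (gr (S x))"
  shows "glue_dec R S e (gcomp (el_graph e) (incl x) k) = dec (S x) e k"
proof -
  let ?m = "gcomp (el_graph e) (incl x) k"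
  have "?m \<in> el_hom e G" by (rule el_hom_gcomp[OF e k etale_incl[OF x]])
  then have "glue_dec R S e ?m = (THE y. \<exists>z\<in>verts R. \<exists>l\<in>el_hom e (gr (S z)).
      ?m = gcomp (el_graph e) (incl z) l \<and> y = dec (S z) e l)" using e by (simp add: glue_dec_def)
  also have "\<dots> = dec (S x) e k"
  proof (rule the_equality)
    show "\<exists>z\<in>verts R. \<exists>l\<in>el_hom e (gr (S z)). ?m = gcomp (el_graph e) (incl z) l \<and> dec (S x) e k = dec (S z) e l"
      using x k by blast
    fix y assume "\<exists>z\<in>verts R. \<exists>l\<in>el_hom e (gr (S z)). ?m = gcomp (el_graph e) (incl z) l \<and> y = dec (S z) e l"
    then show "y = dec (S x) e k" using dec_unique[OF e _ _ x k] by metis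
  qed
  finally show ?thesis .
qed

end

section \<open>Gluing pieces that are cut out of one graph\<close>

locale emb_gluing = gluing R "rep Z" \<phi>
  for R :: "'u ugraph" and Z :: "('b, 'k, 'w) graph" and \<phi> +
  fixes \<alpha> :: "'u + 'u \<Rightarrow> 'b" and W :: "'u \<Rightarrow> 'w set"
    and t :: "'u \<Rightarrow> ('u, 'b, 'k, 'w) probe"
  assumes t: "\<And>x. x \<in> verts R \<Longrightarrow>
      emb Z (flags_at R x) (W x) (\<lambda>f. \<alpha> (flip R (src R f))) (S x) (t x)"
    and \<alpha>: "\<And>a. a \<in> arcs R \<Longrightarrow> \<alpha> (flip R a) = flip Z (\<alpha> a)"
    and W: "\<And>x y. x \<in> verts R \<Longrightarrow> y \<in> verts R \<Longrightarrow> x \<noteq> y \<Longrightarrow> W x \<inter> W y = {}"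
begin

lemmas tD = embD[OF t]

definition val_at :: "'u \<times> ('u + 'u) \<Rightarrow> 'b" where
  "val_at = (\<lambda>(x, a). onA (t x) a)"

lemma val_at_pt:
  assumes "f \<in> hedges R"
  shows "val_at (pt f) = \<alpha> (flip R (src R f))" "val_at (nb f) = \<alpha> (src R f)"
proof -
  note x = vtxR[OF assms]
  show 1: "val_at (pt f) = \<alpha> (flip R (src R f))" using tD(7)[OF x] by (simp add: val_at_def pt_def)
  have "val_at (nb f) = flip Z (val_at (pt f))"
    using etaleD(4)[OF tD(4)[OF x(1)] lab_port(2)[OF assms]] by (simp add: val_at_def pt_def nb_def)
  also have "\<dots> = \<alpha> (src R f)"
    using \<alpha>[of "flip R (src R f)"] graphD(1,2,4)[OF R(1)] assms by (simp add: 1)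
  finally show "val_at (nb f) = \<alpha> (src R f)" .
qed

text \<open>When \<open>pt f\<close> is glued to \<open>nb f'\<close>, both lie over the arc
  \<open>\<alpha> (src R f')\<close> of \<open>Z\<close>, because
  \<open>flip R (src R f) = src R f'\<close>.\<close>

lemma val_at_cong: "glue_class R S p = glue_class R S q \<Longrightarrow> val_at p = val_at q"
  by (erule glue_class_eqE) (simp_all add: val_at_pt)

definition glued_map ::
    "(('u \<times> ('u + 'u)) set, 'u \<times> 'u, 'u \<times> 'u, 'b, 'k, 'w) gmap" where
  "glued_map = \<lparr>onA = (\<lambda>X\<in>arcs G. val_at (SOME p. p \<in> X)),
     onH = (\<lambda>p\<in>hedges G. onH (t (fst p)) (snd p)), onV = (\<lambda>p\<in>verts G. onV (t (fst p)) (snd p))\<rparr>"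

lemma glued_map_simps:
  "p \<in> glue_arcs R S \<Longrightarrow> onA glued_map (glue_class R S p) = val_at p"
  "x \<in> verts R \<Longrightarrow> h \<in> hedges (gr (S x)) \<Longrightarrow> onH glued_map (x, h) = onH (t x) h"
  "x \<in> verts R \<Longrightarrow> v \<in> verts (gr (S x)) \<Longrightarrow> onV glued_map (x, v) = onV (t x) v"
proof -
  assume p: "p \<in> glue_arcs R S"
  have "p \<in> glue_class R S p" by (simp add: glue_classes(1))
  then have "(SOME q. q \<in> glue_class R S p) \<in> glue_class R S p" by (rule someI)
  then show "onA glued_map (glue_class R S p) = val_at p"
    using p val_at_cong[OF mem_glue_class] by (simp add: glued_map_def G_simps)
qed (simp_all add: glued_map_def G_simps)

lemma etale_glued_map: "etale G Z glued_map"
  unfolding etale_def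
proof (intro conjI)
  have "val_at p \<in> arcs Z" if "p \<in> glue_arcs R S" for p
    using that etaleD(1)[OF tD(4)] by (auto simp: glue_arcs_def val_at_def)
  then show "onA glued_map \<in> arcs G \<rightarrow>\<^sub>E arcs Z"
    by (intro PiE_I) (auto simp: G_simps glued_map_simps, simp add: glued_map_def G_simps)
  show "onH glued_map \<in> hedges G \<rightarrow>\<^sub>E hedges Z" "onV glued_map \<in> verts G \<rightarrow>\<^sub>E verts Z"
    using etaleD(2,3)[OF tD(4)] by (auto simp: glued_map_def G_simps)
  show "\<forall>a\<in>arcs G. onA glued_map (flip G a) = flip Z (onA glued_map a)"
  proof
    fix a assume "a \<in> arcs G"
    then obtain x b where p: "x \<in> verts R" "b \<in> arcs (gr (S x))" "a = glue_class R S (x, b)"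
      by (auto simp: G_simps glue_arcs_def)
    then have q: "(x, b) \<in> glue_arcs R S" by (simp add: glue_arcs_iff)
    show "onA glued_map (flip G a) = flip Z (onA glued_map a)"
      using fl_fl(2)[OF q] etaleD(4)[OF tD(4)[OF p(1)] p(2)]
      by (simp add: p(3) G_simps(6)[OF q] glued_map_simps(1) q) (simp add: val_at_def fl_def)
  qed
  show "\<forall>h\<in>hedges G. onA glued_map (src G h) = src Z (onH glued_map h)"
    using src_in etaleD(5)[OF tD(4)] by (auto simp: G_simps glued_map_simps val_at_def)
  show "\<forall>h\<in>hedges G. onV glued_map (vtx G h) = vtx Z (onH glued_map h)"
    using graphD(6)[OF SD(1)] etaleD(6)[OF tD(4)] by (auto simp: G_simps glued_map_simps)
  show "\<forall>v\<in>verts G. \<forall>k\<in>hedges Z. vtx Z k = onV glued_map v \<longrightarrow>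
      (\<exists>!h. h \<in> hedges G \<and> vtx G h = v \<and> onH glued_map h = k)"
  proof (intro ballI impI)
    fix w k assume "w \<in> verts G" and k: "k \<in> hedges Z" "vtx Z k = onV glued_map w"
    then obtain x v where v: "x \<in> verts R" "v \<in> verts (gr (S x))" "w = (x, v)" by (auto simp: G_simps)
    then have "vtx Z k = onV (t x) v" using k by (simp add: glued_map_simps)
    from etaleD(7)[OF tD(4)[OF v(1)] v(2) k(1) this]
    obtain h where h: "h \<in> hedges (gr (S x))" "vtx (gr (S x)) h = v" "onH (t x) h = k"
      and u: "\<And>g. g \<in> hedges (gr (S x)) \<Longrightarrow> vtx (gr (S x)) g = v \<Longrightarrow> onH (t x) g = k \<Longrightarrow> g = h"
      by blast
    show "\<exists>!h. h \<in> hedges G \<and> vtx G h = w \<and> onH glued_map h = k"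
    proof (rule ex1I[of _ "(x, h)"])
      show "(x, h) \<in> hedges G \<and> vtx G (x, h) = w \<and> onH glued_map (x, h) = k"
        using v h by (simp add: G_simps glued_map_simps)
      fix g assume g: "g \<in> hedges G \<and> vtx G g = w \<and> onH glued_map g = k"
      obtain y g' where yg: "g = (y, g')" by fastforce
      with g v have "y = x" "g' \<in> hedges (gr (S x))" "vtx (gr (S x)) g' = v" by (auto simp: G_simps)
      then show "g = (x, h)" using u[of g'] g yg v by (simp add: glued_map_simps)
    qed
  qed
qed

lemma glued_map_incl: "x \<in> verts R \<Longrightarrow> gcomp (gr (S x)) glued_map (incl x) = t x"
  by (rule etale_eqI[OF etale_gcomp[OF etale_incl etale_glued_map SD(1)] tD(4)])
    (simp_all add: incl_simps glued_map_simps glue_arcs_iff val_at_def)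

text \<open>Every probe factors through a piece, where the decoration is induced by
  \<open>t x\<close>, and \<open>t x\<close> is the restriction of \<open>glued_map\<close>.\<close>

lemma glue_dec_eq: "glue_dec R S = rep_map G glued_map"
proof -
  have "glue_dec R S e m = gcomp (el_graph e) glued_map m"
    if e: "e \<in> el_ob" and m: "m \<in> el_hom e G" for e :: "'u el" and m
  proof -
    obtain x k where x: "x \<in> verts R" "k \<in> el_hom e (gr (S x))" "m = gcomp (el_graph e) (incl x) k"
      by (rule incl_factor[OF e m])
    then have "glue_dec R S e m = gcomp (el_graph e) (t x) k"
      using glue_dec_incl[OF e x(1,2)] tD(8)[OF x(1)] e by (simp add: rep_map_def)
    then show ?thesis using x(3) by (simp add: gcomp_assoc_el[OF x(2)] glued_map_incl[OF x(1)])
  qed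
  then show ?thesis by (intro ext) (auto simp: glue_dec_def rep_map_def restrict_def)
qed

text \<open>Disjointness of the sets \<open>W x\<close> separates vertices of different pieces;
  within one piece \<open>t x\<close> is injective.\<close>

lemma inj_glued_map: "inj_on (onV glued_map) (verts G)"
proof (rule inj_onI)
  fix p q assume "p \<in> verts G" "q \<in> verts G" and eq: "onV glued_map p = onV glued_map q"
  then obtain x v y w where v: "x \<in> verts R" "v \<in> verts (gr (S x))" "p = (x, v)"
    "y \<in> verts R" "w \<in> verts (gr (S y))" "q = (y, w)" by (auto simp: G_simps)
  have "onV (t x) v \<in> W x" "onV (t y) w \<in> W y" using tD(6)[OF v(1)] tD(6)[OF v(4)] v by blast+
  moreover have e: "onV (t x) v = onV (t y) w" using eq v by (simp add: glued_map_simps)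
  ultimately have "x = y" using W[OF v(1,4)] by auto
  then show "p = q" using e v inj_onD[OF tD(5)[OF v(1)]] by simp
qed

lemma image_glued_map: "onV glued_map ` verts G = (\<Union>x\<in>verts R. W x)"
proof -
  have "onV glued_map ` verts G = (\<Union>x\<in>verts R. onV (t x) ` verts (gr (S x)))"
    by (force simp: G_simps glued_map_simps)
  then show ?thesis using tD(6) by simp
qed

lemma glued_map_port:
  assumes "a \<in> ports R"
  shows "onA glued_map (glue_port R S a) = \<alpha> a"
proof -
  obtain f where f: "f \<in> hedges R" "a = flip R (src R f)" by (rule port_cases[OF R(2,1) assms])
  then show ?thesis by (simp add: glue_port_eq glued_map_simps pt_nb_in val_at_pt)
qed

lemma emb_glue:
  assumes "bij_betw l n (ports R)"
  shows "emb Z n (\<Union>x\<in>verts R. W x) (\<lambda>k. \<alpha> (l k)) (glue \<lparr>gr = R, lab = l, dec = \<phi>\<rparr>) glued_map"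
  using bij_betw_trans[OF assms bij_glue_port] bij_betwE[OF assms] is_graph_G no_isolated_G
    etale_glued_map inj_glued_map image_glued_map glued_map_port glue_dec_eq
  by (simp add: emb_def glue_def Let_def o_def)

end

section \<open>Composition of refinements\<close>

context refinement
begin

text \<open>The hypothesis says that \<open>\<phi>\<close> is \<open>kl\<close> restricted along
  \<open>s\<close>. With \<open>X\<close> a decorated representative it computes Kleisli composites;
  with \<open>s\<close> the identity of \<open>R\<close> it yields genericity. Fibres over distinct
  vertices of \<open>X\<close> are disjoint because \<open>s\<close> is injective on
  vertices.\<close>

lemma emb_gluing_kl:
  assumes X: "is_graph X" "no_isolated_edges X" and s: "etale X R s" "inj_on (onV s) (verts X)"
    and \<phi>: "nat_trans (rep X) (bar (rep Y)) \<phi>"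
    and eq: "\<And>e m. e \<in> el_ob \<Longrightarrow> m \<in> el_hom e X \<Longrightarrow> \<phi> e m = kl e (gcomp (el_graph e) s m)"
  shows "\<exists>t. emb_gluing X Y \<phi> (\<lambda>a. amap (onA s a)) (\<lambda>x. {v \<in> verts Y. mV h v = onV s x}) t"
proof -
  have ex: "\<exists>t. emb Y (flags_at X x) {v \<in> verts Y. mV h v = onV s x} (\<lambda>f. amap (onA s (flip X (src X f))))
      (piece X \<phi> x) t" if x: "x \<in> verts X" for x
  proof -
    let ?n = "flags_at X x" and ?c = "corolla_at X x"
    let ?m = "gcomp (corolla ?n) s ?c"
    let ?C = "cls Y ?n {v \<in> verts Y. mV h v = onV s x} (\<lambda>k. amap (onA s (flip X (src X k))))"
    have n: "finite ?n" by (rule finite_flags_at[OF X(1)])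
    have c: "?c \<in> el_hom (Corolla ?n) X" by (rule corolla_at_in[OF X(1) x])
    have m: "?m \<in> el_hom (Corolla ?n) R" using el_hom_gcomp[OF _ c s(1)] n by simp
    have V: "onV ?m undefined = onV s x" by (simp add: corolla_at_eq)
    have C: "cls Y ?n W (\<lambda>k. amap (onA ?m (Inl k))) = cls Y ?n W (\<lambda>k. amap (onA s (flip X (src X k))))" for W
      by (rule cls_cong) (simp add: corolla_at_eq)
    have "\<phi> (Corolla ?n) ?c = Inr ?C" using eq[OF _ c] n kl_Corolla[OF m n] C V by simp
    moreover have "?C \<noteq> {}" using cls_nonempty[OF m] C V by simp
    ultimately have "piece X \<phi> x \<in> ?C" by (simp add: piece_def some_in_eq)
    then show ?thesis by (auto simp: cls_def)
  qed
  define t where "t x = (SOME t. emb Y (flags_at X x) {v \<in> verts Y. mV h v = onV s x}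
      (\<lambda>f. amap (onA s (flip X (src X f)))) (piece X \<phi> x) t)" for x
  have t: "emb Y (flags_at X x) {v \<in> verts Y. mV h v = onV s x}
      (\<lambda>f. amap (onA s (flip X (src X f)))) (piece X \<phi> x) (t x)" if "x \<in> verts X" for x
    unfolding t_def by (rule someI_ex[OF ex[OF that]])
  have "emb_gluing X Y \<phi> (\<lambda>a. amap (onA s a)) (\<lambda>x. {v \<in> verts Y. mV h v = onV s x}) t"
  proof
    show "is_graph X" "no_isolated_edges X" "nat_trans (rep X) (bar (rep Y)) \<phi>" by fact+
    show "amap (onA s (flip X a)) = flip Y (amap (onA s a))" if "a \<in> arcs X" for a
      using etaleD(1,4)[OF s(1) that] amap_flip by simp
    show "{v \<in> verts Y. mV h v = onV s x} \<inter> {v \<in> verts Y. mV h v = onV s y} = {}"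
      if "x \<in> verts X" "y \<in> verts X" "x \<noteq> y" for x y
      using inj_onD[OF s(2) _ that(1,2)] that(3) by auto
  qed (rule t)
  then show ?thesis by blast
qed

text \<open>Gluing replaces each vertex of \<open>D\<close> by the fibre over its image, so vertex
  sets are pulled back along \<open>mV h\<close> while port positions are pushed forward along
  \<open>amap\<close>. The map \<open>s\<close> is supplied separately since the decoration of
  \<open>D\<close> takes values in \<open>bar (rep Y)\<close>.\<close>

lemma iso_class_glue_kl:
  assumes D: "emb R n W l \<lparr>gr = gr D, lab = lab D, dec = rep_map (gr D) s\<rparr> s" and W: "W \<noteq> {}"
    and eq: "dec D = nat_comp (rep (gr D)) kl (rep_map (gr D) s)"
  shows "iso_class (rep Y) n (glue D) = cls Y n {v \<in> verts Y. mV h v \<in> W} (\<lambda>k. amap (l k))"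
proof -
  note E = embD[OF D, simplified]
  have "\<exists>t. emb_gluing (gr D) Y (dec D) (\<lambda>a. amap (onA s a)) (\<lambda>x. {v \<in> verts Y. mV h v = onV s x}) t"
  proof (rule emb_gluing_kl[OF E(1,2,4,5)])
    show "nat_trans (rep (gr D)) (bar (rep Y)) (dec D)"
      unfolding eq by (rule nat_trans_comp[OF nat_trans_rep_map[OF E(4)] kl_nat_trans is_species_rep])
    show "dec D e m = kl e (gcomp (el_graph e) s m)" if "e \<in> el_ob" "m \<in> el_hom e (gr D)" for e m
      using that by (simp add: eq nat_comp_def rep_map_def)
  qed
  then obtain t where "emb_gluing (gr D) Y (dec D) (\<lambda>a. amap (onA s a)) (\<lambda>x. {v \<in> verts Y. mV h v = onV s x}) t" ..
  from emb_gluing.emb_glue[OF this E(3)]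
  have g: "emb Y n (\<Union>x\<in>verts (gr D). {v \<in> verts Y. mV h v = onV s x}) (\<lambda>k. amap (onA s (lab D k)))
      (glue D) (emb_gluing.glued_map (gr D) (dec D) t)" by (simp add: glue_def)
  have U: "(\<Union>x\<in>verts (gr D). {v \<in> verts Y. mV h v = onV s x}) = {v \<in> verts Y. mV h v \<in> W}"
    using E(6) by auto
  have "W \<subseteq> verts R" using E(6) etaleD(3)[OF E(4)] by blast
  then have "{v \<in> verts Y. mV h v \<in> W} \<noteq> {}" using W fibre_nonempty by fastforce
  then have "iso_class (rep Y) n (glue D) =
      cls Y n {v \<in> verts Y. mV h v \<in> W} (\<lambda>k. amap (onA s (lab D k)))"
    using iso_class_emb[OF g] U Y(1) by simp
  also have "\<dots> = cls Y n {v \<in> verts Y. mV h v \<in> W} (\<lambda>k. amap (l k))"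
    using E(7) by (intro cls_cong) simp
  finally show ?thesis .
qed

end

text \<open>The image of \<open>cls Y n W l\<close> under \<open>bar_map _ _ \<psi>\<close>.\<close>

definition post_cls :: "('u, ('u, 'b, 'k, 'w) probe, 'x) nat_tr \<Rightarrow> ('b, 'k, 'w) graph \<Rightarrow>
    'u set \<Rightarrow> 'w set \<Rightarrow> ('u \<Rightarrow> 'b) \<Rightarrow> ('u, 'x) udgraph set" where
  "post_cls \<psi> Y n W l =
    {D. \<exists>s. emb Y n W l \<lparr>gr = gr D, lab = lab D, dec = rep_map (gr D) s\<rparr> s \<and>
            dec D = nat_comp (rep (gr D)) \<psi> (rep_map (gr D) s)}"

lemma is_dgraph_post:
  assumes "is_dgraph F n D" "nat_trans F F' \<psi>"
  shows "is_dgraph F' n \<lparr>gr = gr D, lab = lab D, dec = nat_comp (rep (gr D)) \<psi> (dec D)\<rparr>"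
  using assms(1) nat_trans_comp[OF is_dgraphD(4)[OF assms(1)] assms(2) is_species_rep]
  by (simp add: is_dgraph_def)

text \<open>Members of the class on the left carry only a decoration by \<open>F\<close>. Their map
  to \<open>Y\<close> is recovered by transport along the isomorphism with \<open>D\<close>;
  conversely, graphs cut out in the same way are isomorphic over \<open>Y\<close>, hence also after
  applying \<open>\<psi>\<close>.\<close>

lemma iso_class_post:
  fixes Y :: "('b, 'k, 'w) graph" and D :: "('u, 'a, 'h, 'v, ('u, 'b, 'k, 'w) probe) dgraph"
    and F :: "('u, 'x) species"
  assumes s: "emb Y n W l D s" and W: "W \<noteq> {}" and Y: "is_graph Y" and \<psi>: "nat_trans (rep Y) F \<psi>"
  shows "iso_class F n \<lparr>gr = gr D, lab = lab D, dec = nat_comp (rep (gr D)) \<psi> (dec D)\<rparr> =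
    post_cls \<psi> Y n W l"
    and "is_dgraph F n \<lparr>gr = gr D, lab = lab D, dec = nat_comp (rep (gr D)) \<psi> (dec D)\<rparr>"
proof -
  let ?D = "\<lparr>gr = gr D, lab = lab D, dec = nat_comp (rep (gr D)) \<psi> (dec D)\<rparr>"
  have DD: "D = \<lparr>gr = gr D, lab = lab D, dec = rep_map (gr D) s\<rparr>" using embD(8)[OF s] by simp
  show "is_dgraph F n ?D" by (rule is_dgraph_post[OF emb_is_dgraph[OF s W] \<psi>])
  have dec1: "nat_comp (rep (gr D)) \<psi> (dec D) e m = \<psi> e (gcomp (el_graph e) s m)"
    if "e \<in> el_ob" "m \<in> el_hom e (gr D)" for e m
    using that embD(8)[OF s] by (simp add: nat_comp_def rep_map_def)
  show "iso_class F n ?D = post_cls \<psi> Y n W l"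
  proof
    show "iso_class F n ?D \<subseteq> post_cls \<psi> Y n W l"
    proof
      fix D' assume "D' \<in> iso_class F n ?D"
      then have D': "is_dgraph F n D'" and i: "diso n ?D D'" by (simp_all add: iso_class_def)
      obtain h where h: "giso (gr D) (gr D') h" "\<forall>k\<in>n. onA h (lab D k) = lab D' k"
        and hd: "\<And>e m. e \<in> el_ob \<Longrightarrow> m \<in> el_hom e (gr D) \<Longrightarrow>
          dec D' e (gcomp (el_graph e) h m) = \<psi> e (gcomp (el_graph e) s m)"
        using i dec1 unfolding diso_def by auto
      then obtain k where he: "etale (gr D) (gr D') h" and k: "etale (gr D') (gr D) k"
        and kh: "gcomp (gr D) k h = gid (gr D)" and hk: "gcomp (gr D') h k = gid (gr D')"
        unfolding giso_def by blast
      let ?s = "gcomp (gr D') s k"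
      \<comment> \<open>\<open>D'\<close> with its decoration replaced by the one that
        \<open>s\<close> induces through the inverse \<open>k\<close>. It is isomorphic to
        \<open>D\<close>, so \<open>emb_transport\<close> applies to it.\<close>
      let ?E = "\<lparr>gr = gr D', lab = lab D', dec = rep_map (gr D') ?s\<rparr>"
      note D'' = is_dgraphD[OF D']
      have es: "etale (gr D') Y ?s" by (rule etale_gcomp[OF k embD(4)[OF s] D''(1)])
      have sk: "gcomp (gr D) ?s h = s"
        using gcomp_assoc[OF he, of s k] kh gcomp_gid_right[OF embD(4)[OF s]] by simp
      have E: "is_dgraph (rep Y) n ?E"
        using D' nat_trans_rep_map[OF es] by (simp add: is_dgraph_def)
      have "diso n D ?E"
        unfolding diso_def
      proof (intro exI[of _ h] conjI ballI)
        show "onA h (lab D k) = lab ?E k" if "k \<in> n" for k using h that by simp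
        fix e :: "'u el" and m assume e: "e \<in> el_ob" and m: "m \<in> el_hom e (gr D)"
        show "dec ?E e (gcomp (el_graph e) h m) = dec D e m"
          using e m el_hom_gcomp[OF e m he]
          by (simp add: embD(8)[OF s] rep_map_def gcomp_assoc_el[OF m] sk)
      qed (use h in simp)
      then obtain s' where s': "emb Y n W l ?E s'" using emb_transport[OF s _ E] by blast
      \<comment> \<open>Both \<open>?s\<close> and \<open>s'\<close> induce the decoration of
        \<open>?E\<close>, so they may be exchanged inside \<open>rep_map\<close>.\<close>
      then have rs: "rep_map (gr D') ?s = (rep_map (gr D') s' :: ('u, _, _) nat_tr)"
        using embD(8) by fastforce
      have "dec D' = nat_comp (rep (gr D')) \<psi> (rep_map (gr D') s')"
      proof (rule nat_trans_eqI[OF D''(4)])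
        show "nat_trans (rep (gr D')) F (nat_comp (rep (gr D')) \<psi> (rep_map (gr D') s'))"
          using embD(4)[OF s'] by (intro nat_trans_comp[OF nat_trans_rep_map \<psi> is_species_rep]) simp
        fix e :: "'u el" and m assume e: "e \<in> el_ob" and "m \<in> val (rep (gr D')) e"
        then have m: "m \<in> el_hom e (gr D')" by simp
        have km: "gcomp (el_graph e) k m \<in> el_hom e (gr D)" by (rule el_hom_gcomp[OF e m k])
        have "gcomp (el_graph e) h (gcomp (el_graph e) k m) = m"
          using m by (simp add: gcomp_assoc_el[OF m] hk gcomp_gid_left el_hom_def)
        then have "dec D' e m = \<psi> e (gcomp (el_graph e) ?s m)"
          using hd[OF e km] by (simp add: gcomp_assoc_el[OF m])
        also have "gcomp (el_graph e) ?s m = rep_map (gr D') ?s e m" using e m by (simp add: rep_map_def)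
        also note rs
        finally show "dec D' e m = nat_comp (rep (gr D')) \<psi> (rep_map (gr D') s') e m"
          using e m by (simp add: nat_comp_def)
      qed
      then show "D' \<in> post_cls \<psi> Y n W l" using s' rs by (auto simp: post_cls_def)
    qed
    show "post_cls \<psi> Y n W l \<subseteq> iso_class F n ?D"
    proof
      fix D' assume "D' \<in> post_cls \<psi> Y n W l"
      then obtain s' where s': "emb Y n W l \<lparr>gr = gr D', lab = lab D', dec = rep_map (gr D') s'\<rparr> s'"
        and d': "dec D' = nat_comp (rep (gr D')) \<psi> (rep_map (gr D') s')" by (auto simp: post_cls_def)
      have "is_dgraph F n D'"
        using is_dgraph_post[OF emb_is_dgraph[OF s' W] \<psi>] by (simp add: d'[symmetric] is_dgraph_def)
      moreover have "diso n ?D D'"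
      proof -
        obtain h where h: "giso (gr D) (gr D') h" "gcomp (gr D) s' h = s"
          "\<And>k. k \<in> n \<Longrightarrow> onA h (lab D k) = lab D' k" using emb_giso[OF s s' Y] by auto
        have he: "etale (gr D) (gr D') h" using h(1) by (simp add: giso_def)
        have "dec D' e (gcomp (el_graph e) h m) = nat_comp (rep (gr D)) \<psi> (dec D) e m"
          if e: "e \<in> el_ob" and m: "m \<in> el_hom e (gr D)" for e :: "'u el" and m
          using e m el_hom_gcomp[OF e m he]
          by (simp add: embD(8)[OF s] d' nat_comp_def rep_map_def gcomp_assoc_el[OF m] h(2))
        then show ?thesis unfolding diso_def using h by (intro exI[of _ h]) simp
      qed
      ultimately show "D' \<in> iso_class F n ?D" by (simp add: iso_class_def)
    qed
  qed
qed

lemma refinement_comp: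
  assumes c: "refinement R Y c" and d: "refinement Y Z d"
  shows "refinement R Z (bm_comp (bm_of Z) (bm_of Y) (bm_of R) c d)"
  using assms by (auto simp: refinement_def intro!: comp_mor_comp is_bm_graph_bm_of)

text \<open>At a corolla the fibre of \<open>c\<close> is decorated through \<open>d.kl\<close> and
  glued, which leaves the vertices of \<open>Z\<close> lying over that fibre, that is, the fibre of
  the composite. Both unions, in \<open>bar_map\<close> and in \<open>mult_tr\<close>, run over
  nonempty families of equal classes.\<close>

lemma kl_comp_kl:
  fixes R Y Z :: "'u ugraph"
  assumes c: "refinement R Y c" and d: "refinement Y Z d"
  shows "kl_comp R Y Z (refinement.kl Y Z d) (refinement.kl R Y c) =
    refinement.kl R Z (bm_comp (bm_of Z) (bm_of Y) (bm_of R) c d)"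
proof -
  interpret c: refinement R Y c by fact
  interpret d: refinement Y Z d by fact
  let ?cd = "bm_comp (bm_of Z) (bm_of Y) (bm_of R) c d"
  interpret cd: refinement R Z ?cd by (rule refinement_comp[OF c d])
  have am: "d.amap (c.amap a) = cd.amap a" if "a \<in> arcs R" for a
  proof (rule cd.amap_unique[OF _ _ that])
    fix f assume f: "f \<in> hedges R"
    show "d.amap (c.amap (src R f)) = src Z (mF ?cd f)"
      using f c.hD(1)[OF f] by (simp add: c.amap_src d.amap_src bm_comp_def)
    show "d.amap (c.amap (flip R (src R f))) = flip Z (d.amap (c.amap (src R f)))"
      using f graphD(4)[OF c.R(1) f] c.amap_in by (simp add: c.amap_flip d.amap_flip)
  qed
  have "mult_tr (rep Z) e (bar_map (rep Y) (bar (rep Z)) d.kl e (c.kl e m)) = cd.kl e m"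
    if e: "e \<in> el_ob" and m: "m \<in> el_hom e R" for e :: "'u el" and m
    using e
  proof (cases rule: el_ob_cases)
    case 1
    then have m: "m \<in> el_hom Unit R" using m by simp
    let ?a = "onA m (Inl undefined)"
    have a: "?a \<in> arcs R" by (rule uprobe_cases(2)[OF m])
    let ?p = "uprobe Y (c.amap ?a) :: ('u, _, _, _) probe"
    have p: "?p \<in> el_hom Unit Y" by (rule uprobe_in[OF c.Y(1) c.amap_in[OF a]])
    have kp: "d.kl Unit ?p = Inl (uprobe Z (cd.amap ?a))" using d.kl_Unit[OF p] am[OF a] by simp
    then have "d.kl Unit ?p \<in> bar_val (rep Z) Unit" using d.kl_in[OF _ p] by simp
    then show ?thesis
      using 1 c.kl_Unit[OF m] cd.kl_Unit[OF m] p kp by (simp add: mult_tr_def bar_map_def)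
  next
    case (2 n)
    then have m: "m \<in> el_hom (Corolla n) R" using m by simp
    let ?W = "{v \<in> verts Y. mV c v = onV m undefined}" and ?l = "\<lambda>k. c.amap (onA m (Inl k))"
    have W: "?W \<noteq> {}" by (rule c.fibre_nonempty[OF corolla_cases(2)[OF m]])
    have C: "c.kl (Corolla n) m = Inr (cls Y n ?W ?l)" by (rule c.kl_Corolla[OF m 2(2)])
    have C_in: "Inr (cls Y n ?W ?l) \<in> bar_val (rep Y) (Corolla n)"
      using c.kl_in[OF _ m] 2 C by simp
    let ?P = "post_cls d.kl Y n ?W ?l"
    have post: "iso_class (bar (rep Z)) n \<lparr>gr = gr D, lab = lab D, dec = nat_comp (rep (gr D)) d.kl (dec D)\<rparr> = ?P"
      "is_dgraph (bar (rep Z)) n \<lparr>gr = gr D, lab = lab D, dec = nat_comp (rep (gr D)) d.kl (dec D)\<rparr>"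
      if D: "D \<in> cls Y n ?W ?l" for D
    proof -
      obtain s where s: "emb Y n ?W ?l D s" using D by (auto simp: cls_def)
      show "iso_class (bar (rep Z)) n \<lparr>gr = gr D, lab = lab D, dec = nat_comp (rep (gr D)) d.kl (dec D)\<rparr> = ?P"
        "is_dgraph (bar (rep Z)) n \<lparr>gr = gr D, lab = lab D, dec = nat_comp (rep (gr D)) d.kl (dec D)\<rparr>"
        by (rule iso_class_post[OF s W c.Y(1) d.kl_nat_trans])+
    qed
    obtain D where D: "D \<in> cls Y n ?W ?l" using c.cls_nonempty[OF m] by blast
    let ?D = "\<lparr>gr = gr D, lab = lab D, dec = nat_comp (rep (gr D)) d.kl (dec D)\<rparr>"
    have B: "bar_map (rep Y) (bar (rep Z)) d.kl (Corolla n) (Inr (cls Y n ?W ?l)) = Inr ?P"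
      using 2 C_in c.cls_nonempty[OF m] post(1) by (simp add: bar_map_def SUP_eq_const)
    have P_in: "Inr ?P \<in> bar_val (bar (rep Z)) (Corolla n)"
      using post[OF D] by auto
    have P_ne: "?P \<noteq> {}" using self_in_iso_class[OF post(2)[OF D]] post(1)[OF D] by blast
    let ?W' = "{v \<in> verts Z. mV d v \<in> ?W}"
    have "iso_class (rep Z) n (glue D') = cls Z n ?W' (\<lambda>k. d.amap (?l k))" if "D' \<in> ?P" for D'
      using that d.iso_class_glue_kl[OF _ W] by (auto simp: post_cls_def)
    then have "mult_tr (rep Z) (Corolla n) (Inr ?P) = Inr (cls Z n ?W' (\<lambda>k. d.amap (?l k)))"
      using 2 P_in P_ne by (simp add: mult_tr_def SUP_eq_const)
    also have "?W' = {v \<in> verts Z. mV ?cd v = onV m undefined}"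
      using d.hD(3) by (auto simp: bm_comp_def)
    also have "cls Z n {v \<in> verts Z. mV ?cd v = onV m undefined} (\<lambda>k. d.amap (?l k)) =
        cls Z n {v \<in> verts Z. mV ?cd v = onV m undefined} (\<lambda>k. cd.amap (onA m (Inl k)))"
    proof (rule cls_cong)
      fix k assume "k \<in> n"
      then have "onA m (Inl k) \<in> arcs R"
        using etaleD(1)[of "corolla n" R m] m by (simp add: el_hom_def)
      then show "d.amap (?l k) = cd.amap (onA m (Inl k))" by (rule am)
    qed
    finally show ?thesis using 2 C B cd.kl_Corolla[OF m 2(2)] by simp
  qed
  then show ?thesis
    by (intro ext) (auto simp: kl_comp_def nat_comp_def cd.kl_def restrict_def)
qed

section \<open>Generic morphisms are refinements\<close>

text \<open>Every map from a corolla to \<open>R\<close> is the canonical corolla at its vertex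
  after a relabelling, so naturality determines all values from those at arcs and at canonical
  corollas.\<close>

lemma nat_trans_rep_eqI:
  fixes R :: "'u ugraph"
  assumes \<phi>: "nat_trans (rep R) F \<phi>" and \<psi>: "nat_trans (rep R) F \<psi>" and R: "is_graph R"
    and U: "\<And>a. a \<in> arcs R \<Longrightarrow> \<phi> Unit (uprobe R a) = \<psi> Unit (uprobe R a)"
    and C: "\<And>x. x \<in> verts R \<Longrightarrow>
      \<phi> (Corolla (flags_at R x)) (corolla_at R x) = \<psi> (Corolla (flags_at R x)) (corolla_at R x)"
  shows "\<phi> = \<psi>"
proof (rule nat_trans_eqI[OF \<phi> \<psi>])
  fix e :: "'u el" and m assume e: "e \<in> el_ob" and m: "m \<in> val (rep R) e"
  from e show "\<phi> e m = \<psi> e m"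
  proof (cases rule: el_ob_cases)
    case 1
    then have m1: "m \<in> el_hom Unit R" using m by simp
    show ?thesis
      using U[OF uprobe_cases(2)[OF m1]] 1 by (simp only: uprobe_cases(1)[OF m1, symmetric])
  next
    case (2 n)
    then have m2: "m \<in> el_hom (Corolla n) R" using m by simp
    note M = corolla_cases[OF m2]
    let ?x = "onV m undefined"
    let ?k = "flags_at R ?x"
    have k: "finite ?k" by (rule finite_flags_at[OF R])
    have ck: "is_graph (corolla ?k)" using is_graph_el_graph[of "Corolla ?k"] k by simp
    have i: "bij_betw (onH m) n (flags_at (corolla ?k) undefined)" using M(1) by (simp add: flags_at_def)
    let ?u = "cmap (corolla ?k) n undefined (onH m) :: ('u, _, _, _) probe"
    have u: "?u \<in> el_hom (Corolla n) (corolla ?k)" by (rule cmap_in[OF ck _ i]) simp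
    have c: "corolla_at R ?x \<in> el_hom (Corolla ?k) R" by (rule corolla_at_in[OF R M(2)])
    then have ce: "etale (corolla ?k) R (corolla_at R ?x)" by (simp add: el_hom_def)
    have "gcomp (corolla n) (corolla_at R ?x) ?u =
        cmap R n (onV (corolla_at R ?x) undefined) (\<lambda>j. onH (corolla_at R ?x) (onH m j))"
      by (rule gcomp_cmap[OF ce ck _ i 2(2)]) simp
    also have "\<dots> = cmap R n ?x (onH m)"
      using bij_betwE[OF M(1)] by (intro cmap_cong) (simp_all add: corolla_at_eq)
    also have "\<dots> = m" using M(3) by simp
    finally have cu: "gcomp (el_graph (Corolla n)) (corolla_at R ?x) ?u = m" by simp
    have "\<theta> (Corolla n) m = act F (Corolla n) (Corolla ?k) ?u (\<theta> (Corolla ?k) (corolla_at R ?x))"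
      if "nat_trans (rep R) F \<theta>" for \<theta>
      using nat_transD(2)[OF that, of "Corolla n" "Corolla ?k" ?u "corolla_at R ?x"] 2(2) k u c cu by simp
    then show ?thesis using \<phi> \<psi> C[OF M(2)] 2(1) by metis
  qed
qed

lemma diso_sym:
  fixes D :: "('u, 'a, 'h, 'v, 'x) dgraph" and D' :: "('u, 'b, 'k, 'w, 'x) dgraph"
  assumes i: "diso n D D'" and "\<And>k. k \<in> n \<Longrightarrow> lab D k \<in> arcs (gr D)"
  shows "diso n D' D"
proof -
  obtain h k where lab: "\<forall>k\<in>n. onA h (lab D k) = lab D' k"
    and dec: "\<And>e m. e \<in> el_ob \<Longrightarrow> m \<in> el_hom e (gr D) \<Longrightarrow> dec D' e (gcomp (el_graph e) h m) = dec D e m"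
    and h: "etale (gr D) (gr D') h" and k: "etale (gr D') (gr D) k"
    and kh: "gcomp (gr D) k h = gid (gr D)" and hk: "gcomp (gr D') h k = gid (gr D')"
    using i unfolding diso_def giso_def by blast
  have khA: "onA k (onA h a) = a" if "a \<in> arcs (gr D)" for a
    using arg_cong[OF kh, of "\<lambda>m. onA m a"] that by (simp add: gid_def)
  have "dec D e (gcomp (el_graph e) k m) = dec D' e m" if e: "e \<in> el_ob" and m: "m \<in> el_hom e (gr D')"
    for e :: "'u el" and m
  proof -
    have "gcomp (el_graph e) h (gcomp (el_graph e) k m) = m"
      using m by (simp add: gcomp_assoc_el[OF m] hk gcomp_gid_left el_hom_def)
    then show ?thesis using dec[OF e el_hom_gcomp[OF e m k]] by simp
  qed
  moreover have "giso (gr D') (gr D) k" using h k kh hk by (auto simp: giso_def)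
  moreover have "onA k (lab D' i) = lab D i" if "i \<in> n" for i
    using lab khA[OF assms(2)[OF that]] that by simp
  ultimately show ?thesis
    unfolding diso_def by (intro exI[of _ k]) simp
qed

lemma giso_bij:
  assumes h: "giso X Y h"
  shows "bij_betw (onH h) (hedges X) (hedges Y)" "bij_betw (onV h) (verts X) (verts Y)"
    "a \<in> arcs X \<Longrightarrow> onA h a \<in> ports Y \<longleftrightarrow> a \<in> ports X"
proof -
  obtain k where he: "etale X Y h" and k: "etale Y X k"
    and kh: "gcomp X k h = gid X" and hk: "gcomp Y h k = gid Y"
    using h unfolding giso_def by blast
  have H: "onH k (onH h f) = f" if "f \<in> hedges X" for f
    using arg_cong[OF kh, of "\<lambda>m. onH m f"] that by (simp add: gid_def)
  have H': "onH h (onH k f) = f" if "f \<in> hedges Y" for f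
    using arg_cong[OF hk, of "\<lambda>m. onH m f"] that by (simp add: gid_def)
  have V: "onV k (onV h f) = f" if "f \<in> verts X" for f
    using arg_cong[OF kh, of "\<lambda>m. onV m f"] that by (simp add: gid_def)
  have V': "onV h (onV k f) = f" if "f \<in> verts Y" for f
    using arg_cong[OF hk, of "\<lambda>m. onV m f"] that by (simp add: gid_def)
  have A: "onA k (onA h f) = f" if "f \<in> arcs X" for f
    using arg_cong[OF kh, of "\<lambda>m. onA m f"] that by (simp add: gid_def)
  show "bij_betw (onH h) (hedges X) (hedges Y)"
    by (rule bij_betw_byWitness[where f' = "onH k"]) (use H H' etaleD(2)[OF he] etaleD(2)[OF k] in auto)
  show "bij_betw (onV h) (verts X) (verts Y)"
    by (rule bij_betw_byWitness[where f' = "onV k"]) (use V V' etaleD(3)[OF he] etaleD(3)[OF k] in auto)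
  assume a: "a \<in> arcs X"
  have "onA h a \<in> src Y ` hedges Y \<longleftrightarrow> a \<in> src X ` hedges X"
  proof
    assume "onA h a \<in> src Y ` hedges Y"
    then obtain f where f: "f \<in> hedges Y" "onA h a = src Y f" by blast
    then have "a = src X (onH k f)" using A[OF a] etaleD(5)[OF k] by metis
    then show "a \<in> src X ` hedges X" using etaleD(2)[OF k f(1)] by blast
  next
    assume "a \<in> src X ` hedges X"
    then obtain f where f: "f \<in> hedges X" "a = src X f" by blast
    then show "onA h a \<in> src Y ` hedges Y"
      using etaleD(5)[OF he f(1)] etaleD(2)[OF he f(1)] by simp
  qed
  then show "onA h a \<in> ports Y \<longleftrightarrow> a \<in> ports X" using a etaleD(1)[OF he] by (simp add: ports_def)
qed

context refinement
begin

text \<open>The gluing of the fibres and \<open>Y\<close> itself, with its identity map, are both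
  cut out of \<open>Y\<close> along all vertices and with the same port positions, so
  \<open>emb_giso\<close> provides the isomorphism.\<close>

lemma kl_generic: "is_generic R Y kl"
proof -
  \<comment> \<open>Comparing graphs over \<open>Y\<close> takes a labelling of the ports of
    \<open>R\<close>; its half-edges that end in a port serve as labels.\<close>
  let ?T = "{f \<in> hedges R. flip R (src R f) \<in> ports R}" and ?l = "\<lambda>f. flip R (src R f)"
  have l: "bij_betw ?l ?T (ports R)"
    unfolding bij_betw_def
  proof
    show "inj_on ?l ?T"
      using graphD(2,4,5)[OF R(1)] by (intro inj_onI) (metis (no_types, lifting) mem_Collect_eq)
    show "?l ` ?T = ports R"
    proof
      show "ports R \<subseteq> ?l ` ?T"
      proof
        fix a assume a: "a \<in> ports R"
        obtain f where "f \<in> hedges R" "a = flip R (src R f)" by (rule port_cases[OF R(2,1) a])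
        then show "a \<in> ?l ` ?T" using a by blast
      qed
    qed auto
  qed
  have T: "flip Y (src Y (mF h f)) \<in> ports Y \<longleftrightarrow> flip R (src R f) \<in> ports R" if f: "f \<in> hedges R" for f
    using jinv_bm_of(2)[OF Y(1) hD(1)[OF f]] jinv_bm_of(2,4)[OF R(1) f] hD(6)[OF f]
      inj_on_eq_iff[OF hD(2) _ f] by simp
  have "\<exists>t. emb_gluing R Y kl (\<lambda>a. amap (onA (gid R) a)) (\<lambda>x. {v \<in> verts Y. mV h v = onV (gid R) x}) t"
    by (rule emb_gluing_kl[OF R etale_gid[OF R(1)] _ kl_nat_trans])
      (simp_all add: gid_def inj_on_def, simp add: gcomp_gid_left el_hom_def flip: gid_def)
  then obtain t where "emb_gluing R Y kl (\<lambda>a. amap (onA (gid R) a)) (\<lambda>x. {v \<in> verts Y. mV h v = onV (gid R) x}) t" ..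
  from emb_gluing.emb_glue[OF this l]
  have "emb Y ?T (\<Union>x\<in>verts R. {v \<in> verts Y. mV h v = onV (gid R) x}) (\<lambda>f. amap (onA (gid R) (?l f)))
      (glue \<lparr>gr = R, lab = ?l, dec = kl\<rparr>) (emb_gluing.glued_map R kl t)" (is "emb _ _ ?W ?\<alpha> ?D ?s") .
  moreover have "?W = verts Y" using hD(3) by (auto simp: gid_def)
  ultimately have e: "emb Y ?T (verts Y) ?\<alpha> ?D ?s" by simp
  have "emb Y ?T (verts Y) ?\<alpha> \<lparr>gr = Y, lab = (\<lambda>f. flip Y (src Y (mF h f))), dec = rep_map Y (gid Y)\<rparr> (gid Y)"
    unfolding emb_def dgraph.simps
  proof (intro conjI)
    show "bij_betw (\<lambda>f. flip Y (src Y (mF h f))) ?T (ports Y)"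
      unfolding bij_betw_def
    proof
      show "inj_on (\<lambda>f. flip Y (src Y (mF h f))) ?T"
      proof (rule inj_onI)
        fix f g assume "f \<in> ?T" "g \<in> ?T" and eq: "flip Y (src Y (mF h f)) = flip Y (src Y (mF h g))"
        then have f: "f \<in> hedges R" and g: "g \<in> hedges R" by simp_all
        have "src Y (mF h f) = src Y (mF h g)" using eq graphD(2,4)[OF Y(1)] hD(1) f g by metis
        then show "f = g" using graphD(5)[OF Y(1) hD(1)[OF f] hD(1)[OF g]] inj_onD[OF hD(2) _ f g] by simp
      qed
      show "(\<lambda>f. flip Y (src Y (mF h f))) ` ?T = ports Y"
      proof
        show "(\<lambda>f. flip Y (src Y (mF h f))) ` ?T \<subseteq> ports Y" using T by auto
        show "ports Y \<subseteq> (\<lambda>f. flip Y (src Y (mF h f))) ` ?T"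
        proof
          fix p assume p: "p \<in> ports Y"
          obtain y where y: "y \<in> hedges Y" "p = flip Y (src Y y)" by (rule port_cases[OF Y(2,1) p])
          then have "jinv (bm_of Y) y = y" using p jinv_bm_of(2)[OF Y(1)] by simp
          \<comment> \<open>A half-edge of \<open>Y\<close> that is a tail cannot be contracted by a
            compression, so it comes from \<open>R\<close>.\<close>
          then obtain f where f: "f \<in> hedges R" "y = mF h f" using hD(8)[OF y(1)] by blast
          then show "p \<in> (\<lambda>f. flip Y (src Y (mF h f))) ` ?T" using T[OF f(1)] p y by blast
        qed
      qed
    qed
    show "onV (gid Y) ` verts Y = verts Y" "inj_on (onV (gid Y)) (verts Y)" by (simp_all add: gid_def inj_on_def)
    show "\<forall>f\<in>?T. onA (gid Y) (flip Y (src Y (mF h f))) = ?\<alpha> f"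
      using graphD(1,4)[OF Y(1)] graphD(1,4)[OF R(1)] hD(1) amap_flip_src by (simp add: gid_def)
  qed (use Y etale_gid in auto)
  from emb_giso[OF e this Y(1)] obtain g where g: "giso (gr ?D) Y g" "gcomp (gr ?D) (gid Y) g = ?s"
    by auto
  \<comment> \<open>The comparison lies over \<open>Y\<close> and \<open>Y\<close> maps to itself by
    the identity, so the comparison is the glued map that induces \<open>glue_dec\<close>.\<close>
  have "g = ?s" using g gcomp_gid_left[of "gr ?D" Y g] by (simp add: giso_def)
  then show ?thesis
    using g(1) embD(8)[OF e] unfolding is_generic_def by (auto simp: glue_def Let_def)
qed

end

section \<open>Recovering a compression from a generic morphism\<close>

locale generic_gluing = gluing R "rep Y" \<phi> for R Y :: "'u ugraph" and \<phi> +
  fixes h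
  assumes Y: "is_graph Y" "no_isolated_edges Y"
    and h: "giso G Y h" and dec_h: "glue_dec R S = rep_map G h"
begin

lemma etale_h: "etale G Y h"
  using h by (simp add: giso_def)

definition t :: "'u \<Rightarrow> ('u, 'u + 'u, 'u, 'u) probe" where
  "t x = gcomp (gr (S x)) h (incl x)"

text \<open>The action of \<open>\<phi>\<close> on arcs: its value at the unit probe of an arc of
  \<open>R\<close> is the unit probe of an arc of \<open>Y\<close>.\<close>

definition \<alpha> :: "'u + 'u \<Rightarrow> 'u + 'u" where
  "\<alpha> a = onA (projl (\<phi> Unit (uprobe R a))) (Inl undefined)"

lemma etale_t: "x \<in> verts R \<Longrightarrow> etale (gr (S x)) Y (t x)"
  unfolding t_def by (rule etale_gcomp[OF etale_incl etale_h SD(1)])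

lemma dec_t:
  assumes x: "x \<in> verts R"
  shows "dec (S x) = rep_map (gr (S x)) (t x)"
proof (rule nat_trans_eqI[OF SD(4)[OF x] nat_trans_rep_map[OF etale_t[OF x]]])
  fix e :: "'u el" and k assume e: "e \<in> el_ob" and "k \<in> val (rep (gr (S x))) e"
  then have k: "k \<in> el_hom e (gr (S x))" by simp
  have "dec (S x) e k = rep_map G h e (gcomp (el_graph e) (incl x) k)"
    using glue_dec_incl[OF e x k] dec_h by simp
  also have "\<dots> = gcomp (el_graph e) (t x) k"
    using e el_hom_gcomp[OF e k etale_incl[OF x]] by (simp add: rep_map_def gcomp_assoc_el[OF k] t_def)
  finally show "dec (S x) e k = rep_map (gr (S x)) (t x) e k" using e k by (simp add: rep_map_def)
qed

lemma phi_alpha: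
  assumes a: "a \<in> arcs R"
  shows "\<phi> Unit (uprobe R a) = Inl (uprobe Y (\<alpha> a))" "\<alpha> a \<in> arcs Y"
proof -
  have "\<phi> Unit (uprobe R a) \<in> bar_val (rep Y) Unit"
    using nat_transD(1)[OF \<phi>, of Unit "uprobe R a"] uprobe_in[OF R(1) a] by simp
  then obtain p where p: "\<phi> Unit (uprobe R a) = Inl p" "p \<in> el_hom Unit Y" by auto
  then have "\<alpha> a = onA p (Inl undefined)" by (simp add: \<alpha>_def)
  then show "\<phi> Unit (uprobe R a) = Inl (uprobe Y (\<alpha> a))" "\<alpha> a \<in> arcs Y"
    using p uprobe_cases(1,2)[OF p(2)] by simp_all
qed

lemma alpha_flip:
  assumes a: "a \<in> arcs R"
  shows "\<alpha> (flip R a) = flip Y (\<alpha> a)"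
proof -
  let ?u = "uprobe (unit_graph :: 'u ugraph) (Inr undefined) :: ('u, _, _, _) probe"
  have U: "is_graph (unit_graph :: 'u ugraph)" using is_graph_el_graph[of Unit] by simp
  have i: "Inr undefined \<in> arcs (unit_graph :: 'u ugraph)" by (simp add: unit_graph_def)
  have u: "?u \<in> el_hom Unit unit_graph" by (rule uprobe_in[OF U i])
  have *: "gcomp unit_graph (uprobe Z b) ?u = uprobe Z (flip Z b)" if "is_graph Z" "b \<in> arcs Z"
    for Z :: "'u ugraph" and b
    using gcomp_uprobe[OF _ U i, of Z "uprobe Z b"] uprobe_in[OF that] by (simp add: el_hom_def)
  have "\<phi> Unit (gcomp unit_graph (uprobe R a) ?u) = bar_act (rep Y) Unit Unit ?u (\<phi> Unit (uprobe R a))"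
    using nat_transD(2)[OF \<phi>, of Unit Unit ?u "uprobe R a"] u uprobe_in[OF R(1) a] by simp
  then have "(Inl (uprobe Y (\<alpha> (flip R a))) :: ('u, ('u, _, _, _) probe) bar) = Inl (uprobe Y (flip Y (\<alpha> a)))"
    using phi_alpha[OF a] phi_alpha(1)[OF graphD(1)[OF R(1) a]] *[OF R(1) a] *[OF Y(1)] by simp
  then have "(uprobe Y (\<alpha> (flip R a)) :: ('u, _, _, _) probe) = uprobe Y (flip Y (\<alpha> a))" by simp
  from arg_cong[OF this, of "\<lambda>p. onA p (Inl undefined)"] show ?thesis by simp
qed

text \<open>The decoration of the piece at its port \<open>f\<close> is computed in two ways, from
  \<open>\<phi>\<close> at the corresponding arc of \<open>R\<close> and from the map
  \<open>t\<close> to \<open>Y\<close>.\<close>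

lemma t_lab:
  assumes f: "f \<in> hedges R"
  shows "onA (t (vtx R f)) (lab (S (vtx R f)) f) = \<alpha> (flip R (src R f))"
proof -
  let ?x = "vtx R f" and ?u = "uprobe (gr (S (vtx R f))) (lab (S (vtx R f)) f) :: ('u, _, _, _) probe"
  have x: "?x \<in> verts R" by (rule vtxR(1)[OF f])
  have a: "flip R (src R f) \<in> arcs R" using graphD(1,4)[OF R(1)] f by blast
  have u: "?u \<in> el_hom Unit (gr (S ?x))" by (rule uprobe_in[OF SD(1)[OF x] lab_port(2)[OF f]])
  have "dec (S ?x) Unit ?u = uprobe Y (onA (t ?x) (lab (S ?x) f))"
    using u gcomp_uprobe[OF etale_t[OF x] SD(1)[OF x] lab_port(2)[OF f]] by (simp add: dec_t[OF x] rep_map_def)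
  then have "(uprobe Y (\<alpha> (flip R (src R f))) :: ('u, _, _, _) probe) = uprobe Y (onA (t ?x) (lab (S ?x) f))"
    using phi_Unit(1)[OF f] phi_alpha(1)[OF a] by simp
  from arg_cong[OF this, of "\<lambda>p. onA p (Inl undefined)"] show ?thesis by simp
qed

lemmas h_bij = giso_bij[OF h]

lemma emb_piece:
  assumes x: "x \<in> verts R"
  shows "emb Y (flags_at R x) (onV h ` ({x} \<times> verts (gr (S x)))) (\<lambda>f. \<alpha> (flip R (src R f))) (S x) (t x)"
  unfolding emb_def
proof (intro conjI)
  have V: "onV (t x) v = onV h (x, v)" if "v \<in> verts (gr (S x))" for v
    using that by (simp add: t_def incl_simps)
  show "inj_on (onV (t x)) (verts (gr (S x)))"
  proof (rule inj_onI)
    fix v w assume v: "v \<in> verts (gr (S x))" "w \<in> verts (gr (S x))" "onV (t x) v = onV (t x) w"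
    then have eq: "onV h (x, v) = onV h (x, w)" by (simp add: V)
    have inj: "inj_on (onV h) (verts G)" using h_bij(2) by (simp add: bij_betw_def)
    have "(x, v) \<in> verts G" "(x, w) \<in> verts G" using v x by (auto simp: G_simps)
    then have "(x, v) = (x, w)" by (rule inj_onD[OF inj eq])
    then show "v = w" by simp
  qed
  show "onV (t x) ` verts (gr (S x)) = onV h ` ({x} \<times> verts (gr (S x)))"
    using V by force
  show "\<forall>f\<in>flags_at R x. onA (t x) (lab (S x) f) = \<alpha> (flip R (src R f))"
    using t_lab by (auto simp: flags_at_def)
qed (use SD(1-3)[OF x] etale_t[OF x] dec_t[OF x] in blast)+

text \<open>The value is a class containing \<open>S x\<close>, which is cut out of \<open>Y\<close>
  by the restriction of \<open>h\<close>. A graph defining the class is isomorphic to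
  \<open>S x\<close>, so it is cut out in the same way.\<close>

lemma phi_corolla_at:
  assumes x: "x \<in> verts R"
  shows "\<phi> (Corolla (flags_at R x)) (corolla_at R x) =
    Inr (cls Y (flags_at R x) (onV h ` ({x} \<times> verts (gr (S x)))) (\<lambda>f. \<alpha> (flip R (src R f))))"
proof -
  obtain D :: "('u, ('u, 'u + 'u, 'u, 'u) probe) udgraph" where D: "is_dgraph (rep Y) (flags_at R x) D"
    "\<phi> (Corolla (flags_at R x)) (corolla_at R x) = Inr (iso_class (rep Y) (flags_at R x) D)"
    "S x \<in> iso_class (rep Y) (flags_at R x) D" by (rule piece_class[OF x])
  have "diso (flags_at R x) (S x) D"
    by (rule diso_sym[OF _ is_dgraphD(7)[OF D(1)]]) (use D(3) in \<open>simp add: iso_class_def\<close>)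
  from emb_transport[OF emb_piece[OF x] this D(1)]
  obtain s where s: "emb Y (flags_at R x) (onV h ` ({x} \<times> verts (gr (S x)))) (\<lambda>f. \<alpha> (flip R (src R f))) D s" ..
  have ne: "onV h ` ({x} \<times> verts (gr (S x))) \<noteq> {}" using SD(5)[OF x] by blast
  show ?thesis using iso_class_emb[OF s ne Y(1)] D(2) by simp
qed

text \<open>The flag at which \<open>f\<close> enters its piece. It exists because the neighbour of
  a port is no port, edges of a piece not being isolated.\<close>

definition entry :: "'u \<Rightarrow> 'u" where
  "entry f = (SOME g. g \<in> hedges (gr (S (vtx R f))) \<and>
     src (gr (S (vtx R f))) g = flip (gr (S (vtx R f))) (lab (S (vtx R f)) f))"

lemma entry:
  assumes "f \<in> hedges R"
  shows "entry f \<in> hedges (gr (S (vtx R f)))"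
    "src (gr (S (vtx R f))) (entry f) = flip (gr (S (vtx R f))) (lab (S (vtx R f)) f)"
proof -
  have "\<exists>g. g \<in> hedges (gr (S (vtx R f))) \<and>
     src (gr (S (vtx R f))) g = flip (gr (S (vtx R f))) (lab (S (vtx R f)) f)"
    using lab_port(3,4)[OF assms] by (auto simp: ports_def)
  from someI_ex[OF this] show "entry f \<in> hedges (gr (S (vtx R f)))"
    "src (gr (S (vtx R f))) (entry f) = flip (gr (S (vtx R f))) (lab (S (vtx R f)) f)"
    by (simp_all add: entry_def)
qed

lemma entry_G: "f \<in> hedges R \<Longrightarrow> (vtx R f, entry f) \<in> hedges G"
  using entry(1) vtxR(1) by (simp add: G_simps)

text \<open>The formulas are forced: \<open>mF\<close> must send \<open>f\<close> to the half-edge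
  with \<open>src\<close> equal to \<open>\<alpha> (src R f)\<close>, and \<open>mV\<close> must
  send a vertex of \<open>Y\<close> to the vertex of \<open>R\<close> whose piece contains it. The
  isomorphism \<open>h\<close> makes both well defined.\<close>

definition the_compression :: "'u bm_mor" where
  "the_compression = (let F = (\<lambda>f\<in>hedges R. onH h (vtx R f, entry f)) in
     \<lparr>mF = F, mV = (\<lambda>v\<in>verts Y. fst (inv_into (verts G) (onV h) v)),
      mj = restrict (jinv (bm_of Y)) (hedges Y - F ` hedges R)\<rparr>)"

abbreviation c where "c \<equiv> the_compression"

lemma c_simps:
  "f \<in> hedges R \<Longrightarrow> mF c f = onH h (vtx R f, entry f)"
  "x \<in> verts R \<Longrightarrow> v \<in> verts (gr (S x)) \<Longrightarrow> mV c (onV h (x, v)) = x"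
proof -
  show "f \<in> hedges R \<Longrightarrow> mF c f = onH h (vtx R f, entry f)" by (simp add: the_compression_def Let_def)
  assume "x \<in> verts R" "v \<in> verts (gr (S x))"
  then have "(x, v) \<in> verts G" by (simp add: G_simps)
  then show "mV c (onV h (x, v)) = x"
    using h_bij(2) by (auto simp: the_compression_def Let_def bij_betw_def)
qed

lemma verts_cases:
  assumes "v \<in> verts Y"
  obtains x w where "x \<in> verts R" "w \<in> verts (gr (S x))" "v = onV h (x, w)"
proof -
  have "v \<in> onV h ` verts G" using assms h_bij(2) by (simp add: bij_betw_def)
  then show thesis using that by (auto simp: G_simps)
qed

lemma hedges_cases:
  assumes "y \<in> hedges Y"
  obtains x g where "x \<in> verts R" "g \<in> hedges (gr (S x))" "y = onH h (x, g)"
proof -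
  have "y \<in> onH h ` hedges G" using assms h_bij(1) by (simp add: bij_betw_def)
  then show thesis using that by (auto simp: G_simps)
qed

lemma h_hedges_inject:
  "x \<in> verts R \<Longrightarrow> g \<in> hedges (gr (S x)) \<Longrightarrow> y \<in> verts R \<Longrightarrow> k \<in> hedges (gr (S y)) \<Longrightarrow>
    onH h (x, g) = onH h (y, k) \<Longrightarrow> x = y \<and> g = k"
  using h_bij(1) inj_onD[of "onH h" "hedges G" "(x, g)" "(y, k)"] by (simp add: bij_betw_def G_simps)

lemma vtx_h:
  assumes "x \<in> verts R" "g \<in> hedges (gr (S x))"
  shows "mV c (vtx Y (onH h (x, g))) = x"
proof -
  have "vtx Y (onH h (x, g)) = onV h (x, vtx (gr (S x)) g)"
    using etaleD(6)[OF etale_h, of "(x, g)"] assms by (simp add: G_simps)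
  then show ?thesis using c_simps(2)[OF assms(1) graphD(6)[OF SD(1)[OF assms(1)] assms(2)]] by simp
qed

lemma h_src: "x \<in> verts R \<Longrightarrow> g \<in> hedges (gr (S x)) \<Longrightarrow>
    src Y (onH h (x, g)) = onA (t x) (src (gr (S x)) g)"
  using etaleD(5)[OF etale_t, of x g] by (simp add: t_def incl_simps)

text \<open>The port \<open>f\<close> of the piece stands for the arc opposite
  \<open>src R f\<close>. Hence \<open>src R f\<close> itself corresponds to the neighbour of that
  port, which is the \<open>src\<close> of \<open>entry f\<close>.\<close>

lemma alpha_src:
  assumes f: "f \<in> hedges R"
  shows "\<alpha> (src R f) = src Y (mF c f)"
proof -
  have x: "vtx R f \<in> verts R" by (rule vtxR(1)[OF f])
  have "src Y (mF c f) = onA (t (vtx R f)) (flip (gr (S (vtx R f))) (lab (S (vtx R f)) f))"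
    using h_src[OF x entry(1)[OF f]] entry(2)[OF f] c_simps(1)[OF f] by simp
  also have "\<dots> = flip Y (\<alpha> (flip R (src R f)))"
    using etaleD(4)[OF etale_t[OF x] lab_port(2)[OF f]] t_lab[OF f] by simp
  also have "\<dots> = \<alpha> (src R f)"
    using alpha_flip[of "flip R (src R f)"] graphD(1,2,4)[OF R(1)] f by simp
  finally show ?thesis by simp
qed

text \<open>Flags of \<open>Y\<close> missed by \<open>mF c\<close> lie on inner edges of a single
  piece, so they are no tails and \<open>mV c\<close> is constant along their edges. On the image,
  compatibility with the involutions reflects that tails of \<open>R\<close> leave ports unglued
  while inner edges are governed by \<open>alpha_flip\<close>.\<close>

lemma refinement_c: "refinement R Y c"
proof
  show "is_graph R" "no_isolated_edges R" "is_graph Y" "no_isolated_edges Y" by (fact R Y)+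
  have F_in: "mF c f \<in> hedges Y" if "f \<in> hedges R" for f
    using etaleD(2)[OF etale_h entry_G[OF that]] c_simps(1)[OF that] by simp
  have V_in: "mV c v \<in> verts R" if "v \<in> verts Y" for v
    using verts_cases[OF that] c_simps(2) by metis
  have flip_F: "flip Y (src Y (mF c f)) = \<alpha> (flip R (src R f))" if "f \<in> hedges R" for f
    using alpha_flip alpha_src graphD(4)[OF R(1)] that by simp
  have K: "jinv (bm_of Y) y \<noteq> y \<and> mV c (vtx Y (jinv (bm_of Y) y)) = mV c (vtx Y y)"
    if y: "y \<in> hedges Y - mF c ` hedges R" for y
  proof -
    obtain x g where g: "x \<in> verts R" "g \<in> hedges (gr (S x))" "y = onH h (x, g)"
      using hedges_cases y by blast
    note X = SD(1)[OF g(1)]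
    let ?a = "flip (gr (S x)) (src (gr (S x)) g)"
    have sg: "src (gr (S x)) g \<in> arcs (gr (S x))" by (rule graphD(4)[OF X g(2)])
    \<comment> \<open>A half-edge opposite to a port of its piece is the entry of the label of that
      port, so its image would belong to \<open>mF c\<close>.\<close>
    have "?a \<notin> ports (gr (S x))"
    proof
      assume "?a \<in> ports (gr (S x))"
      then obtain f where "f \<in> flags_at R x" "?a = lab (S x) f"
        using SD(3)[OF g(1)] by (auto simp: bij_betw_def)
      then have f: "f \<in> hedges R" "vtx R f = x" "?a = lab (S x) f" by (simp_all add: flags_at_def)
      have "src (gr (S x)) (entry f) = src (gr (S x)) g"
        using entry(2)[OF f(1)] f graphD(2)[OF X sg] by simp
      then have "entry f = g" using graphD(5)[OF X _ g(2)] entry(1)[OF f(1)] f(2) by simp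
      then have "y = mF c f" using f c_simps(1) g(3) by simp
      then show False using y f(1) by blast
    qed
    then obtain k where k: "k \<in> hedges (gr (S x))" "?a = src (gr (S x)) k"
      using graphD(1)[OF X sg] by (auto simp: ports_def)
    have "flip Y (src Y y) = src Y (onH h (x, k))"
      using h_src g k etaleD(4)[OF etale_t[OF g(1)] sg] by simp
    moreover have kY: "onH h (x, k) \<in> hedges Y"
      using etaleD(2)[OF etale_h, of "(x, k)"] g(1) k(1) by (simp add: G_simps)
    ultimately have j: "jinv (bm_of Y) y = onH h (x, k)" using jinv_bm_of(1)[OF Y(1)] y by simp
    have "k \<noteq> g" using graphD(3)[OF X sg] k(2) by auto
    then have "onH h (x, k) \<noteq> onH h (x, g)" using h_hedges_inject g k by blast
    then show ?thesis using j vtx_h g k by simp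
  qed
  show "comp_mor (bm_of Y) (bm_of R) c"
    unfolding comp_mor_def bm_of_simps
  proof (intro conjI ballI)
    show "mF c \<in> hedges R \<rightarrow>\<^sub>E hedges Y"
      using F_in by (auto simp: PiE_def extensional_def) (simp add: the_compression_def Let_def)
    show "mV c \<in> verts Y \<rightarrow>\<^sub>E verts R"
      using V_in by (auto simp: PiE_def extensional_def) (simp add: the_compression_def Let_def)
    show "inj_on (mF c) (hedges R)"
    proof (rule inj_onI)
      fix f g assume f: "f \<in> hedges R" and g: "g \<in> hedges R" and "mF c f = mF c g"
      then have "vtx R f = vtx R g \<and> entry f = entry g"
        using h_hedges_inject[OF vtxR(1)[OF f] entry(1)[OF f] vtxR(1)[OF g] entry(1)[OF g]]
        by (simp add: c_simps)
      \<comment> \<open>Equal entries in equal pieces mean equal neighbours, and a neighbour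
        determines its port and hence its label.\<close>
      then have "nb f = nb g" using entry(2)[OF f] entry(2)[OF g] by (simp add: nb_def)
      then show "f = g" by (rule nb_inject[OF f g])
    qed
    show "mV c ` verts Y = verts R"
    proof
      show "mV c ` verts Y \<subseteq> verts R" using V_in by blast
      show "verts R \<subseteq> mV c ` verts Y"
      proof
        fix x assume x: "x \<in> verts R"
        then obtain v where v: "v \<in> verts (gr (S x))" using SD(5) by blast
        have "onV h (x, v) \<in> verts Y" using etaleD(3)[OF etale_h, of "(x, v)"] x v by (simp add: G_simps)
        then show "x \<in> mV c ` verts Y" using c_simps(2)[OF x v] by (metis imageI)
      qed
    qed
    have "mF c ` hedges R = (\<lambda>f\<in>hedges R. onH h (vtx R f, entry f)) ` hedges R"
      by (simp add: c_simps)
    then show "mj c = restrict (jinv (bm_of Y)) (hedges Y - mF c ` hedges R)"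
      by (simp add: the_compression_def Let_def)
    show "jinv (bm_of Y) y \<noteq> y" "mV c (vtx Y (jinv (bm_of Y) y)) = mV c (vtx Y y)"
      if "y \<in> hedges Y - mF c ` hedges R" for y using K[OF that] by blast+
    fix f assume f: "f \<in> hedges R"
    show "mV c (vtx Y (mF c f)) = vtx R f" using vtx_h[OF vtxR(1) entry(1)] f c_simps(1) by simp
    show "jinv (bm_of Y) (mF c f) = mF c (jinv (bm_of R) f)"
    proof (cases "jinv (bm_of R) f = f")
      case True
      then have "flip R (src R f) \<in> ports R" using jinv_bm_of(2)[OF R(1) f] by simp
      \<comment> \<open>At a tail of \<open>R\<close> the port of the piece survives as a port of
        the gluing, and the isomorphism \<open>h\<close> carries ports to ports.\<close>
      then have "glue_class R S (pt f) \<in> ports G" using pt_port_iff[OF f] by simp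
      moreover have "glue_class R S (pt f) \<in> arcs G" using pt_nb_in(1)[OF f] by (simp add: G_simps)
      ultimately have "onA h (glue_class R S (pt f)) \<in> ports Y" using h_bij(3) by blast
      moreover have "onA h (glue_class R S (pt f)) = onA (t (vtx R f)) (lab (S (vtx R f)) f)"
        using lab_port(2)[OF f] by (simp add: t_def incl_simps pt_def)
      ultimately have "flip Y (src Y (mF c f)) \<in> ports Y" using t_lab[OF f] flip_F[OF f] by simp
      then show ?thesis using jinv_bm_of(2)[OF Y(1) F_in[OF f]] True by simp
    next
      case False
      let ?f = "jinv (bm_of R) f"
      have f': "?f \<in> hedges R" by (rule jinv_bm_of(4)[OF R(1) f])
      have "flip Y (src Y (mF c f)) = src Y (mF c ?f)"
        using flip_F[OF f] jinv_bm_of(3)[OF R(1) f False] alpha_src[OF f'] by simp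
      then show ?thesis by (rule jinv_bm_of(1)[OF Y(1) F_in[OF f] F_in[OF f']])
    qed
  qed
qed

text \<open>Arcs and canonical corollas suffice. On arcs \<open>\<alpha>\<close> is the
  \<open>amap\<close> of the compression, and the vertices of the piece at \<open>x\<close> are by
  construction its fibre over \<open>x\<close>.\<close>

lemma phi_eq_kl: "\<phi> = refinement.kl R Y c"
proof -
  interpret c: refinement R Y c by (rule refinement_c)
  have am: "\<alpha> a = c.amap a" if "a \<in> arcs R" for a
    using alpha_src alpha_flip graphD(4)[OF R(1)] by (intro c.amap_unique[OF _ _ that]) simp_all
  show ?thesis
  proof (rule nat_trans_rep_eqI[OF \<phi> c.kl_nat_trans R(1)])
    fix a assume a: "a \<in> arcs R"
    show "\<phi> Unit (uprobe R a) = c.kl Unit (uprobe R a)"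
      using c.kl_Unit[OF uprobe_in[OF R(1) a]] phi_alpha(1)[OF a] am[OF a] by simp
  next
    fix x assume x: "x \<in> verts R"
    let ?n = "flags_at R x" and ?m = "corolla_at R x"
    have W: "onV h ` ({x} \<times> verts (gr (S x))) = {v \<in> verts Y. mV c v = x}"
    proof
      show "onV h ` ({x} \<times> verts (gr (S x))) \<subseteq> {v \<in> verts Y. mV c v = x}"
        using etaleD(3)[OF etale_h] c_simps(2)[OF x] x by (auto simp: G_simps)
      show "{v \<in> verts Y. mV c v = x} \<subseteq> onV h ` ({x} \<times> verts (gr (S x)))"
      proof
        fix v assume v: "v \<in> {v \<in> verts Y. mV c v = x}"
        then obtain y w where y: "y \<in> verts R" "w \<in> verts (gr (S y))" "v = onV h (y, w)"
          using verts_cases by blast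
        then have "y = x" using v c_simps(2) by simp
        then show "v \<in> onV h ` ({x} \<times> verts (gr (S x)))" using y by blast
      qed
    qed
    have "cls Y ?n V (\<lambda>f. \<alpha> (flip R (src R f))) = cls Y ?n V (\<lambda>k. c.amap (onA ?m (Inl k)))" for V
    proof (rule cls_cong)
      fix k assume k: "k \<in> ?n"
      then have "flip R (src R k) \<in> arcs R" using graphD(1,4)[OF R(1)] by (simp add: flags_at_def)
      then show "\<alpha> (flip R (src R k)) = c.amap (onA ?m (Inl k))" using am k by (simp add: corolla_at_eq)
    qed
    moreover have "onV ?m undefined = x" by (simp add: corolla_at_eq)
    ultimately show "\<phi> (Corolla ?n) ?m = c.kl (Corolla ?n) ?m"
      using phi_corolla_at[OF x] c.kl_Corolla[OF corolla_at_in[OF R(1) x] finite_flags_at[OF R(1)]] W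
      by simp
  qed
qed

end

lemma generic_iff_kl:
  fixes R Y :: "'u ugraph"
  assumes R: "is_graph R" "no_isolated_edges R" and Y: "is_graph Y" "no_isolated_edges Y"
  shows "nat_trans (rep R) (bar (rep Y)) \<phi> \<and> is_generic R Y \<phi> \<longleftrightarrow>
    (\<exists>h. comp_mor (bm_of Y) (bm_of R) h \<and> \<phi> = refinement.kl R Y h)"
proof
  assume *: "nat_trans (rep R) (bar (rep Y)) \<phi> \<and> is_generic R Y \<phi>"
  then obtain h where "giso (glue_graph R (piece R \<phi>)) Y h"
    "glue_dec R (piece R \<phi>) = rep_map (glue_graph R (piece R \<phi>)) h" by (auto simp: is_generic_def)
  then interpret generic_gluing R Y \<phi> h by unfold_locales (use assms * in simp_all)
  show "\<exists>h. comp_mor (bm_of Y) (bm_of R) h \<and> \<phi> = refinement.kl R Y h"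
    using refinement_c phi_eq_kl by (auto simp: refinement_def)
next
  assume "\<exists>h. comp_mor (bm_of Y) (bm_of R) h \<and> \<phi> = refinement.kl R Y h"
  then obtain h where c: "comp_mor (bm_of Y) (bm_of R) h" and \<phi>: "\<phi> = refinement.kl R Y h" by blast
  interpret refinement R Y h by unfold_locales (use assms c in simp_all)
  show "nat_trans (rep R) (bar (rep Y)) \<phi> \<and> is_generic R Y \<phi>"
    using kl_nat_trans kl_generic \<phi> by simp
qed

section \<open>The equivalence\<close>

definition gr_obj :: "'u ugraph \<Rightarrow> bool" where
  "gr_obj R \<longleftrightarrow> is_graph R \<and> no_isolated_edges R"

lemma refinement_iff:
  "gr_obj R \<Longrightarrow> gr_obj Y \<Longrightarrow> refinement R Y h \<longleftrightarrow> comp_mor (bm_of Y) (bm_of R) h"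
  by (simp add: refinement_def gr_obj_def)

lemma Gr_gen_simps:
  "Ob (op_cat Gr_tilde_gen) = {R. gr_obj R}"
  "Ident (op_cat Gr_tilde_gen) R = unit_tr (rep R)"
  "Cmp (op_cat Gr_tilde_gen) Z Y R \<phi> \<psi> = kl_comp R Y Z \<psi> \<phi>"
  "gr_obj R \<Longrightarrow> gr_obj Y \<Longrightarrow>
     Hom (op_cat Gr_tilde_gen) Y R = {refinement.kl R Y h | h. refinement R Y h}"
  using generic_iff_kl[of R Y] refinement_iff[of R Y]
  by (auto simp: op_cat_def Gr_tilde_gen_def Gr_tilde_def wide_sub_def gr_obj_def)

lemma gr_obj_simps:
  "gr_obj R \<Longrightarrow> is_bm_graph (bm_of R)" "gr_obj R \<Longrightarrow> refinement R R (bm_id (bm_of R))"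
  "gr_obj R \<Longrightarrow> refinement.kl R R (bm_id (bm_of R)) = unit_tr (rep R)"
  "is_bm_graph \<tau> \<Longrightarrow> gr_obj (phi_ob \<tau>)"
  by (simp_all add: gr_obj_def is_bm_graph_bm_of refinement_id kl_id is_graph_phi_ob no_isolated_edges_phi_ob)

lemma refinementD:
  "refinement R Y h \<Longrightarrow> comp_mor (bm_of Y) (bm_of R) h" "refinement R Y h \<Longrightarrow> gr_obj R"
  "refinement R Y h \<Longrightarrow> gr_obj Y"
  by (simp_all add: refinement_def gr_obj_def)

lemma bm_comp_refinement_id:
  assumes "refinement R Y h"
  shows "bm_comp (bm_of Y) (bm_of Y) (bm_of R) h (bm_id (bm_of Y)) = h"
    "bm_comp (bm_of Y) (bm_of R) (bm_of R) (bm_id (bm_of R)) h = h"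
  using bm_comp_id[OF refinementD(1)[OF assms]] refinementD(2,3)[OF assms] gr_obj_simps(1) by blast+

lemma is_category_Gr_gen: "is_category (op_cat Gr_tilde_gen)"
  unfolding is_category_def Gr_gen_simps(1) mem_Collect_eq
proof (intro conjI ballI)
  fix R :: "'a ugraph" assume "R \<in> {R. gr_obj R}"
  then have R: "gr_obj R" by simp
  then show "Ident (op_cat Gr_tilde_gen) R \<in> Hom (op_cat Gr_tilde_gen) R R"
    using gr_obj_simps(2)[OF R] gr_obj_simps(3)[OF R, symmetric] unfolding Gr_gen_simps(2) Gr_gen_simps(4)[OF R R]
    by blast
next
  fix Z Y R :: "'a ugraph" and f g
  assume "Z \<in> {R. gr_obj R}" "Y \<in> {R. gr_obj R}" "R \<in> {R. gr_obj R}"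
    and "f \<in> Hom (op_cat Gr_tilde_gen) Z Y" "g \<in> Hom (op_cat Gr_tilde_gen) Y R"
  then show "Cmp (op_cat Gr_tilde_gen) Z Y R g f \<in> Hom (op_cat Gr_tilde_gen) Z R"
    using kl_comp_kl refinement_comp by (auto simp: Gr_gen_simps) blast
next
  fix Y R :: "'a ugraph" and f
  assume "Y \<in> {R. gr_obj R}" "R \<in> {R. gr_obj R}" and "f \<in> Hom (op_cat Gr_tilde_gen) Y R"
  then obtain h where h: "refinement R Y h" "f = refinement.kl R Y h" by (auto simp: Gr_gen_simps)
  note O = refinementD(2,3)[OF h(1)]
  show "Cmp (op_cat Gr_tilde_gen) Y Y R f (Ident (op_cat Gr_tilde_gen) Y) = f"
    using kl_comp_kl[OF h(1) gr_obj_simps(2)[OF O(2)]] gr_obj_simps(3)[OF O(2)] h bm_comp_refinement_id[OF h(1)]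
    by (simp add: Gr_gen_simps)
  show "Cmp (op_cat Gr_tilde_gen) Y R R (Ident (op_cat Gr_tilde_gen) R) f = f"
    using kl_comp_kl[OF gr_obj_simps(2)[OF O(1)] h(1)] gr_obj_simps(3)[OF O(1)] h bm_comp_refinement_id[OF h(1)]
    by (simp add: Gr_gen_simps)
next
  fix X Y Z W :: "'a ugraph" and f g k
  assume "X \<in> {R. gr_obj R}" "Y \<in> {R. gr_obj R}" "Z \<in> {R. gr_obj R}" "W \<in> {R. gr_obj R}"
    and "f \<in> Hom (op_cat Gr_tilde_gen) X Y" "g \<in> Hom (op_cat Gr_tilde_gen) Y Z"
    "k \<in> Hom (op_cat Gr_tilde_gen) Z W"
  then obtain f' g' k' where f: "refinement Y X f'" "f = refinement.kl Y X f'"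
    and g: "refinement Z Y g'" "g = refinement.kl Z Y g'"
    and k: "refinement W Z k'" "k = refinement.kl W Z k'" by (auto simp: Gr_gen_simps)
  have "bm_comp (bm_of X) (bm_of Z) (bm_of W) k' (bm_comp (bm_of X) (bm_of Y) (bm_of Z) g' f') =
      bm_comp (bm_of X) (bm_of Y) (bm_of W) (bm_comp (bm_of Y) (bm_of Z) (bm_of W) k' g') f'"
    using f g k by (intro bm_comp_assoc) (auto intro: refinementD gr_obj_simps(1))
  then show "Cmp (op_cat Gr_tilde_gen) X Z W k (Cmp (op_cat Gr_tilde_gen) X Y Z g f) =
      Cmp (op_cat Gr_tilde_gen) X Y W (Cmp (op_cat Gr_tilde_gen) Y Z W k g) f"
    using kl_comp_kl[OF g(1) f(1)] kl_comp_kl[OF k(1) g(1)] kl_comp_kl[OF k(1) refinement_comp[OF g(1) f(1)]]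
      kl_comp_kl[OF refinement_comp[OF k(1) g(1)] f(1)] f g k by (simp add: Gr_gen_simps)
qed

lemma Phi2_simps [simp]: "FOb Phi2 = phi_ob" "FMor Phi2 = phi_mor"
  by (simp_all add: Phi2_def)

text \<open>\<open>bm_comp\<close> and \<open>bm_id\<close> look only at the carriers of their
  objects, and forgetting the ports of \<open>phi_ob\<close> restores these.\<close>

lemma bm_comp_bm_of_phi_ob:
  "bm_comp (bm_of (phi_ob \<tau>)) (bm_of (phi_ob \<sigma>)) (bm_of (phi_ob \<rho>)) c g = bm_comp \<tau> \<sigma> \<rho> c g"
  "bm_id (bm_of (phi_ob \<tau>)) = bm_id \<tau>"
  by (simp_all add: bm_comp_def bm_id_def cong: if_cong)

lemma is_functor_Phi2: "is_functor BM_comp (op_cat Gr_tilde_gen) Phi2"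
  unfolding is_functor_def
proof (intro conjI ballI is_category_BM_comp is_category_Gr_gen)
  fix \<tau> :: "'a bm_graph" assume "\<tau> \<in> Ob BM_comp"
  then have \<tau>: "is_bm_graph \<tau>" by (simp add: BM_comp_simps)
  then show "FOb Phi2 \<tau> \<in> Ob (op_cat Gr_tilde_gen)" by (simp add: Gr_gen_simps gr_obj_simps)
  show "FMor Phi2 \<tau> \<tau> (Ident BM_comp \<tau>) = Ident (op_cat Gr_tilde_gen) (FOb Phi2 \<tau>)"
    using gr_obj_simps(3)[OF gr_obj_simps(4)[OF \<tau>]] phi_mor_eq_kl[OF \<tau> \<tau> comp_mor_id[OF \<tau>]]
    by (simp add: BM_comp_simps Gr_gen_simps bm_comp_bm_of_phi_ob)
next
  fix \<tau> \<sigma> :: "'a bm_graph" and h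
  assume "\<tau> \<in> Ob BM_comp" "\<sigma> \<in> Ob BM_comp" "h \<in> Hom BM_comp \<tau> \<sigma>"
  then have *: "is_bm_graph \<tau>" "is_bm_graph \<sigma>" "comp_mor \<tau> \<sigma> h" by (simp_all add: BM_comp_simps)
  then show "FMor Phi2 \<tau> \<sigma> h \<in> Hom (op_cat Gr_tilde_gen) (FOb Phi2 \<tau>) (FOb Phi2 \<sigma>)"
    using refinement_phi_ob[OF *] by (auto simp: Gr_gen_simps gr_obj_simps phi_mor_eq_kl)
next
  fix \<tau> \<sigma> \<rho> :: "'a bm_graph" and g c
  assume "\<tau> \<in> Ob BM_comp" "\<sigma> \<in> Ob BM_comp" "\<rho> \<in> Ob BM_comp"
    and "g \<in> Hom BM_comp \<tau> \<sigma>" "c \<in> Hom BM_comp \<sigma> \<rho>"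
  then have O: "is_bm_graph \<tau>" "is_bm_graph \<sigma>" "is_bm_graph \<rho>" and g: "comp_mor \<tau> \<sigma> g"
    and c: "comp_mor \<sigma> \<rho> c" by (simp_all add: BM_comp_simps)
  show "FMor Phi2 \<tau> \<rho> (Cmp BM_comp \<tau> \<sigma> \<rho> c g) = Cmp (op_cat Gr_tilde_gen) (FOb Phi2 \<tau>) (FOb Phi2 \<sigma>)
      (FOb Phi2 \<rho>) (FMor Phi2 \<sigma> \<rho> c) (FMor Phi2 \<tau> \<sigma> g)"
    using O g c comp_mor_comp[OF g c O] kl_comp_kl[OF refinement_phi_ob[OF O(2,3) c] refinement_phi_ob[OF O(1,2) g]]
    by (simp add: BM_comp_simps Gr_gen_simps phi_mor_eq_kl bm_comp_bm_of_phi_ob)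
qed

section \<open>The quasi-inverse functor\<close>

definition Psi2 :: "('u ugraph, 'u kl_mor, 'u bm_graph, 'u bm_mor) func" where
  "Psi2 = \<lparr>FOb = bm_of, FMor = (\<lambda>Y R \<phi>. THE h. refinement R Y h \<and> \<phi> = refinement.kl R Y h)\<rparr>"

text \<open>The definite description in \<open>Psi2\<close> is justified by
  \<open>kl_inject\<close>; on hom sets the functor inverts the passage from compressions to Kleisli
  morphisms.\<close>

lemma Psi2_simps:
  "FOb Psi2 = bm_of" "refinement R Y h \<Longrightarrow> FMor Psi2 Y R (refinement.kl R Y h) = h"
proof -
  assume h: "refinement R Y h"
  have "(THE k. refinement R Y k \<and> refinement.kl R Y h = refinement.kl R Y k) = h"
    using h kl_inject[OF h] by (intro the_equality) blast+
  then show "FMor Psi2 Y R (refinement.kl R Y h) = h" by (simp add: Psi2_def)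
qed (simp add: Psi2_def)

lemma is_functor_Psi2: "is_functor (op_cat Gr_tilde_gen) BM_comp Psi2"
  unfolding is_functor_def
proof (intro conjI ballI is_category_BM_comp is_category_Gr_gen)
  fix R :: "'a ugraph" assume "R \<in> Ob (op_cat Gr_tilde_gen)"
  then have R: "gr_obj R" by (simp add: Gr_gen_simps)
  then show "FOb Psi2 R \<in> Ob BM_comp" by (simp add: Psi2_simps BM_comp_simps gr_obj_simps)
  show "FMor Psi2 R R (Ident (op_cat Gr_tilde_gen) R) = Ident BM_comp (FOb Psi2 R)"
    using Psi2_simps(2)[OF gr_obj_simps(2)[OF R]] gr_obj_simps(3)[OF R]
    by (simp add: Psi2_simps(1) BM_comp_simps Gr_gen_simps)
next
  fix Y R :: "'a ugraph" and f
  assume "Y \<in> Ob (op_cat Gr_tilde_gen)" "R \<in> Ob (op_cat Gr_tilde_gen)" "f \<in> Hom (op_cat Gr_tilde_gen) Y R"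
  then obtain h where h: "refinement R Y h" "f = refinement.kl R Y h" by (auto simp: Gr_gen_simps)
  then show "FMor Psi2 Y R f \<in> Hom BM_comp (FOb Psi2 Y) (FOb Psi2 R)"
    using refinementD[OF h(1)] by (simp add: Psi2_simps BM_comp_simps gr_obj_simps)
next
  fix Z Y R :: "'a ugraph" and f g
  assume "Z \<in> Ob (op_cat Gr_tilde_gen)" "Y \<in> Ob (op_cat Gr_tilde_gen)" "R \<in> Ob (op_cat Gr_tilde_gen)"
    and "f \<in> Hom (op_cat Gr_tilde_gen) Z Y" "g \<in> Hom (op_cat Gr_tilde_gen) Y R"
  then obtain f' g' where f: "refinement Y Z f'" "f = refinement.kl Y Z f'"
    and g: "refinement R Y g'" "g = refinement.kl R Y g'" by (auto simp: Gr_gen_simps)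
  show "FMor Psi2 Z R (Cmp (op_cat Gr_tilde_gen) Z Y R g f) =
      Cmp BM_comp (FOb Psi2 Z) (FOb Psi2 Y) (FOb Psi2 R) (FMor Psi2 Y R g) (FMor Psi2 Z Y f)"
    using f g kl_comp_kl[OF g(1) f(1)] Psi2_simps(2)[OF refinement_comp[OF g(1) f(1)]]
    by (simp add: Psi2_simps BM_comp_simps Gr_gen_simps)
qed

text \<open>Forgetting the ports of \<open>phi_ob \<tau>\<close> leaves a graph that agrees with \<open>\<tau>\<close> on its carriers, so the
  identity maps are the components of the unit and, via \<open>refinement.kl\<close>, of the counit.\<close>

lemma comp_mor_phi_ob_id:
  assumes \<tau>: "is_bm_graph \<tau>"
  shows "comp_mor \<tau> (bm_of (phi_ob \<tau>)) (bm_id \<tau>)" "comp_mor (bm_of (phi_ob \<tau>)) \<tau> (bm_id \<tau>)"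
proof -
  show "comp_mor \<tau> (bm_of (phi_ob \<tau>)) (bm_id \<tau>)"
    by (rule comp_mor_cong[OF _ _ _ _ \<tau> \<tau> _ _ comp_mor_id[OF \<tau>]]) (simp_all add: jinv_phi_ob[OF \<tau>])
  show "comp_mor (bm_of (phi_ob \<tau>)) \<tau> (bm_id \<tau>)"
    by (rule comp_mor_cong[OF _ _ _ _ \<tau> \<tau> _ _ comp_mor_id[OF \<tau>]]) (simp_all add: jinv_phi_ob[OF \<tau>])
qed

theorem proposition5p4:
  shows "is_equivalence (BM_comp :: ('u::infinite bm_graph, 'u bm_mor) category)
           (op_cat Gr_tilde_gen) Phi2"
  unfolding is_equivalence_def
proof (intro conjI exI)
  show "is_functor BM_comp (op_cat Gr_tilde_gen) Phi2" by (rule is_functor_Phi2)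
  show "is_functor (op_cat Gr_tilde_gen) BM_comp Psi2" by (rule is_functor_Psi2)
  show "nat_iso (BM_comp :: ('u bm_graph, 'u bm_mor) category) BM_comp id_func (comp_func Psi2 Phi2) bm_id"
    unfolding nat_iso_def
  proof (intro conjI ballI)
    fix \<tau> :: "'u bm_graph" assume "\<tau> \<in> Ob BM_comp"
    then have \<tau>: "is_bm_graph \<tau>" by (simp add: BM_comp_simps)
    have B: "is_bm_graph (bm_of (phi_ob \<tau>))" by (rule gr_obj_simps(1)[OF gr_obj_simps(4)[OF \<tau>]])
    have "bm_comp \<tau> (bm_of (phi_ob \<tau>)) \<tau> (bm_id \<tau>) (bm_id \<tau>) = bm_id \<tau>"
      "bm_comp (bm_of (phi_ob \<tau>)) \<tau> (bm_of (phi_ob \<tau>)) (bm_id \<tau>) (bm_id \<tau>) = bm_id (bm_of (phi_ob \<tau>))"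
      using bm_comp_id(1)[OF comp_mor_id[OF \<tau>] \<tau> \<tau>] by (simp_all add: bm_comp_def bm_id_def cong: if_cong)
    then show "is_iso BM_comp (FOb id_func \<tau>) (FOb (comp_func Psi2 Phi2) \<tau>) (bm_id \<tau>)"
      using comp_mor_phi_ob_id[OF \<tau>] \<tau> B
      by (auto simp: is_iso_def id_func_def comp_func_def Psi2_simps(1) BM_comp_simps)
  next
    fix \<tau> \<sigma> :: "'u bm_graph" and h
    assume "\<tau> \<in> Ob BM_comp" "\<sigma> \<in> Ob BM_comp" "h \<in> Hom BM_comp \<tau> \<sigma>"
    then have *: "is_bm_graph \<tau>" "is_bm_graph \<sigma>" "comp_mor \<tau> \<sigma> h" by (simp_all add: BM_comp_simps)
    \<comment> \<open>Composition depends on objects through their carriers alone, so the middle and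
      final objects may be exchanged and naturality becomes the two identity laws.\<close>
    have "bm_comp \<tau> \<sigma> (bm_of (phi_ob \<sigma>)) (bm_id \<sigma>) h = bm_comp \<tau> \<sigma> \<sigma> (bm_id \<sigma>) h"
      "bm_comp \<tau> (bm_of (phi_ob \<tau>)) (bm_of (phi_ob \<sigma>)) h (bm_id \<tau>) = bm_comp \<tau> \<tau> \<sigma> h (bm_id \<tau>)"
      by (simp_all add: bm_comp_def cong: if_cong)
    then show "Cmp BM_comp (FOb id_func \<tau>) (FOb id_func \<sigma>) (FOb (comp_func Psi2 Phi2) \<sigma>) (bm_id \<sigma>)
        (FMor id_func \<tau> \<sigma> h) =
      Cmp BM_comp (FOb id_func \<tau>) (FOb (comp_func Psi2 Phi2) \<tau>) (FOb (comp_func Psi2 Phi2) \<sigma>)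
        (FMor (comp_func Psi2 Phi2) \<tau> \<sigma> h) (bm_id \<tau>)"
      using bm_comp_id[OF *(3,1,2)]
      by (simp add: id_func_def comp_func_def Psi2_simps(1) BM_comp_simps phi_mor_eq_kl[OF *]
          Psi2_simps(2)[OF refinement_phi_ob[OF *]])
  qed
  \<comment> \<open>As a Kleisli morphism the component runs from \<open>R\<close> to
    \<open>phi_ob (bm_of R)\<close>; in the opposite category this is the required direction of the
    counit.\<close>
  let ?\<epsilon> = "\<lambda>R :: 'u ugraph. refinement.kl R (phi_ob (bm_of R)) (bm_id (bm_of R))"
  show "nat_iso (op_cat Gr_tilde_gen) (op_cat Gr_tilde_gen) (comp_func Phi2 Psi2) id_func ?\<epsilon>"
    unfolding nat_iso_def
  proof (intro conjI ballI)
    fix R :: "'u ugraph" assume "R \<in> Ob (op_cat Gr_tilde_gen)"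
    then have R: "gr_obj R" by (simp add: Gr_gen_simps)
    let ?U = "bm_of R" let ?P = "phi_ob ?U"
    have U: "is_bm_graph ?U" by (rule gr_obj_simps(1)[OF R])
    have P: "gr_obj ?P" by (rule gr_obj_simps(4)[OF U])
    have e: "refinement R ?P (bm_id ?U)" and e': "refinement ?P R (bm_id ?U)"
      using comp_mor_phi_ob_id[OF U] by (simp_all add: refinement_iff R P)
    have b: "bm_comp ?U (bm_of ?P) ?U (bm_id ?U) (bm_id ?U) = bm_id ?U"
      "bm_comp (bm_of ?P) ?U (bm_of ?P) (bm_id ?U) (bm_id ?U) = bm_id (bm_of ?P)"
      using bm_comp_id(1)[OF comp_mor_id[OF U] U U] by (simp_all add: bm_comp_def bm_id_def cong: if_cong)
    have "kl_comp R ?P R (refinement.kl ?P R (bm_id ?U)) (?\<epsilon> R) = unit_tr (rep R)"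
      "kl_comp ?P R ?P (?\<epsilon> R) (refinement.kl ?P R (bm_id ?U)) = unit_tr (rep ?P)"
      using kl_comp_kl[OF e e'] kl_comp_kl[OF e' e] b gr_obj_simps(3)[OF R] gr_obj_simps(3)[OF P] by simp_all
    then show "is_iso (op_cat Gr_tilde_gen) (FOb (comp_func Phi2 Psi2) R) (FOb id_func R) (?\<epsilon> R)"
      using e e' R P by (auto simp: is_iso_def id_func_def comp_func_def Psi2_simps(1) Gr_gen_simps)
  next
    fix Y R :: "'u ugraph" and f
    assume "Y \<in> Ob (op_cat Gr_tilde_gen)" "R \<in> Ob (op_cat Gr_tilde_gen)" "f \<in> Hom (op_cat Gr_tilde_gen) Y R"
    then obtain h where h: "refinement R Y h" "f = refinement.kl R Y h" by (auto simp: Gr_gen_simps)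
    note O = refinementD(2,3)[OF h(1)] and c = refinementD(1)[OF h(1)]
    let ?UR = "bm_of R" and ?UY = "bm_of Y"
    let ?PR = "phi_ob ?UR" and ?PY = "phi_ob ?UY"
    have U: "is_bm_graph ?UR" "is_bm_graph ?UY" by (simp_all add: gr_obj_simps O)
    have P: "gr_obj ?PR" "gr_obj ?PY" by (simp_all add: gr_obj_simps U)
    have eR: "refinement R ?PR (bm_id ?UR)" and eY: "refinement Y ?PY (bm_id ?UY)"
      using comp_mor_phi_ob_id[OF U(1)] comp_mor_phi_ob_id[OF U(2)] by (simp_all add: refinement_iff O P)
    have hP: "refinement ?PR ?PY h" by (rule refinement_phi_ob[OF U(2,1) c])
    have "bm_comp (bm_of ?PY) (bm_of ?PR) ?UR (bm_id ?UR) h = bm_comp ?UY ?UR ?UR (bm_id ?UR) h"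
      "bm_comp (bm_of ?PY) ?UY ?UR h (bm_id ?UY) = bm_comp ?UY ?UY ?UR h (bm_id ?UY)"
      by (simp_all add: bm_comp_def cong: if_cong)
    then have "bm_comp (bm_of ?PY) (bm_of ?PR) ?UR (bm_id ?UR) h = bm_comp (bm_of ?PY) ?UY ?UR h (bm_id ?UY)"
      using bm_comp_refinement_id[OF h(1)] by simp
    \<comment> \<open>The square of Kleisli morphisms is the image of a square of compressions,
      which commutes because its other two sides are identities on carriers.\<close>
    then have "kl_comp R ?PR ?PY (refinement.kl ?PR ?PY h) (?\<epsilon> R) = kl_comp R Y ?PY (?\<epsilon> Y) f"
      using kl_comp_kl[OF eR hP] kl_comp_kl[OF h(1) eY] h(2) by simp
    then show "Cmp (op_cat Gr_tilde_gen) (FOb (comp_func Phi2 Psi2) Y) (FOb (comp_func Phi2 Psi2) R)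
        (FOb id_func R) (?\<epsilon> R) (FMor (comp_func Phi2 Psi2) Y R f) =
      Cmp (op_cat Gr_tilde_gen) (FOb (comp_func Phi2 Psi2) Y) (FOb id_func Y) (FOb id_func R)
        (FMor id_func Y R f) (?\<epsilon> Y)"
      using h Psi2_simps(2)[OF h(1)] phi_mor_eq_kl[OF U(2,1) c]
      by (simp add: id_func_def comp_func_def Psi2_simps(1) Gr_gen_simps)
  qed
qed

end
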